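(* Let $\Omega$ be a bounded doubly connected region with parametrized boundary $\Gamma=\Gamma_0\cup\Gamma_1$ as in the context, let $f$ be the Ahlfors map of $\Omega$ with respect to a point $a_0\in\Omega$, let $a_0$ and $a_1=\alpha+\mathrm{i}\beta$ ($\alpha,\beta\in\mathbb{R}$) be the two zeros of $f$ in $\Omega$ (listed with multiplicity), and let $\theta(t)$ be the boundary correspondence function of $f$. Write $z(t)=x(t)+\mathrm{i}y(t)$ with $x,y$ real, and put $$\phi=(\mathbf{I}+\mathbf{N}^*+\mathbf{J})\theta'-\psi,\qquad k_1(t)=\frac12\left[\phi(t)-2\,\mathrm{Im}\left(\frac{z'(t)}{z(t)-a_0}\right)\right],$$ $$k_2(t)=y'(t)-2k_1(t)x(t),\qquad k_3(t)=-2k_1(t)y(t)-x'(t),$$ $$k_4(t)=k_1(t)x(t)^2+k_1(t)y(t)^2+x'(t)y(t)-y'(t)x(t).$$ Then for every $t\in J$ $$\mathrm{Im}\left[\frac{z'(t)}{z(t)-a_1}\right]=k_1(t)\qquad\text{and}\qquad k_2(t)\,\alpha+k_3(t)\,\beta+k_1(t)\,(\alpha^2+\beta^2)=-k_4(t).$$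
   Context: Setting. $\Omega\subset\mathbb{C}$ is a bounded region whose boundary $\Gamma=\Gamma_0\cup\Gamma_1$ consists of two disjoint smooth Jordan curves, with $\Gamma_1$ in the interior of $\Gamma_0$. $\Gamma_0$ is oriented counterclockwise and $\Gamma_1$ clockwise, so that $\Omega$ lies to the left. Each $\Gamma_j$ is parametrized, in the direction of its orientation, by a $2\pi$-periodic three times continuously differentiable function $z_j(t)$, $t\in J_j=[0,2\pi]$, with $z_j'(t)\neq 0$. $J$ is the disjoint union of $J_0$ and $J_1$, and $z(t)=z_j(t)$ for $t\in J_j$. Integration over $J$ means the sum of the integrals over $J_0$ and $J_1$. Ahlfors map. For $a_0\in\Omega$, the Ahlfors map $f$ is the unique analytic function from $\Omega$ into the unit disk $D$ with $f(a_0)=0$, $f'(a_0)>0$ and $f'(a_0)$ maximal among all analytic maps $h:\Omega\to D$ with $h(a_0)=0$ and $h'(a_0)>0$. It maps $\Omega$ onto $D$ in a two-to-one fashion, extends to $\Gamma$ and maps each $\Gamma_j$ one-to-one onto the unit circle. The boundary correspondence function $\theta$ is a real function on $J$, differentiable on each $J_j$, with $f(z(t))=e^{\mathrm{i}\theta(t)}$. Operators. $N^*(t,s)=\frac1\pi\,\mathrm{Im}\left(\frac{z'(t)}{z(t)-z(s)}\right)$ for $t\ne s$, $N^*(t,t)=\frac{1}{2\pi}\mathrm{Im}\left(\frac{z''(t)}{z'(t)}\right)$, and $\mathbf{N}^*\nu(t)=\int_J N^*(t,s)\nu(s)\,ds$. $\mathbf{J}\nu(t)=0$ for $t\in J_0$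 and $\mathbf{J}\nu(t)=\frac{1}{2\pi}\int_{J_1}\nu(s)\,ds$ for $t\in J_1$. $\mathbf{I}$ is the identity. $\psi(t)=0$ for $t\in J_0$ and $\psi(t)=1$ for $t\in J_1$. *)

theory Defs
  imports "HOL-Complex_Analysis.Complex_Analysis" "HOL-Library.Multiset"
begin

text \<open>
  The parameter domain \<open>J\<close> is the disjoint union of \<open>J\<^sub>0 = J\<^sub>1 = [0, 2\<pi>]\<close>. A point of \<open>J\<close> is given
  by an index \<open>j \<in> {0, 1}\<close> and a parameter \<open>t \<in> [0, 2\<pi>]\<close>, so a function on \<open>J\<close> is a curried
  function of \<open>j\<close> and \<open>t\<close> whose values for other arguments are irrelevant. The parametrizations
  themselves are defined on the whole real line, being periodic.
\<close>

abbreviation J_range :: "real set" where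
  "J_range \<equiv> {0..2 * pi}"

definition integral_J :: "(nat \<Rightarrow> real \<Rightarrow> real) \<Rightarrow> real" where
  "integral_J \<nu> = (\<Sum>j\<in>{0, 1}. integral J_range (\<nu> j))"

definition vderiv :: "(real \<Rightarrow> complex) \<Rightarrow> real \<Rightarrow> complex" where
  "vderiv p t = vector_derivative p (at t)"

definition C3 :: "(real \<Rightarrow> complex) \<Rightarrow> bool" where
  "C3 p \<longleftrightarrow> (\<forall>k<3. \<forall>t. (vderiv ^^ k) p differentiable (at t)) \<and> continuous_on UNIV ((vderiv ^^ 3) p)"

text \<open>The library's paths are parametrized over the unit interval.\<close>

definition unit_path :: "(real \<Rightarrow> complex) \<Rightarrow> real \<Rightarrow> complex" where
  "unit_path p u = p (2 * pi * u)"

definition regular_jordan_param :: "(real \<Rightarrow> complex) \<Rightarrow> bool" where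
  "regular_jordan_param p \<longleftrightarrow>
     (\<forall>t. p (t + 2 * pi) = p t) \<and> C3 p \<and> (\<forall>t. vderiv p t \<noteq> 0) \<and> simple_path (unit_path p)"

definition curve :: "(real \<Rightarrow> complex) \<Rightarrow> complex set" where
  "curve p = p ` J_range"

definition counterclockwise :: "(real \<Rightarrow> complex) \<Rightarrow> bool" where
  "counterclockwise p \<longleftrightarrow> (\<forall>w\<in>inside (curve p). winding_number (unit_path p) w = 1)"

definition clockwise :: "(real \<Rightarrow> complex) \<Rightarrow> bool" where
  "clockwise p \<longleftrightarrow> (\<forall>w\<in>inside (curve p). winding_number (unit_path p) w = - 1)"

definition doubly_connected_region :: "complex set \<Rightarrow> (nat \<Rightarrow> real \<Rightarrow> complex) \<Rightarrow> bool" where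
  "doubly_connected_region \<Omega> z \<longleftrightarrow>
     open \<Omega> \<and> connected \<Omega> \<and> bounded \<Omega> \<and>
     regular_jordan_param (z 0) \<and> regular_jordan_param (z 1) \<and>
     frontier \<Omega> = curve (z 0) \<union> curve (z 1) \<and>
     curve (z 0) \<inter> curve (z 1) = {} \<and> curve (z 1) \<subseteq> inside (curve (z 0)) \<and>
     counterclockwise (z 0) \<and> clockwise (z 1)"

text \<open>
  Positivity of a derivative includes that it is real. Only the values of \<open>f\<close> in \<open>\<Omega>\<close> matter;
  uniqueness of the extremal function is a consequence of this definition.
\<close>

definition ahlfors_competitor :: "complex set \<Rightarrow> complex \<Rightarrow> (complex \<Rightarrow> complex) \<Rightarrow> bool" where
  "ahlfors_competitor \<Omega> a h \<longleftrightarrow>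
     h holomorphic_on \<Omega> \<and> h ` \<Omega> \<subseteq> ball 0 1 \<and> h a = 0 \<and> deriv h a \<in> \<real> \<and> Re (deriv h a) > 0"

definition ahlfors_map :: "complex set \<Rightarrow> complex \<Rightarrow> (complex \<Rightarrow> complex) \<Rightarrow> bool" where
  "ahlfors_map \<Omega> a f \<longleftrightarrow>
     ahlfors_competitor \<Omega> a f \<and>
     (\<forall>h. ahlfors_competitor \<Omega> a h \<longrightarrow> Re (deriv h a) \<le> Re (deriv f a))"

text \<open>\<open>M\<close> is the multiset of zeros of \<open>f\<close> in \<open>\<Omega>\<close>; at a point with \<open>f w \<noteq> 0\<close> the order is 0.\<close>

definition zeros_with_multiplicity ::
    "(complex \<Rightarrow> complex) \<Rightarrow> complex set \<Rightarrow> complex multiset \<Rightarrow> bool" where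
  "zeros_with_multiplicity f \<Omega> M \<longleftrightarrow>
     {w \<in> \<Omega>. f w = 0} = set_mset M \<and> (\<forall>w\<in>\<Omega>. zorder f w = int (count M w))"

text \<open>\<open>f\<close> also denotes its values on the boundary, i.e. those of its continuous extension.\<close>

definition boundary_correspondence ::
    "(complex \<Rightarrow> complex) \<Rightarrow> (nat \<Rightarrow> real \<Rightarrow> complex) \<Rightarrow> (nat \<Rightarrow> real \<Rightarrow> real) \<Rightarrow> bool" where
  "boundary_correspondence f z \<theta> \<longleftrightarrow>
     (\<forall>j\<in>{0, 1}. \<theta> j differentiable_on J_range \<and>
        (\<forall>t\<in>J_range. f (z j t) = exp (\<i> * complex_of_real (\<theta> j t))))"

text \<open>One-sided at the two end points of \<open>[0, 2\<pi>]\<close>.\<close>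

definition deriv_J :: "(nat \<Rightarrow> real \<Rightarrow> real) \<Rightarrow> nat \<Rightarrow> real \<Rightarrow> real" where
  "deriv_J \<theta> j t = vector_derivative (\<theta> j) (at t within J_range)"

text \<open>
  For \<open>j = k\<close> and \<open>{t, s} = {0, 2\<pi>}\<close> the first branch divides by zero and gives 0; this concerns
  a single point \<open>s\<close> and does not influence the integral.
\<close>

definition Nstar_kernel ::
    "(nat \<Rightarrow> real \<Rightarrow> complex) \<Rightarrow> nat \<Rightarrow> real \<Rightarrow> nat \<Rightarrow> real \<Rightarrow> real" where
  "Nstar_kernel z j t k s =
     (if (j, t) \<noteq> (k, s) then 1 / pi * Im (vderiv (z j) t / (z j t - z k s))
      else 1 / (2 * pi) * Im (vderiv (vderiv (z j)) t / vderiv (z j) t))"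

definition Nstar_op ::
    "(nat \<Rightarrow> real \<Rightarrow> complex) \<Rightarrow> (nat \<Rightarrow> real \<Rightarrow> real) \<Rightarrow> nat \<Rightarrow> real \<Rightarrow> real" where
  "Nstar_op z \<nu> j t = integral_J (\<lambda>k s. Nstar_kernel z j t k s * \<nu> k s)"

definition J_op :: "(nat \<Rightarrow> real \<Rightarrow> real) \<Rightarrow> nat \<Rightarrow> real \<Rightarrow> real" where
  "J_op \<nu> j t = (if j = 1 then 1 / (2 * pi) * integral J_range (\<nu> 1) else 0)"

definition psi :: "nat \<Rightarrow> real \<Rightarrow> real" where
  "psi j t = (if j = 1 then 1 else 0)"

definition phi ::
    "(nat \<Rightarrow> real \<Rightarrow> complex) \<Rightarrow> (nat \<Rightarrow> real \<Rightarrow> real) \<Rightarrow> nat \<Rightarrow> real \<Rightarrow> real" where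
  "phi z \<theta> j t =
     deriv_J \<theta> j t + Nstar_op z (deriv_J \<theta>) j t + J_op (deriv_J \<theta>) j t - psi j t"

definition k1 ::
    "(nat \<Rightarrow> real \<Rightarrow> complex) \<Rightarrow> complex \<Rightarrow> (nat \<Rightarrow> real \<Rightarrow> real) \<Rightarrow> nat \<Rightarrow> real \<Rightarrow> real" where
  "k1 z a0 \<theta> j t = 1 / 2 * (phi z \<theta> j t - 2 * Im (vderiv (z j) t / (z j t - a0)))"

end

theory Submission
  imports Defs
begin

text \<open>
  Let \<open>C w\<close> be the integral of \<open>\<theta>'(s) / (z(s) - w)\<close> over \<open>J\<close>. As \<open>\<i> \<theta>'\<close> is the boundary value of the logarithmic
  derivative of \<open>f\<close> along \<open>\<Gamma>\<close>, the argument principle with weight \<open>1 / (\<zeta> - w)\<close> gives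
  \<open>C w = 2 \<pi> (1 / (a\<^sub>0 - w) + 1 / (a\<^sub>1 - w))\<close> for \<open>w\<close> outside the closure of \<open>\<Omega>\<close>. Multiply by \<open>z'(t)\<close>, take imaginary
  parts and let \<open>w\<close> tend to \<open>z(t)\<close> along the outer normal: the jump of the Cauchy integral turns the left-hand side into
  \<open>- \<pi> (\<theta>' + \<^bold>N\<^sup>* \<theta>')(t)\<close>. Finally \<open>\<^bold>J \<theta>' = \<psi>\<close>, because \<open>\<theta>\<close> increases by a positive multiple of \<open>2 \<pi>\<close> on each of the two
  curves and by \<open>4 \<pi>\<close> in total.

  Since \<open>\<theta>'\<close> is merely known to exist, the integrals are first taken in the Henstock-Kurzweil sense and the limits are
  obtained by moving the derivative to the smooth kernel. Comparing the limits of \<open>C\<close> from both sides with \<open>\<bar>f\<bar> < 1\<close>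
  yields \<open>\<theta>' \<ge> 0\<close>; then \<open>\<theta>'\<close> is absolutely integrable and dominated convergence becomes available.
\<close>

subsection \<open>Integration by parts for a density that is only a derivative\<close>

text \<open>\<open>f\<close> is not known to have a derivative on the boundary, so everything
  happens on the parallel curves \<open>z \<plusminus> \<i> \<delta> z'\<close> with \<delta>
  tending to 0. Displacing by a multiple of \<open>z'\<close> instead of the unit normal turns
  \<open>(z s - w) / z' t\<close> into \<open>zeta t s \<mp> \<i> \<delta>\<close>, where
  \<open>zeta t s\<close> is s - t up to a uniform quadratic error: all kernels become perturbations
  of kernels on the real line. The difference of the Cauchy kernels at the two displaced points is
  then close to \<open>2 \<i>\<close> times the Poisson kernel, and their sum is close to a real
  kernel. The limit from outside is half of sum minus difference. The difference converges for every
  density that is a derivative, and this yields the sign of \<open>\<theta>'\<close>; the sum is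
  dominated by a multiple of \<open>\<theta>'\<close> and therefore has to come afterwards. The same
  jump computation with density \<open>z'\<close> shows which side of each curve is the left one.
  That neither increment of \<theta> vanishes is a separate argument by analytic continuation. The
  limits are taken at interior parameters; the end points follow by continuity.\<close>

lemma has_integral_by_parts_vector:
  fixes \<Theta> K :: "real \<Rightarrow> complex"
  assumes "a \<le> b"
    and \<Theta>: "\<And>s. s \<in> {a..b} \<Longrightarrow> (\<Theta> has_vector_derivative \<Theta>' s) (at s within {a..b})"
    and K: "\<And>s. s \<in> {a..b} \<Longrightarrow> (K has_vector_derivative K' s) (at s within {a..b})"
    and K': "continuous_on {a..b} K'"
  shows "((\<lambda>s. K s * \<Theta>' s) has_integral
           K b * \<Theta> b - K a * \<Theta> a - integral {a..b} (\<lambda>s. K' s * \<Theta> s)) {a..b}"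
proof -
  have cont: "continuous_on {a..b} \<Theta>"
    using \<Theta> by (meson continuous_on_eq_continuous_within has_vector_derivative_continuous)
  have "((\<lambda>s. K s * \<Theta> s) has_vector_derivative (K s * \<Theta>' s + K' s * \<Theta> s)) (at s within {a..b})"
    if "s \<in> {a..b}" for s
    using has_vector_derivative_mult[OF K[OF that] \<Theta>[OF that]] by (simp add: add.commute)
  \<comment> \<open>The fundamental theorem for the gauge integral holds for every derivative,
    however irregular \<open>\<Theta>'\<close> is.\<close>
  then have 1: "((\<lambda>s. K s * \<Theta>' s + K' s * \<Theta> s) has_integral K b * \<Theta> b - K a * \<Theta> a) {a..b}"
    by (intro fundamental_theorem_of_calculus \<open>a \<le> b\<close>) auto
  have "((\<lambda>s. K' s * \<Theta> s) has_integral integral {a..b} (\<lambda>s. K' s * \<Theta> s)) {a..b}"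
    using cont K' by (intro integrable_integral integrable_continuous_real continuous_intros)
  from has_integral_diff[OF 1 this] show ?thesis by simp
qed

text \<open>There is no dominating function for \<open>K x s * \<Theta>' s\<close>. After
  integration by parts only the continuous \<open>\<Theta>\<close> meets the kernel and its
  derivative, and joint continuity on a compact interval suffices.\<close>

lemma continuous_on_integral_by_parts:
  fixes \<Theta> :: "real \<Rightarrow> complex" and K :: "'p::topological_space \<Rightarrow> real \<Rightarrow> complex"
  assumes "a \<le> b"
    and \<Theta>: "\<And>s. s \<in> {a..b} \<Longrightarrow> (\<Theta> has_vector_derivative \<Theta>' s) (at s within {a..b})"
    and K: "\<And>x s. x \<in> U \<Longrightarrow> s \<in> {a..b} \<Longrightarrow> (K x has_vector_derivative K' x s) (at s within {a..b})"
    and cK: "continuous_on (U \<times> {a..b}) (\<lambda>(x, s). K x s)"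
    and cK': "continuous_on (U \<times> {a..b}) (\<lambda>(x, s). K' x s)"
  shows "continuous_on U (\<lambda>x. integral {a..b} (\<lambda>s. K x s * \<Theta>' s))"
proof -
  have c\<Theta>: "continuous_on {a..b} \<Theta>"
    using \<Theta> by (meson continuous_on_eq_continuous_within has_vector_derivative_continuous)
  have sec: "continuous_on {a..b} (K' x)" if "x \<in> U" for x
    using continuous_on_compose2[OF cK', of "{a..b}" "\<lambda>s. (x, s)"] that
      continuous_on_Pair[OF continuous_on_const continuous_on_id, of "{a..b}" x] by auto
  have sec2: "continuous_on U (\<lambda>x. K x s)" if "s \<in> {a..b}" for s
    using continuous_on_compose2[OF cK, of U "\<lambda>x. (x, s)"] that
      continuous_on_Pair[OF continuous_on_id continuous_on_const, of U s] by (simp add: image_subset_iff)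
  have I: "((\<lambda>s. K x s * \<Theta>' s) has_integral
           K x b * \<Theta> b - K x a * \<Theta> a - integral {a..b} (\<lambda>s. K' x s * \<Theta> s)) {a..b}" if "x \<in> U" for x
    using has_integral_by_parts_vector[OF \<open>a \<le> b\<close> \<Theta> K[OF that] sec[OF that]] by simp
  have "continuous_on (U \<times> cbox a b) (\<lambda>(x, s). K' x s * \<Theta> s)"
    using cK' unfolding split_beta box_real
    by (intro continuous_intros continuous_on_compose2[OF c\<Theta> continuous_on_snd]) auto
  from integral_continuous_on_param[OF this]
  have "continuous_on U (\<lambda>x. integral {a..b} (\<lambda>s. K' x s * \<Theta> s))" by simp
  then have "continuous_on U (\<lambda>x. K x b * \<Theta> b - K x a * \<Theta> a - integral {a..b} (\<lambda>s. K' x s * \<Theta> s))"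
    using \<open>a \<le> b\<close> by (intro continuous_intros sec2) auto
  then show "continuous_on U (\<lambda>x. integral {a..b} (\<lambda>s. K x s * \<Theta>' s))"
    by (rule continuous_on_eq) (simp add: integral_unique[OF I])
qed

lemma has_vector_derivative_shift:
  assumes "(q has_vector_derivative d) (at (t + c))"
  shows "((\<lambda>s. q (s + c)) has_vector_derivative d) (at t)"
proof -
  have "((\<lambda>s. s + c) has_vector_derivative 1) (at t)"
    using has_vector_derivative_add_const[of "\<lambda>s. s" c] has_vector_derivative_id by blast
  from vector_diff_chain_at[OF this assms] show ?thesis by (simp add: o_def)
qed

subsection \<open>Kernels on a single regular Jordan curve\<close>

locale jordan_param =
  fixes p :: "real \<Rightarrow> complex"
  assumes param: "regular_jordan_param p"
begin

abbreviation "p' \<equiv> vderiv p"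
abbreviation "p'' \<equiv> vderiv p'"

lemma periodic: "p (t + 2 * pi) = p t"
  using param unfolding regular_jordan_param_def by blast

lemma deriv_nz [simp]: "p' t \<noteq> 0"
  using param unfolding regular_jordan_param_def by blast

lemma has_deriv: "(p has_vector_derivative p' t) (at t within S)"
  and has_deriv2: "(p' has_vector_derivative p'' t) (at t within S)"
  and cont2: "continuous_on T p''"
proof -
  have C: "\<And>k t. k < 3 \<Longrightarrow> (vderiv ^^ k) p differentiable (at t)"
    using param unfolding regular_jordan_param_def C3_def by blast
  have "p differentiable (at t)" "p' differentiable (at t)" "\<And>t. p'' differentiable (at t)"
    using C[of 0] C[of 1] C[of 2] by (simp_all add: eval_nat_numeral)
  then show "(p has_vector_derivative p' t) (at t within S)"
    "(p' has_vector_derivative p'' t) (at t within S)"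
    "continuous_on T p''"
    unfolding vderiv_def
    by (auto simp: vector_derivative_works intro: has_vector_derivative_at_within
      intro!: differentiable_imp_continuous_on differentiable_at_imp_differentiable_on)
qed

lemma cont: "continuous_on T p" and cont1: "continuous_on T p'"
  by (meson continuous_on_eq_continuous_within has_vector_derivative_continuous has_deriv has_deriv2)+

lemmas cont_comp [continuous_intros] =
  continuous_on_compose2[OF cont[of UNIV], simplified]
  continuous_on_compose2[OF cont1[of UNIV], simplified]
  continuous_on_compose2[OF cont2[of UNIV], simplified]

lemma periodic1: "p' (t + 2 * pi) = p' t"
proof -
  have "((\<lambda>s. p (s + 2*pi)) has_vector_derivative p' (t + 2*pi)) (at t)"
    by (intro has_vector_derivative_shift has_deriv)
  then show ?thesis using has_deriv[of t UNIV] unfolding periodic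
    using vector_derivative_unique_at by blast
qed

lemma periodic2: "p'' (t + 2 * pi) = p'' t"
proof -
  have "((\<lambda>s. p' (s + 2*pi)) has_vector_derivative p'' (t + 2*pi)) (at t)"
    by (intro has_vector_derivative_shift has_deriv2)
  then show ?thesis using has_deriv2[of t UNIV] unfolding periodic1
    using vector_derivative_unique_at by blast
qed

lemma periodic_int:
  fixes q :: "real \<Rightarrow> 'a"
  assumes "\<And>t. q (t + 2 * pi) = q t"
  shows "q (t + 2 * pi * of_int n) = q t"
proof -
  have N: "q (t + 2 * pi * real k) = q t" for k t
  proof (induction k)
    case (Suc k)
    have "q (t + 2 * pi * real (Suc k)) = q ((t + 2 * pi * real k) + 2 * pi)"
      by (simp add: algebra_simps)
    then show ?case using assms Suc by simp
  qed simp
  show ?thesis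
  proof (cases "n \<ge> 0")
    case True
    then show ?thesis using N[of t "nat n"] by simp
  next
    case False
    then show ?thesis using N[of "t + 2 * pi * of_int n" "nat (-n)"] by (simp add: algebra_simps)
  qed
qed

lemmas periodics = periodic_int[of p, OF periodic] periodic_int[of p', OF periodic1]
  periodic_int[of p'', OF periodic2]

lemma reduce_period:
  obtains n :: int and s where "t = s + 2 * pi * of_int n" "0 \<le> s" "s < 2 * pi"
proof -
  define n where "n = \<lfloor>t / (2*pi)\<rfloor>"
  have "of_int n \<le> t / (2*pi)" "t / (2*pi) < of_int n + 1"
    unfolding n_def by linarith+
  then have "2 * pi * of_int n \<le> t" "t < 2 * pi * (of_int n + 1)"
    by (auto simp: field_simps)
  then show ?thesis by (intro that[of "t - 2 * pi * of_int n" n]) (auto simp: algebra_simps)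
qed

lemma inj_p: assumes "p s = p t" "0 \<le> s" "s < 2 * pi" "0 \<le> t" "t < 2 * pi" shows "s = t"
proof -
  have "simple_path (unit_path p)" using param unfolding regular_jordan_param_def by blast
  then have "inj_on (unit_path p) {0..<1}"
    unfolding simple_path_def loop_free_def inj_on_def by fastforce
  from inj_onD[OF this, of "s/(2*pi)" "t/(2*pi)"] assms show ?thesis
    by (auto simp: unit_path_def)
qed

lemma periodic_bounded:
  fixes q :: "real \<Rightarrow> complex"
  assumes "\<And>t. q (t + 2 * pi) = q t" "continuous_on UNIV q"
  obtains B where "B > 0" "\<And>t. norm (q t) \<le> B"
proof -
  have "compact (q ` {0..2*pi})"
    by (intro compact_continuous_image continuous_on_subset[OF assms(2)]) auto
  then obtain B where B: "B > 0" "\<And>t. t \<in> {0..2*pi} \<Longrightarrow> norm (q t) \<le> B"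
    using compact_imp_bounded bounded_pos by (metis image_eqI)
  have "norm (q t) \<le> B" for t
  proof -
    obtain n s where "t = s + 2 * pi * of_int n" "0 \<le> s" "s < 2 * pi" by (rule reduce_period)
    then show ?thesis using B(2)[of s] periodic_int[of q, OF assms(1)] by simp
  qed
  with B(1) that show ?thesis by blast
qed

text \<open>The chord measured in units of the tangent at \<open>t\<close>: its derivative in
  \<open>s\<close> at \<open>s = t\<close> is 1, and displacing \<open>p t\<close> by
  \<open>\<i> \<delta> p' t\<close> shifts it by \<open>\<i> \<delta>\<close>.\<close>

definition zeta :: "real \<Rightarrow> real \<Rightarrow> complex" where
  "zeta t s = (p s - p t) / p' t"

text \<open>By periodicity \<open>p'\<close>, \<open>p''\<close> and \<open>1 / p'\<close> are
  bounded, so the second-order expansion is uniform in both variables. The sum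
  \<open>1 + B * C + B1 * C\<close> merely serves all three bounds with a single constant.\<close>

lemma zeta_taylor:
  obtains M where "M \<ge> 1" "\<And>t s. norm (zeta t s - of_real (s - t)) \<le> M * (s - t)\<^sup>2"
    "\<And>t s. norm (p' s / p' t) \<le> M"
proof -
  obtain B where B: "B > 0" "\<And>t. norm (p'' t) \<le> B" using periodic_bounded periodic2 cont2 by metis
  obtain B1 where B1: "B1 > 0" "\<And>t. norm (p' t) \<le> B1" using periodic_bounded periodic1 cont1 by metis
  have "continuous_on UNIV (\<lambda>t. 1 / p' t)" by (intro continuous_intros) auto
  then obtain C where C: "C > 0" "\<And>t. norm (1 / p' t) \<le> C"
    using periodic_bounded[of "\<lambda>t. 1 / p' t"] periodic1 by auto
  have lin: "norm (p' s - p' t) \<le> B * \<bar>s - t\<bar>" for s t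
  proof -
    have "onorm (\<lambda>h. h *\<^sub>R p'' x) \<le> B" for x
      using B(2)[of x] by (intro onorm_le) (auto simp: mult.commute[of B] intro!: mult_left_mono)
    with differentiable_bound[of UNIV p' "\<lambda>x h. h *\<^sub>R p'' x" B s t] has_deriv2[of _ UNIV]
    show ?thesis by (auto simp: has_vector_derivative_def)
  qed
  have tay: "norm (p s - p t - (s - t) *\<^sub>R p' t) \<le> B * (s - t)\<^sup>2" for s t
  proof -
    have "norm (p s - p t - (s - t) *\<^sub>R p' t) \<le> norm (s - t) * (B * \<bar>s - t\<bar>)"
    proof (rule vector_differentiable_bound_linearization[where S = "closed_segment t s"])
      show "norm (p' x - p' t) \<le> B * \<bar>s - t\<bar>" if "x \<in> closed_segment t s" for x
      proof -
        have "\<bar>x - t\<bar> \<le> \<bar>s - t\<bar>" using that unfolding closed_segment_eq_real_ivl by (auto split: if_splits)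
        then show ?thesis using lin[of x t] B(1) by (smt (verit) mult_left_mono)
      qed
    qed (auto intro: has_deriv)
    then show ?thesis by (simp add: power2_eq_square ac_simps)
  qed
  show ?thesis
  proof (rule that[of "1 + B * C + B1 * C"])
    show "1 \<le> 1 + B * C + B1 * C" using B B1 C by simp
    fix t s
    have "zeta t s - of_real (s - t) = (p s - p t - (s - t) *\<^sub>R p' t) * (1 / p' t)"
      by (simp add: zeta_def field_simps scaleR_conv_of_real)
    also have "norm \<dots> \<le> (B * (s - t)\<^sup>2) * C" unfolding norm_mult by (intro mult_mono tay C) (use B in auto)
    also have "\<dots> \<le> (1 + B * C + B1 * C) * (s - t)\<^sup>2"
      using B1 C B by (simp add: algebra_simps)
    finally show "norm (zeta t s - of_real (s - t)) \<le> (1 + B * C + B1 * C) * (s - t)\<^sup>2" .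
    have "norm (p' s * (1 / p' t)) \<le> B1 * C" unfolding norm_mult by (intro mult_mono B1 C) (use B1 in auto)
    then show "norm (p' s / p' t) \<le> 1 + B * C + B1 * C" using B C by (simp add: add_increasing)
  qed
qed

lemma zeta_periodic: "zeta t (s + 2 * pi * of_int n) = zeta t s" "zeta (t + 2 * pi * of_int n) s = zeta t s"
  by (simp_all add: zeta_def periodics)

text \<open>Simplicity of the curve makes \<open>zeta t (t + u)\<close> nonzero when
  \<open>u\<close> keeps distance \<eta> from 0 and from the period; compactness turns this into a
  lower bound. Hence a small value forces the parameters together modulo
  \<open>2 * pi\<close>.\<close>

lemma zeta_separated:
  assumes "\<eta> > 0"
  obtains c where "c > 0" "\<And>t s. norm (zeta t s) < c \<Longrightarrow> \<exists>n::int. \<bar>s - t - 2 * pi * of_int n\<bar> < \<eta>"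
proof -
  define K where "K = {0..2*pi} \<times> {\<eta>..2*pi-\<eta>}"
  have pos: "norm (zeta (fst x) (fst x + snd x)) > 0" if xK: "x \<in> K" for x
  proof -
    obtain t u where x: "x = (t, u)" "0 \<le> t" "t \<le> 2*pi" "\<eta> \<le> u" "u \<le> 2*pi-\<eta>"
      using xK by (cases x) (auto simp: K_def)
    obtain n t' where t': "t = t' + 2 * pi * of_int n" "0 \<le> t'" "t' < 2 * pi" by (rule reduce_period)
    obtain m s' where s': "t + u = s' + 2 * pi * of_int m" "0 \<le> s'" "s' < 2 * pi" by (rule reduce_period)
    have "p (t + u) \<noteq> p t"
    proof
      assume "p (t + u) = p t"
      then have "s' = t'" using inj_p[of s' t'] t' s' by (simp add: periodics)
      then have *: "u = 2 * pi * of_int (m - n)" using t' s' by (simp add: algebra_simps)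
      have "0 < u" "u < 2 * pi" using x assms by auto
      then have "0 < real_of_int (m - n)" "real_of_int (m - n) < 1"
        using * by (auto simp: zero_less_mult_iff)
      then have "0 < m - n" "m - n < 1" by (simp_all only: of_int_0_less_iff of_int_less_1_iff)
      then show False by linarith
    qed
    then show ?thesis by (simp add: x zeta_def)
  qed
  have "\<exists>c>0. \<forall>x\<in>K. c \<le> norm (zeta (fst x) (fst x + snd x))"
  proof (cases "K = {}")
    case False
    have "continuous_on K (\<lambda>x. norm (zeta (fst x) (fst x + snd x)))"
      unfolding zeta_def by (intro continuous_intros) auto
    moreover have "compact K" unfolding K_def by (intro compact_Times) auto
    ultimately obtain x where x: "x \<in> K"
      "\<And>y. y \<in> K \<Longrightarrow> norm (zeta (fst x) (fst x + snd x)) \<le> norm (zeta (fst y) (fst y + snd y))"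
      using continuous_attains_inf[of K "\<lambda>x. norm (zeta (fst x) (fst x + snd x))"] False by blast
    then show ?thesis using pos[OF x(1)] by blast
  qed (auto intro: exI[of _ 1])
  then obtain c where c: "c > 0" "\<And>x. x \<in> K \<Longrightarrow> c \<le> norm (zeta (fst x) (fst x + snd x))" by blast
  show ?thesis
  proof (rule that[OF c(1)])
    fix t s assume less: "norm (zeta t s) < c"
    obtain n t' where t': "t = t' + 2 * pi * of_int n" "0 \<le> t'" "t' < 2 * pi" by (rule reduce_period)
    obtain m u where u: "s - t = u + 2 * pi * of_int m" "0 \<le> u" "u < 2 * pi" by (rule reduce_period)
    have s: "s = t' + u + 2 * pi * of_int (n + m)" using u t' by (simp add: algebra_simps)
    have "zeta t s = zeta t' (t' + u)" unfolding s t' zeta_periodic ..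
    then have "(t', u) \<notin> K" using c(2)[of "(t', u)"] less by auto
    then consider "u < \<eta>" | "u > 2*pi - \<eta>" using t' K_def by force
    then show "\<exists>n::int. \<bar>s - t - 2 * pi * of_int n\<bar> < \<eta>"
    proof cases
      case 1 then show ?thesis using u by (intro exI[of _ m]) auto
    next
      case 2 then show ?thesis using u by (intro exI[of _ "m + 1"]) (auto simp: algebra_simps)
    qed
  qed
qed

end

text \<open>The number \<open>u + \<i> \<delta>\<close> has norm at least
  \<open>\<bar>u\<bar>\<close>, so a perturbation of size \<open>\<bar>u\<bar> / 4\<close> removes
  at most a quarter of it, whatever \<delta> is. For the second bound the sum of squares splits into
  the factors with \<open>\<i> \<delta>\<close> and \<open>- \<i> \<delta>\<close>.\<close>

lemma norm_perturbed_real_plus_imaginary: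
  fixes \<zeta> :: complex
  assumes "norm (\<zeta> - of_real u) \<le> \<bar>u\<bar> / 4"
  shows "sqrt (u\<^sup>2 + \<delta>\<^sup>2) / 2 \<le> norm (\<zeta> + \<i> * of_real \<delta>)"
    and "(u\<^sup>2 + \<delta>\<^sup>2) / 4 \<le> norm (\<zeta>\<^sup>2 + (of_real \<delta>)\<^sup>2)"
proof -
  have *: "sqrt (u\<^sup>2 + \<delta>\<^sup>2) / 2 \<le> norm (\<zeta> + \<i> * of_real \<delta>)" for \<delta>
  proof -
    have 1: "norm (of_real u + \<i> * of_real \<delta>) = sqrt (u\<^sup>2 + \<delta>\<^sup>2)" by (simp add: cmod_def)
    have 2: "\<bar>u\<bar> \<le> sqrt (u\<^sup>2 + \<delta>\<^sup>2)" by (simp add: real_le_rsqrt)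
    have "norm (of_real u + \<i> * of_real \<delta>) \<le> norm (\<zeta> + \<i> * of_real \<delta>) + norm (\<zeta> - of_real u)"
      using norm_triangle_ineq4[of "\<zeta> + \<i> * of_real \<delta>" "\<zeta> - of_real u"] by (simp add: add.commute)
    then show ?thesis using assms 1 2 by linarith
  qed
  show "sqrt (u\<^sup>2 + \<delta>\<^sup>2) / 2 \<le> norm (\<zeta> + \<i> * of_real \<delta>)" by (rule *)
  have "\<zeta>\<^sup>2 + (of_real \<delta>)\<^sup>2 = (\<zeta> + \<i> * of_real \<delta>) * (\<zeta> + \<i> * of_real (-\<delta>))"
    by (simp add: algebra_simps power2_eq_square)
  then have "norm (\<zeta>\<^sup>2 + (of_real \<delta>)\<^sup>2) = norm (\<zeta> + \<i> * of_real \<delta>) * norm (\<zeta> + \<i> * of_real (-\<delta>))"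
    by (simp only: norm_mult)
  also have "\<dots> \<ge> (sqrt (u\<^sup>2 + \<delta>\<^sup>2) / 2) * (sqrt (u\<^sup>2 + \<delta>\<^sup>2) / 2)"
    using *[of \<delta>] *[of "-\<delta>"] by (intro mult_mono) auto
  finally show "(u\<^sup>2 + \<delta>\<^sup>2) / 4 \<le> norm (\<zeta>\<^sup>2 + (of_real \<delta>)\<^sup>2)" by simp
qed

lemma poisson_kernel_has_integral:
  assumes "\<delta> > 0" "\<eta> \<ge> 0"
  shows "((\<lambda>s. \<delta> / ((s - t)\<^sup>2 + \<delta>\<^sup>2)) has_integral 2 * arctan (\<eta> / \<delta>)) {t - \<eta>..t + \<eta>}"
proof -
  have "((\<lambda>s. arctan ((s - t) / \<delta>)) has_vector_derivative \<delta> / ((s - t)\<^sup>2 + \<delta>\<^sup>2)) (at s within S)" for s S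
  proof -
    have "((\<lambda>s. arctan ((s - t) / \<delta>)) has_real_derivative inverse (1 + ((s - t) / \<delta>)\<^sup>2) * (1 / \<delta>)) (at s within S)"
      using assms by (auto intro!: derivative_eq_intros)
    moreover have "inverse (1 + ((s - t) / \<delta>)\<^sup>2) * (1 / \<delta>) = \<delta> / ((s - t)\<^sup>2 + \<delta>\<^sup>2)"
    proof -
      have "1 + ((s - t) / \<delta>)\<^sup>2 = ((s - t)\<^sup>2 + \<delta>\<^sup>2) / \<delta>\<^sup>2"
        using assms by (simp add: field_simps)
      then show ?thesis using assms by (simp add: power2_eq_square)
    qed
    ultimately show ?thesis by (simp add: has_real_derivative_iff_has_vector_derivative)
  qed
  from fundamental_theorem_of_calculus[OF _ this, of "t - \<eta>" "t + \<eta>"] assms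
  show ?thesis by (simp add: arctan_minus)
qed

section \<open>Jump of the Cauchy kernel across a Jordan curve\<close>

context jordan_param
begin

text \<open>The radius \<open>1 / (4 * M)\<close> is where the quadratic error drops below a quarter
  of \<open>\<bar>s - t\<bar>\<close>, as \<open>norm_perturbed_real_plus_imaginary\<close> demands;
  \<open>c\<close> is the separation constant belonging to that radius.\<close>

lemma zeta_normal_form:
  obtains M c where "M \<ge> 1" "c > 0"
    "\<And>t s. norm (zeta t s - of_real (s - t)) \<le> M * (s - t)\<^sup>2" "\<And>t s. norm (p' s / p' t) \<le> M"
    "\<And>t s. \<bar>s - t\<bar> \<le> 1 / (4 * M) \<Longrightarrow> norm (zeta t s - of_real (s - t)) \<le> \<bar>s - t\<bar> / 4"
    "\<And>t s. norm (zeta t s) < c \<Longrightarrow> \<exists>n::int. \<bar>s - t - 2 * pi * of_int n\<bar> \<le> 1 / (4 * M)"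
proof -
  obtain M where M: "M \<ge> 1" "\<And>t s. norm (zeta t s - of_real (s - t)) \<le> M * (s - t)\<^sup>2"
    "\<And>t s. norm (p' s / p' t) \<le> M" using zeta_taylor by metis
  obtain c where c: "c > 0"
    "\<And>t s. norm (zeta t s) < c \<Longrightarrow> \<exists>n::int. \<bar>s - t - 2 * pi * of_int n\<bar> < 1 / (4 * M)"
    using zeta_separated[of "1 / (4 * M)"] M(1) by auto
  have "norm (zeta t s - of_real (s - t)) \<le> \<bar>s - t\<bar> / 4" if "\<bar>s - t\<bar> \<le> 1 / (4 * M)" for t s
  proof -
    have "norm (zeta t s - of_real (s - t)) \<le> (M * \<bar>s - t\<bar>) * \<bar>s - t\<bar>"
      using M(2)[of t s] by (simp add: power2_eq_square)
    also have "\<dots> \<le> (1 / 4) * \<bar>s - t\<bar>"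
      using that M(1) by (intro mult_right_mono) (auto simp: field_simps)
    finally show ?thesis by simp
  qed
  then show ?thesis using that M c less_imp_le by metis
qed

text \<open>Otherwise \<open>zeta t s = - \<i> \<delta>\<close> is small, so \<open>s\<close> is
  close to \<open>t\<close> modulo the period; but there \<open>zeta\<close> is nearly real. This is
  a tubular neighbourhood with a width that does not depend on the point.\<close>

lemma tube:
  obtains c where "c > 0" "\<And>t s \<delta>. \<delta> \<noteq> 0 \<Longrightarrow> \<bar>\<delta>\<bar> < c \<Longrightarrow> zeta t s + \<i> * of_real \<delta> \<noteq> 0"
proof -
  obtain M c where M: "M \<ge> 1" "c > 0"
    "\<And>t s. \<bar>s - t\<bar> \<le> 1 / (4 * M) \<Longrightarrow> norm (zeta t s - of_real (s - t)) \<le> \<bar>s - t\<bar> / 4"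
    "\<And>t s. norm (zeta t s) < c \<Longrightarrow> \<exists>n::int. \<bar>s - t - 2 * pi * of_int n\<bar> \<le> 1 / (4 * M)"
    using zeta_normal_form by metis
  have "zeta t s + \<i> * of_real \<delta> \<noteq> 0" if \<delta>: "\<delta> \<noteq> 0" "\<bar>\<delta>\<bar> < c" for t s \<delta>
  proof
    assume 0: "zeta t s + \<i> * of_real \<delta> = 0"
    then have "norm (zeta t s) = \<bar>\<delta>\<bar>" by (simp add: add_eq_0_iff2 norm_mult)
    then obtain n :: int where n: "\<bar>s - t - 2 * pi * of_int n\<bar> \<le> 1 / (4 * M)" using M(4) \<delta> by metis
    define s' where "s' = s - 2 * pi * of_int n"
    have "zeta t s' = zeta t s" using zeta_periodic(1)[of t s' n] by (simp add: s'_def)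
    moreover have "norm (zeta t s' - of_real (s' - t)) \<le> \<bar>s' - t\<bar> / 4"
      using n by (intro M(3)) (simp add: s'_def algebra_simps)
    ultimately have "sqrt ((s' - t)\<^sup>2 + \<delta>\<^sup>2) / 2 \<le> 0"
      using norm_perturbed_real_plus_imaginary(1)[of "zeta t s'" "s' - t" \<delta>] 0 by simp
    then show False using that(1) by (simp add: sum_power2_le_zero_iff)
  qed
  with M(2) that show ?thesis by blast
qed

lemma diff_displaced:
  "p s - (p t + \<i> * of_real \<delta> * p' t) = p' t * (zeta t s - \<i> * of_real \<delta>)"
  "p s - (p t - \<i> * of_real \<delta> * p' t) = p' t * (zeta t s + \<i> * of_real \<delta>)"
  by (simp_all add: zeta_def field_simps)

lemma zeta_has_deriv: "(zeta t has_vector_derivative p' s / p' t) (at s within S)"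
proof -
  have "((\<lambda>s. (p s - p t) * (1 / p' t)) has_vector_derivative (p' s - 0) * (1 / p' t)) (at s within S)"
    by (intro has_vector_derivative_mult_left has_vector_derivative_diff has_deriv has_vector_derivative_const)
  then show ?thesis by (simp add: zeta_def[abs_def])
qed

text \<open>\<open>s = 2 * pi\<close> gives the same point as \<open>s = 0\<close>, which differs
  from \<open>p t\<close> because \<open>t\<close> is interior. For \<open>t = 0\<close> the
  diagonal singularity would occur a second time, at the other end of the interval.\<close>

lemma zeta_nonzero:
  assumes "0 < t" "t < 2 * pi" "0 \<le> s" "s \<le> 2 * pi" "s \<noteq> t"
  shows "zeta t s \<noteq> 0"
proof -
  have "p s \<noteq> p t"
  proof (cases "s = 2 * pi")
    case True
    then have "p s = p 0" using periodic[of 0] by simp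
    then show ?thesis using inj_p[of 0 t] assms by auto
  next
    case False
    then show ?thesis using inj_p[of s t] assms by auto
  qed
  then show ?thesis by (simp add: zeta_def)
qed

text \<open>The difference of the Cauchy kernels at the two displaced points, multiplied by
  \<open>p' t\<close>; with \<open>s - t\<close> in place of \<open>zeta t s\<close> it is
  \<open>2 \<i>\<close> times the Poisson kernel of the half-plane. As a single fraction it also
  makes sense for \<open>\<delta> = 0\<close> off the diagonal, with value 0.\<close>

definition jump_kernel :: "real \<Rightarrow> real \<Rightarrow> real \<Rightarrow> complex" where
  "jump_kernel t \<delta> s = 2 * \<i> * of_real \<delta> / ((zeta t s)\<^sup>2 + (of_real \<delta>)\<^sup>2)"

definition jump_kernel' :: "real \<Rightarrow> real \<Rightarrow> real \<Rightarrow> complex" where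
  "jump_kernel' t \<delta> s = - 4 * \<i> * of_real \<delta> * zeta t s * (p' s / p' t) / ((zeta t s)\<^sup>2 + (of_real \<delta>)\<^sup>2)\<^sup>2"

lemma jump_kernel_has_deriv:
  assumes "(zeta t s)\<^sup>2 + (of_real \<delta>)\<^sup>2 \<noteq> 0"
  shows "(jump_kernel t \<delta> has_vector_derivative jump_kernel' t \<delta> s) (at s within S)"
proof -
  have "((\<lambda>w. 2 * \<i> * of_real \<delta> / (w\<^sup>2 + (of_real \<delta>)\<^sup>2)) has_field_derivative
      - 4 * \<i> * of_real \<delta> * zeta t s / ((zeta t s)\<^sup>2 + (of_real \<delta>)\<^sup>2)\<^sup>2) (at (zeta t s) within T)" for T
    using assms by (auto intro!: derivative_eq_intros simp: power2_eq_square)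
  from field_vector_diff_chain_within[OF zeta_has_deriv this] show ?thesis
    by (simp add: jump_kernel_def[abs_def] jump_kernel'_def[abs_def] o_def mult_ac)
qed

lemma jump_kernel_eq:
  assumes "zeta t s + \<i> * of_real \<delta> \<noteq> 0" "zeta t s - \<i> * of_real \<delta> \<noteq> 0"
  shows "jump_kernel t \<delta> s =
    p' t / (p s - (p t + \<i> * of_real \<delta> * p' t)) - p' t / (p s - (p t - \<i> * of_real \<delta> * p' t))"
proof -
  have "(zeta t s)\<^sup>2 + (of_real \<delta>)\<^sup>2 = (zeta t s - \<i> * of_real \<delta>) * (zeta t s + \<i> * of_real \<delta>)"
    by (simp add: algebra_simps power2_eq_square)
  moreover have "2 * \<i> * of_real \<delta> / ((zeta t s - \<i> * of_real \<delta>) * (zeta t s + \<i> * of_real \<delta>)) =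
      1 / (zeta t s - \<i> * of_real \<delta>) - 1 / (zeta t s + \<i> * of_real \<delta>)"
    using assms by (simp add: diff_frac_eq)
  ultimately show ?thesis unfolding diff_displaced jump_kernel_def by simp
qed

text \<open>Away from \<open>t\<close> the kernel and its derivative are jointly continuous down to
  \<open>\<delta> = 0\<close>, where the kernel vanishes identically.\<close>

lemma jump_kernel_far_tendsto:
  assumes "0 < t" "t < 2 * pi" and ab: "a \<le> b" "{a..b} \<subseteq> J_range - {t}"
    and \<Theta>: "\<And>s. s \<in> {a..b} \<Longrightarrow> (\<Theta> has_vector_derivative \<Theta>' s) (at s within {a..b})"
  shows "((\<lambda>\<delta>. integral {a..b} (\<lambda>s. jump_kernel t \<delta> s * \<Theta>' s)) \<longlongrightarrow> 0) (at_right 0)"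
proof -
  obtain c where c: "c > 0" "\<And>t s \<delta>. \<delta> \<noteq> 0 \<Longrightarrow> \<bar>\<delta>\<bar> < c \<Longrightarrow> zeta t s + \<i> * of_real \<delta> \<noteq> 0"
    using tube by metis
  have nz: "(zeta t s)\<^sup>2 + (of_real \<delta>)\<^sup>2 \<noteq> 0" if "\<delta> \<in> {0..c/2}" "s \<in> {a..b}" for \<delta> s
  proof (cases "\<delta> = 0")
    case True
    moreover have "s \<in> J_range - {t}" using ab(2) that(2) by blast
    ultimately show ?thesis using zeta_nonzero[of t s] assms(1,2) by auto
  next
    case False
    have "(zeta t s)\<^sup>2 + (of_real \<delta>)\<^sup>2 = (zeta t s + \<i> * of_real (-\<delta>)) * (zeta t s + \<i> * of_real \<delta>)"
      by (simp add: algebra_simps power2_eq_square)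
    then show ?thesis using c(2)[of \<delta> t s] c(2)[of "-\<delta>" t s] c(1) that False by auto
  qed
  have "continuous_on {0..c/2} (\<lambda>\<delta>. integral {a..b} (\<lambda>s. jump_kernel t \<delta> s * \<Theta>' s))"
  proof (rule continuous_on_integral_by_parts[OF ab(1) \<Theta> jump_kernel_has_deriv[OF nz]])
    show "continuous_on ({0..c/2} \<times> {a..b}) (\<lambda>(\<delta>, s). jump_kernel t \<delta> s)"
      unfolding jump_kernel_def zeta_def split_beta
      by (intro continuous_intros) (use nz in \<open>auto simp: zeta_def\<close>)
    show "continuous_on ({0..c/2} \<times> {a..b}) (\<lambda>(\<delta>, s). jump_kernel' t \<delta> s)"
      unfolding jump_kernel'_def zeta_def split_beta
      by (intro continuous_intros) (use nz in \<open>auto simp: zeta_def\<close>)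
  qed auto
  then have "((\<lambda>\<delta>. integral {a..b} (\<lambda>s. jump_kernel t \<delta> s * \<Theta>' s)) \<longlongrightarrow>
      integral {a..b} (\<lambda>s. jump_kernel t 0 s * \<Theta>' s)) (at 0 within {0..c/2})"
    using c(1) by (simp add: continuous_on)
  moreover have "at (0::real) within {0..c/2} = at_right 0"
    using c(1) by (simp add: at_within_Icc_at_right)
  ultimately show ?thesis by (simp add: jump_kernel_def)
qed

lemma poisson_limit:
  assumes "\<eta> > 0"
  shows "((\<lambda>\<delta>. 2 * arctan (\<eta> / \<delta>)) \<longlongrightarrow> pi) (at_right 0)"
proof -
  have "filterlim (\<lambda>\<delta>. \<eta> / \<delta>) at_top (at_right 0)"
    using assms by real_asymp
  then have "((\<lambda>\<delta>. arctan (\<eta> / \<delta>)) \<longlongrightarrow> pi / 2) (at_right 0)"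
    using tendsto_arctan_at_top filterlim_compose by blast
  from tendsto_mult[OF tendsto_const[of 2] this] show ?thesis by simp
qed

text \<open>Two replacements are made: \<open>\<Theta>'\<close> by its value \<open>g\<close> at
  \<open>t\<close>, and the kernel by the Poisson kernel. The first leaves the Taylor remainder
  \<open>R\<close> of \<open>\<Theta>\<close>, integrated by parts: \<open>16\<close> comes from two
  end point terms of size \<open>8 * \<epsilon>\<close>, and \<open>320 * M\<close> from
  \<open>80 * M\<close> times the bound 4 for the Poisson mass. The second has a pointwise error of
  at most \<open>9 * M\<close> on an interval of length \<open>2 * \<eta>\<close>, whence
  \<open>18\<close>.\<close>

lemma jump_kernel_near:
  assumes t: "0 < t" "t < 2 * pi" and "\<epsilon> > 0" "M \<ge> 1" "\<eta> > 0" "M * \<eta> \<le> \<epsilon>"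
    and M: "\<And>s. norm (zeta t s - of_real (s - t)) \<le> M * (s - t)\<^sup>2" "\<And>s. norm (p' s / p' t) \<le> M"
    and near: "\<And>s. \<bar>s - t\<bar> \<le> \<eta> \<Longrightarrow> norm (zeta t s - of_real (s - t)) \<le> \<bar>s - t\<bar> / 4"
    and \<Theta>: "\<And>s. s \<in> {t-\<eta>..t+\<eta>} \<Longrightarrow> (\<Theta> has_vector_derivative \<Theta>' s) (at s within {t-\<eta>..t+\<eta>})"
    and R: "\<And>s. \<bar>s - t\<bar> \<le> \<eta> \<Longrightarrow> norm (\<Theta> s - \<Theta> t - of_real (s - t) * g) \<le> \<epsilon> * \<bar>s - t\<bar>"
    and \<delta>: "0 < \<delta>" "\<delta> \<le> \<eta>"
  shows "norm (integral {t-\<eta>..t+\<eta>} (\<lambda>s. jump_kernel t \<delta> s * \<Theta>' s) - g * (2 * \<i> * of_real (2 * arctan (\<eta> / \<delta>))))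
    \<le> (16 + 320 * M + 18 * norm g) * \<epsilon>"
proof -
  define I where "I = {t-\<eta>..t+\<eta>}"
  define Q where "Q = (\<lambda>s. (s - t)\<^sup>2 + \<delta>\<^sup>2)"
  have Q: "Q s > 0" "(s - t)\<^sup>2 \<le> Q s" "\<delta>\<^sup>2 \<le> Q s" "2 * (\<delta> * \<bar>s - t\<bar>) \<le> Q s" for s
  proof -
    show "Q s > 0" "(s - t)\<^sup>2 \<le> Q s" "\<delta>\<^sup>2 \<le> Q s" using \<delta> by (auto simp: Q_def add_nonneg_pos)
    show "2 * (\<delta> * \<bar>s - t\<bar>) \<le> Q s"
      using sum_squares_bound[of \<delta> "\<bar>s - t\<bar>"] by (simp add: Q_def)
  qed
  have I: "s \<in> I \<longleftrightarrow> \<bar>s - t\<bar> \<le> \<eta>" for s unfolding I_def by auto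
  have D: "Q s / 4 \<le> norm ((zeta t s)\<^sup>2 + (of_real \<delta>)\<^sup>2)" if "s \<in> I" for s
    using norm_perturbed_real_plus_imaginary(2)[OF near] that I unfolding Q_def by blast
  then have nz: "(zeta t s)\<^sup>2 + (of_real \<delta>)\<^sup>2 \<noteq> 0" if "s \<in> I" for s
    using Q(1)[of s] that by fastforce
  have z: "norm (zeta t s) \<le> 5 / 4 * \<bar>s - t\<bar>" if "s \<in> I" for s
  proof -
    have "norm (zeta t s) \<le> norm (zeta t s - of_real (s - t)) + norm (of_real (s - t) :: complex)"
      using norm_triangle_ineq[of "zeta t s - of_real (s - t)" "of_real (s - t)"] by simp
    moreover have "norm (of_real (s - t) :: complex) = \<bar>s - t\<bar>" by (rule norm_of_real)
    moreover have "norm (zeta t s - of_real (s - t)) \<le> \<bar>s - t\<bar> / 4" using near[of s] that I by blast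
    ultimately show ?thesis by argo
  qed
  have P: "norm (jump_kernel t \<delta> s) \<le> 8 * \<delta> / Q s" if "s \<in> I" for s
  proof -
    have "norm (jump_kernel t \<delta> s) = 2 * \<delta> / norm ((zeta t s)\<^sup>2 + (of_real \<delta>)\<^sup>2)"
      using \<delta> by (simp add: jump_kernel_def norm_divide norm_mult)
    also have "\<dots> \<le> 2 * \<delta> / (Q s / 4)"
      using D[OF that] Q(1)[of s] \<delta> by (intro divide_left_mono mult_pos_pos) auto
    finally show ?thesis by simp
  qed
  have P': "norm (jump_kernel' t \<delta> s) \<le> 80 * M * \<delta> * \<bar>s - t\<bar> / (Q s)\<^sup>2" if "s \<in> I" for s
  proof -
    have "norm (jump_kernel' t \<delta> s) =
        (4 * \<delta>) * norm (zeta t s) * norm (p' s / p' t) / (norm ((zeta t s)\<^sup>2 + (of_real \<delta>)\<^sup>2))\<^sup>2"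
      using \<delta> by (simp add: jump_kernel'_def norm_divide norm_mult norm_power)
    also have "\<dots> \<le> (4 * \<delta>) * (5 / 4 * \<bar>s - t\<bar>) * M / (Q s / 4)\<^sup>2"
      using D[OF that] z[OF that] M(2) Q(1)[of s] \<delta> \<open>M \<ge> 1\<close>
      by (intro frac_le mult_mono power_mono) auto
    finally show ?thesis by (simp add: power_divide mult_ac)
  qed
  define R where "R = (\<lambda>s. \<Theta> s - \<Theta> t - of_real (s - t) * g)"
  have Rb: "norm (R s) \<le> \<epsilon> * \<bar>s - t\<bar>" if "s \<in> I" for s
    using R that I unfolding R_def by blast
  have Rd: "(R has_vector_derivative \<Theta>' s - g) (at s within I)" if "s \<in> I" for s
    using \<Theta>[of s] that unfolding R_def I_def[symmetric]
    by (auto intro!: derivative_eq_intros)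
  have cP': "continuous_on I (jump_kernel' t \<delta>)"
    unfolding jump_kernel'_def[abs_def] zeta_def by (intro continuous_intros) (use nz in \<open>auto simp: zeta_def\<close>)
  have cP: "continuous_on I (jump_kernel t \<delta>)"
    unfolding jump_kernel_def[abs_def] zeta_def by (intro continuous_intros) (use nz in \<open>auto simp: zeta_def\<close>)
  have cR: "continuous_on I R"
    using Rd by (meson continuous_on_eq_continuous_within has_vector_derivative_continuous)
  let ?a = "t - \<eta>" and ?b = "t + \<eta>"
  have ab: "?a \<le> ?b" "?a \<in> I" "?b \<in> I" using \<open>\<eta> > 0\<close> by (auto simp: I_def)
  have 1: "((\<lambda>s. jump_kernel t \<delta> s * (\<Theta>' s - g)) has_integral
    jump_kernel t \<delta> ?b * R ?b - jump_kernel t \<delta> ?a * R ?a - integral I (\<lambda>s. jump_kernel' t \<delta> s * R s)) I"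
    unfolding I_def
    by (rule has_integral_by_parts_vector[OF ab(1) Rd[unfolded I_def]
          jump_kernel_has_deriv[OF nz[unfolded I_def]] cP'[unfolded I_def]])
  have iP: "(jump_kernel t \<delta> has_integral integral I (jump_kernel t \<delta>)) I"
    using cP unfolding I_def by (intro integrable_integral integrable_continuous_real)
  have 2: "((\<lambda>s. jump_kernel t \<delta> s * \<Theta>' s) has_integral
    (jump_kernel t \<delta> ?b * R ?b - jump_kernel t \<delta> ?a * R ?a - integral I (\<lambda>s. jump_kernel' t \<delta> s * R s))
     + g * integral I (jump_kernel t \<delta>)) I"
    using has_integral_add[OF 1 has_integral_mult_right[OF iP, of g]] by (simp add: algebra_simps)
  have poi: "((\<lambda>s. \<delta> / Q s) has_integral 2 * arctan (\<eta> / \<delta>)) I"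
    unfolding Q_def I_def using poisson_kernel_has_integral[OF \<delta>(1), of \<eta> t] \<open>\<eta> > 0\<close> by simp
  have endpt: "norm (jump_kernel t \<delta> s * R s) \<le> 8 * \<epsilon>" if "\<bar>s - t\<bar> = \<eta>" for s
  proof -
    have "s \<in> I" using that I by simp
    have "norm (jump_kernel t \<delta> s * R s) \<le> (8 * \<delta> / Q s) * (\<epsilon> * \<eta>)"
      unfolding norm_mult using P[OF \<open>s \<in> I\<close>] Rb[OF \<open>s \<in> I\<close>] that \<delta> Q(1)[of s]
      by (intro mult_mono) auto
    also have "\<dots> = (8 * \<epsilon>) * (\<delta> * \<eta> / Q s)" by simp
    also have "\<dots> \<le> (8 * \<epsilon>) * 1"
      using Q(1)[of s] Q(4)[of s] that \<open>\<epsilon> > 0\<close> \<delta> \<open>\<eta> > 0\<close> by (intro mult_left_mono) (auto simp: field_simps)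
    finally show ?thesis by simp
  qed
  \<comment> \<open>Both the kernel derivative and \<open>R\<close> carry a factor
    \<open>\<bar>s - t\<bar>\<close>. The square is absorbed by
    \<open>(s - t)\<^sup>2 \<le> Q s\<close>, leaving a Poisson kernel, whose mass stays bounded as
    \<delta> tends to 0.\<close>
  have "norm (integral I (\<lambda>s. jump_kernel' t \<delta> s * R s)) \<le> integral I (\<lambda>s. (80 * M * \<epsilon>) * (\<delta> / Q s))"
  proof (rule integral_norm_bound_integral)
    show "(\<lambda>s. jump_kernel' t \<delta> s * R s) integrable_on I"
      using cP' cR unfolding I_def by (intro integrable_continuous_real continuous_intros)
    show "(\<lambda>s. (80 * M * \<epsilon>) * (\<delta> / Q s)) integrable_on I"
      using has_integral_mult_right[OF poi] by blast
    fix s assume s: "s \<in> I"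
    have "norm (jump_kernel' t \<delta> s * R s) \<le> (80 * M * \<delta> * \<bar>s - t\<bar> / (Q s)\<^sup>2) * (\<epsilon> * \<bar>s - t\<bar>)"
      unfolding norm_mult using P'[OF s] Rb[OF s] \<delta> \<open>M \<ge> 1\<close> by (intro mult_mono) auto
    also have "\<dots> = (80 * M * \<epsilon>) * (\<delta> / Q s) * ((s - t)\<^sup>2 / Q s)"
    proof -
      have sq: "(s - t)\<^sup>2 = \<bar>s - t\<bar> * \<bar>s - t\<bar>" by (simp add: power2_eq_square)
      show ?thesis unfolding sq by (simp add: power2_eq_square mult_ac del: abs_mult_self_eq)
    qed
    also have "\<dots> \<le> (80 * M * \<epsilon>) * (\<delta> / Q s) * 1"
      using Q[of s] \<delta> \<open>M \<ge> 1\<close> \<open>\<epsilon> > 0\<close> by (intro mult_left_mono) (auto simp: field_simps)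
    finally show "norm (jump_kernel' t \<delta> s * R s) \<le> (80 * M * \<epsilon>) * (\<delta> / Q s)" by simp
  qed
  also have "\<dots> = 80 * M * \<epsilon> * (2 * arctan (\<eta> / \<delta>))"
    using has_integral_mult_right[OF poi] by (rule integral_unique)
  also have "\<dots> \<le> 80 * M * \<epsilon> * 4"
    using arctan_ubound[of "\<eta> / \<delta>"] pi_less_4 \<open>M \<ge> 1\<close> \<open>\<epsilon> > 0\<close> by (intro mult_left_mono) auto
  finally have int1: "norm (integral I (\<lambda>s. jump_kernel' t \<delta> s * R s)) \<le> 320 * M * \<epsilon>" by simp
  have poi2: "((\<lambda>s. 2 * \<i> * complex_of_real (\<delta> / Q s)) has_integral 2 * \<i> * of_real (2 * arctan (\<eta> / \<delta>))) I"
    by (intro has_integral_mult_right has_integral_of_real poi)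
  \<comment> \<open>The numerator of the difference contains \<open>(u - zeta) * (u + zeta)\<close>
    with \<open>u = s - t\<close>, which is of third order. Two orders cancel against
    \<open>Q s\<close>, and the third, together with \<delta>, against the other \<open>Q s\<close>
    because \<open>2 * (\<delta> * \<bar>s - t\<bar>) \<le> Q s\<close>.\<close>
  have "norm (integral I (\<lambda>s. jump_kernel t \<delta> s - 2 * \<i> * complex_of_real (\<delta> / Q s))) \<le> integral I (\<lambda>s. 9 * M)"
  proof (rule integral_norm_bound_integral)
    show "(\<lambda>s. jump_kernel t \<delta> s - 2 * \<i> * complex_of_real (\<delta> / Q s)) integrable_on I"
      using has_integral_diff[OF iP poi2] by blast
    show "(\<lambda>s. 9 * M) integrable_on I" unfolding I_def by (rule integrable_const_ivl)
    fix s assume s: "s \<in> I"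
    let ?u = "complex_of_real (s - t)"
    have Qc: "complex_of_real (Q s) = ?u\<^sup>2 + (of_real \<delta>)\<^sup>2" by (simp add: Q_def)
    have "jump_kernel t \<delta> s - 2 * \<i> * complex_of_real (\<delta> / Q s) =
        2 * \<i> * of_real \<delta> * ((?u - zeta t s) * (?u + zeta t s)) / (((zeta t s)\<^sup>2 + (of_real \<delta>)\<^sup>2) * of_real (Q s))"
    proof -
      have "jump_kernel t \<delta> s - 2 * \<i> * complex_of_real (\<delta> / Q s) =
        2 * \<i> * of_real \<delta> * (of_real (Q s) - ((zeta t s)\<^sup>2 + (of_real \<delta>)\<^sup>2)) / (((zeta t s)\<^sup>2 + (of_real \<delta>)\<^sup>2) * of_real (Q s))"
        unfolding jump_kernel_def using nz[OF s] Q(1)[of s] by (simp add: divide_simps) (simp add: algebra_simps)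
      also have "of_real (Q s) - ((zeta t s)\<^sup>2 + (of_real \<delta>)\<^sup>2) = (?u - zeta t s) * (?u + zeta t s)"
        unfolding Qc by (simp add: algebra_simps power2_eq_square)
      finally show ?thesis .
    qed
    then have "norm (jump_kernel t \<delta> s - 2 * \<i> * complex_of_real (\<delta> / Q s)) =
       2 * \<delta> * (norm (zeta t s - ?u) * norm (?u + zeta t s)) / (norm ((zeta t s)\<^sup>2 + (of_real \<delta>)\<^sup>2) * Q s)"
      using \<delta> Q(1)[of s] by (simp add: norm_mult norm_divide norm_minus_commute)
    also have "\<dots> \<le> 2 * \<delta> * (M * (s - t)\<^sup>2 * (9 / 4 * \<bar>s - t\<bar>)) / ((Q s / 4) * Q s)"
    proof -
      have "norm (?u + zeta t s) \<le> 9 / 4 * \<bar>s - t\<bar>"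
        using norm_triangle_ineq[of ?u "zeta t s"] z[OF s] norm_of_real[of "s - t", where 'a = complex]
        by argo
      then show ?thesis using D[OF s] M(1)[of s] Q(1)[of s] \<delta> \<open>M \<ge> 1\<close>
        by (intro frac_le mult_left_mono mult_right_mono mult_mono) auto
    qed
    also have "\<dots> = 9 * M * ((s - t)\<^sup>2 / Q s * (2 * (\<delta> * \<bar>s - t\<bar>) / Q s))"
      by (simp add: field_simps)
    also have "\<dots> \<le> 9 * M * (1 * 1)"
      using Q[of s] \<delta> \<open>M \<ge> 1\<close> by (intro mult_left_mono mult_mono) (auto simp: field_simps)
    finally show "norm (jump_kernel t \<delta> s - 2 * \<i> * complex_of_real (\<delta> / Q s)) \<le> 9 * M" by simp
  qed
  also have "\<dots> \<le> 18 * \<epsilon>" using \<open>\<eta> > 0\<close> \<open>M * \<eta> \<le> \<epsilon>\<close> by (simp add: I_def algebra_simps)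
  finally have int2: "norm (integral I (jump_kernel t \<delta>) - 2 * \<i> * of_real (2 * arctan (\<eta> / \<delta>))) \<le> 18 * \<epsilon>"
    using integral_unique[OF has_integral_diff[OF iP poi2]] by simp
  have "integral I (\<lambda>s. jump_kernel t \<delta> s * \<Theta>' s) - g * (2 * \<i> * of_real (2 * arctan (\<eta> / \<delta>))) =
    jump_kernel t \<delta> ?b * R ?b - jump_kernel t \<delta> ?a * R ?a - integral I (\<lambda>s. jump_kernel' t \<delta> s * R s)
     + g * (integral I (jump_kernel t \<delta>) - 2 * \<i> * of_real (2 * arctan (\<eta> / \<delta>)))"
    unfolding integral_unique[OF 2] by (simp add: algebra_simps)
  also have "norm \<dots> \<le> 8 * \<epsilon> + 8 * \<epsilon> + 320 * M * \<epsilon> + norm g * (18 * \<epsilon>)"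
    using endpt[of ?a] endpt[of ?b] \<open>\<eta> > 0\<close> int1 mult_left_mono[OF int2, of "norm g"]
    by (intro norm_triangle_mono norm_triangle_le_diff add_mono) (auto simp: norm_mult)
  finally show "norm (integral {t-\<eta>..t+\<eta>} (\<lambda>s. jump_kernel t \<delta> s * \<Theta>' s) - g * (2 * \<i> * of_real (2 * arctan (\<eta> / \<delta>))))
    \<le> (16 + 320 * M + 18 * norm g) * \<epsilon>"
    unfolding I_def by (simp add: algebra_simps)
qed

end

section \<open>Contour integrals over parametrizations on the unit interval\<close>

lemma unit_path_has_vector_derivative:
  assumes "\<And>t. (q has_vector_derivative q' t) (at t)"
  shows "(unit_path q has_vector_derivative (2 * pi) *\<^sub>R q' (2 * pi * x)) (at x)"
proof -
  have "((\<lambda>u. 2 * pi * u) has_vector_derivative 2 * pi) (at x)"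
    by (auto intro!: derivative_eq_intros simp: has_real_derivative_iff_has_vector_derivative[symmetric])
  from vector_diff_chain_at[OF this assms] show ?thesis by (simp add: o_def unit_path_def[abs_def])
qed

lemma valid_path_unit_path:
  assumes "\<And>t. (q has_vector_derivative q' t) (at t)" "continuous_on UNIV q'"
  shows "valid_path (unit_path q)"
proof -
  have "continuous_on {0..1} (\<lambda>x. (2 * pi) *\<^sub>R q' (2 * pi * x))"
    by (intro continuous_intros continuous_on_compose2[OF assms(2)]) auto
  then have "unit_path q C1_differentiable_on {0..1}"
    unfolding C1_differentiable_on_def
    by (intro exI[of _ "\<lambda>x. (2 * pi) *\<^sub>R q' (2 * pi * x)"])
      (use unit_path_has_vector_derivative[OF assms(1)] in auto)
  then show ?thesis unfolding valid_path_def by (rule C1_differentiable_imp_piecewise)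
qed

lemma has_contour_integral_unit_path:
  assumes "\<And>t. (q has_vector_derivative q' t) (at t)"
  shows "(g has_contour_integral I) (unit_path q) \<longleftrightarrow> ((\<lambda>s. g (q s) * q' s) has_integral I) J_range"
proof -
  have im: "(\<lambda>x. x / (2 * pi)) ` J_range = {0..1}"
    using image_divide_atLeastAtMost[of "2*pi" 0 "2*pi"] by simp
  have "(g has_contour_integral I) (unit_path q) \<longleftrightarrow>
      ((\<lambda>x. complex_of_real (2 * pi) * (g (q (2 * pi * x)) * q' (2 * pi * x))) has_integral I) {0..1}"
    unfolding has_contour_integral vector_derivative_at[OF unit_path_has_vector_derivative[OF assms]]
    by (simp add: unit_path_def scaleR_conv_of_real mult_ac)
  also have "\<dots> \<longleftrightarrow> ((\<lambda>x. g (q (2 * pi * x)) * q' (2 * pi * x)) has_integral I / of_real (2 * pi)) {0..1}"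
    by (subst has_integral_mult_right_iff) auto
  also have "\<dots> \<longleftrightarrow> ((\<lambda>s. g (q s) * q' s) has_integral I) J_range"
    using has_integral_stretch_real_iff[of "2*pi" "\<lambda>s. g (q s) * q' s" "I / of_real (2 * pi)" 0 "2*pi"]
    unfolding im by (simp add: scaleR_conv_of_real)
  finally show ?thesis .
qed

lemma path_image_unit_path: "path_image (unit_path q) = q ` J_range"
proof -
  have "(\<lambda>u. 2 * pi * u) ` {0..1} = J_range"
    using image_mult_atLeastAtMost[of "2*pi" 0 1] by simp
  then have "q ` J_range = (\<lambda>u. q (2 * pi * u)) ` {0..1}" by (metis image_image)
  then show ?thesis by (simp add: path_image_def unit_path_def[abs_def])
qed

section \<open>Cauchy integrals over a Jordan curve and its two sides\<close>

context jordan_param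
begin

lemma curve_eq_path_image: "curve p = path_image (unit_path p)"
  unfolding path_image_unit_path curve_def ..

lemma curve_eq_range: "curve p = range p"
proof -
  have "p t \<in> p ` J_range" for t
  proof -
    obtain n s where "t = s + 2 * pi * of_int n" "0 \<le> s" "s < 2 * pi" by (rule reduce_period)
    then show ?thesis by (auto simp: periodics)
  qed
  then show ?thesis unfolding curve_def by auto
qed

lemma in_curve: "p t \<in> curve p" by (simp add: curve_eq_range)

lemma valid_path_p: "valid_path (unit_path p)"
  by (rule valid_path_unit_path[OF has_deriv cont1])

lemma loop_p: "pathfinish (unit_path p) = pathstart (unit_path p)"
  using periodic[of 0] by (simp add: pathfinish_def pathstart_def unit_path_def)

lemma simple_p: "simple_path (unit_path p)"
  using param unfolding regular_jordan_param_def by blast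

lemma compact_curve: "compact (curve p)"
  unfolding curve_eq_path_image by (intro compact_path_image valid_path_imp_path valid_path_p)

lemma jordan_sides:
  "inside (curve p) \<noteq> {}" "open (inside (curve p))" "connected (inside (curve p))"
  "outside (curve p) \<noteq> {}" "open (outside (curve p))" "connected (outside (curve p))"
  "bounded (inside (curve p))" "inside (curve p) \<inter> outside (curve p) = {}"
  "inside (curve p) \<union> outside (curve p) = - curve p"
  "frontier (inside (curve p)) = curve p" "frontier (outside (curve p)) = curve p"
  using Jordan_inside_outside[OF simple_p loop_p] unfolding curve_eq_path_image[symmetric] by auto

lemma winding_outside: "w \<in> outside (curve p) \<Longrightarrow> winding_number (unit_path p) w = 0"
  using winding_number_zero_in_outside[OF valid_path_imp_path[OF valid_path_p] loop_p]
  unfolding curve_eq_path_image .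

lemma winding_eq_integral:
  assumes "w \<notin> curve p"
  shows "((\<lambda>s. p' s / (p s - w)) has_integral 2 * pi * \<i> * winding_number (unit_path p) w) J_range"
  using has_contour_integral_winding_number[OF valid_path_p, of w] assms
  unfolding has_contour_integral_unit_path[OF has_deriv] curve_eq_path_image by simp

lemma cauchy_kernel_has_deriv:
  assumes "w \<notin> curve p"
  shows "((\<lambda>s. 1 / (p s - w)) has_vector_derivative - p' s / (p s - w)\<^sup>2) (at s within S)"
proof -
  have nz: "p s - w \<noteq> 0" using assms in_curve[of s] by auto
  have "((\<lambda>v. 1 / (v - w)) has_field_derivative - 1 / (p s - w)\<^sup>2) (at (p s) within T)" for T
    using nz by (auto intro!: derivative_eq_intros simp: power2_eq_square)
  from field_vector_diff_chain_within[OF has_deriv this] show ?thesis by (simp add: o_def)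
qed

text \<open>The integrated terms combine into one because the kernel is periodic;
  \<open>\<Theta>\<close> itself may grow over a period, as the boundary correspondence
  does.\<close>

lemma cauchy_by_parts:
  assumes "w \<notin> curve p"
    and \<Theta>: "\<And>s. s \<in> J_range \<Longrightarrow> (\<Theta> has_vector_derivative \<Theta>' s) (at s within J_range)"
  shows "((\<lambda>s. \<Theta>' s / (p s - w)) has_integral
    (\<Theta> (2 * pi) - \<Theta> 0) / (p 0 - w) + integral J_range (\<lambda>s. p' s / (p s - w)\<^sup>2 * \<Theta> s)) J_range"
proof -
  have "continuous_on J_range (\<lambda>s. - p' s / (p s - w)\<^sup>2)"
    using assms(1) in_curve by (intro continuous_intros) auto
  from has_integral_by_parts_vector[OF _ \<Theta> cauchy_kernel_has_deriv[OF assms(1)] this]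
  show ?thesis using periodic[of 0] by (simp add: diff_divide_distrib)
qed

lemma displaced_nonzero:
  obtains c where "c > 0"
    "\<And>t s \<delta>. 0 < \<delta> \<Longrightarrow> \<delta> < c \<Longrightarrow> zeta t s + \<i> * of_real \<delta> \<noteq> 0"
    "\<And>t s \<delta>. 0 < \<delta> \<Longrightarrow> \<delta> < c \<Longrightarrow> zeta t s - \<i> * of_real \<delta> \<noteq> 0"
    "\<And>t \<delta>. 0 < \<delta> \<Longrightarrow> \<delta> < c \<Longrightarrow> p t + \<i> * of_real \<delta> * p' t \<notin> curve p"
    "\<And>t \<delta>. 0 < \<delta> \<Longrightarrow> \<delta> < c \<Longrightarrow> p t - \<i> * of_real \<delta> * p' t \<notin> curve p"
proof -
  obtain c where c: "c > 0" "\<And>t s \<delta>. \<delta> \<noteq> 0 \<Longrightarrow> \<bar>\<delta>\<bar> < c \<Longrightarrow> zeta t s + \<i> * of_real \<delta> \<noteq> 0"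
    using tube by metis
  have 1: "zeta t s + \<i> * of_real \<delta> \<noteq> 0" "zeta t s - \<i> * of_real \<delta> \<noteq> 0" if "0 < \<delta>" "\<delta> < c" for t s \<delta>
    using c(2)[of \<delta> t s] c(2)[of "-\<delta>" t s] that by auto
  have 2: "p t + \<i> * of_real \<delta> * p' t \<notin> curve p" if "0 < \<delta>" "\<delta> < c" for t \<delta>
  proof
    assume "p t + \<i> * of_real \<delta> * p' t \<in> curve p"
    then obtain s where "p t + \<i> * of_real \<delta> * p' t = p s" unfolding curve_eq_range by blast
    then show False using diff_displaced(1)[of s t \<delta>] 1[OF that, of t s] by simp
  qed
  have 3: "p t - \<i> * of_real \<delta> * p' t \<notin> curve p" if "0 < \<delta>" "\<delta> < c" for t \<delta>
  proof
    assume "p t - \<i> * of_real \<delta> * p' t \<in> curve p"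
    then obtain s where "p t - \<i> * of_real \<delta> * p' t = p s" unfolding curve_eq_range by blast
    then show False using diff_displaced(2)[of s t \<delta>] 1[OF that, of t s] by simp
  qed
  from that[OF c(1)] 1 2 3 show ?thesis by blast
qed

lemma jump_kernel_integral:
  assumes \<Theta>: "\<And>s. s \<in> J_range \<Longrightarrow> (\<Theta> has_vector_derivative \<Theta>' s) (at s within J_range)"
  shows "\<forall>\<^sub>F \<delta> in at_right 0. ((\<lambda>s. jump_kernel t \<delta> s * \<Theta>' s) has_integral
    p' t * (integral J_range (\<lambda>s. \<Theta>' s / (p s - (p t + \<i> * of_real \<delta> * p' t))) -
            integral J_range (\<lambda>s. \<Theta>' s / (p s - (p t - \<i> * of_real \<delta> * p' t))))) J_range"
proof -
  obtain c where c: "c > 0"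
    "\<And>t s \<delta>. 0 < \<delta> \<Longrightarrow> \<delta> < c \<Longrightarrow> zeta t s + \<i> * of_real \<delta> \<noteq> 0"
    "\<And>t s \<delta>. 0 < \<delta> \<Longrightarrow> \<delta> < c \<Longrightarrow> zeta t s - \<i> * of_real \<delta> \<noteq> 0"
    "\<And>t \<delta>. 0 < \<delta> \<Longrightarrow> \<delta> < c \<Longrightarrow> p t + \<i> * of_real \<delta> * p' t \<notin> curve p"
    "\<And>t \<delta>. 0 < \<delta> \<Longrightarrow> \<delta> < c \<Longrightarrow> p t - \<i> * of_real \<delta> * p' t \<notin> curve p"
    by (rule displaced_nonzero) (rule that)
  have "((\<lambda>s. jump_kernel t \<delta> s * \<Theta>' s) has_integral
    p' t * (integral J_range (\<lambda>s. \<Theta>' s / (p s - (p t + \<i> * of_real \<delta> * p' t))) -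
            integral J_range (\<lambda>s. \<Theta>' s / (p s - (p t - \<i> * of_real \<delta> * p' t))))) J_range"
    if \<delta>: "0 < \<delta>" "\<delta> < c" for \<delta>
  proof -
    have "((\<lambda>s. \<Theta>' s / (p s - w)) has_integral integral J_range (\<lambda>s. \<Theta>' s / (p s - w))) J_range"
      if "w \<notin> curve p" for w
      by (rule integrable_integral[OF has_integral_integrable[OF cauchy_by_parts[OF that \<Theta>]]])
    from has_integral_mult_right[OF has_integral_diff[OF this[OF c(4)[OF \<delta>]] this[OF c(5)[OF \<delta>]]], where c = "p' t"]
    show ?thesis
      by (simp add: jump_kernel_eq[OF c(2,3)[OF \<delta>]] algebra_simps)
  qed
  then show ?thesis using c(1) by (intro eventually_at_rightI[of 0 c]) auto
qed

text \<open>The Plemelj jump formula for a density that is only a derivative: the kernel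
  concentrates at \<open>t\<close> like \<open>2 * pi * \<i>\<close> times a point mass, and
  differentiability of \<open>\<Theta>\<close> at \<open>t\<close> takes the place of continuity of
  the density.\<close>

lemma jump:
  assumes t: "0 < t" "t < 2 * pi"
    and \<Theta>: "\<And>s. s \<in> J_range \<Longrightarrow> (\<Theta> has_vector_derivative \<Theta>' s) (at s within J_range)"
  shows "((\<lambda>\<delta>. integral J_range (\<lambda>s. jump_kernel t \<delta> s * \<Theta>' s)) \<longlongrightarrow> 2 * pi * \<i> * \<Theta>' t) (at_right 0)"
proof (rule tendstoI)
  fix e :: real assume "e > 0"
  obtain M where M: "M \<ge> 1" "\<And>t s. norm (zeta t s - of_real (s - t)) \<le> M * (s - t)\<^sup>2"
    "\<And>t s. norm (p' s / p' t) \<le> M"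
    "\<And>t s. \<bar>s - t\<bar> \<le> 1 / (4 * M) \<Longrightarrow> norm (zeta t s - of_real (s - t)) \<le> \<bar>s - t\<bar> / 4"
    using zeta_normal_form by metis
  define g where "g = \<Theta>' t"
  define C where "C = 16 + 320 * M + 18 * norm g"
  have "C > 0" using M(1) by (simp add: C_def add_pos_nonneg)
  define \<epsilon> where "\<epsilon> = e / (2 * C)"
  have "\<epsilon> > 0" using \<open>e > 0\<close> \<open>C > 0\<close> by (simp add: \<epsilon>_def)
  have "(\<Theta> has_derivative (\<lambda>h. h *\<^sub>R g)) (at t within J_range)"
    using \<Theta>[of t] t by (simp add: has_vector_derivative_def g_def)
  then obtain d where d: "d > 0" "\<And>s. s \<in> J_range \<Longrightarrow> \<bar>s - t\<bar> < d \<Longrightarrow>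
      norm (\<Theta> s - \<Theta> t - (s - t) *\<^sub>R g) \<le> \<epsilon> * \<bar>s - t\<bar>"
    using \<open>\<epsilon> > 0\<close> unfolding has_derivative_within_alt by (metis real_norm_def)
  \<comment> \<open>In this order: the differential quotient at \<open>t\<close> is within
    \<epsilon>, the quarter bound for \<open>zeta\<close> holds,
    \<open>M * \<eta> \<le> \<epsilon>\<close>, and the interval around \<open>t\<close> stays in
    \<open>J_range\<close>.\<close>
  define \<eta> where "\<eta> = Min {d / 2, 1 / (4 * M), \<epsilon> / M, t, 2 * pi - t}"
  have "\<eta> > 0" using d(1) M(1) \<open>\<epsilon> > 0\<close> t by (simp add: \<eta>_def)
  have \<eta>: "\<eta> \<le> d / 2" "\<eta> \<le> 1 / (4 * M)" "\<eta> \<le> \<epsilon> / M" "\<eta> \<le> t" "\<eta> \<le> 2 * pi - t"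
    unfolding \<eta>_def by (rule Min.coboundedI; simp)+
  have M\<eta>: "M * \<eta> \<le> \<epsilon>" using \<eta>(3) M(1) by (simp add: field_simps)
  have R: "norm (\<Theta> s - \<Theta> t - of_real (s - t) * g) \<le> \<epsilon> * \<bar>s - t\<bar>" if "\<bar>s - t\<bar> \<le> \<eta>" for s
  proof -
    have "s \<in> J_range" "\<bar>s - t\<bar> < d" using that \<eta> \<open>\<eta> > 0\<close> by auto
    then show ?thesis using d(2)[of s] by (simp add: scaleR_conv_of_real)
  qed
  have near: "norm (zeta t s - of_real (s - t)) \<le> \<bar>s - t\<bar> / 4" if "\<bar>s - t\<bar> \<le> \<eta>" for s
    using M(4) \<eta>(2) that by simp
  have sub: "(\<Theta> has_vector_derivative \<Theta>' s) (at s within {a..b})" if "s \<in> {a..b}" "{a..b} \<subseteq> J_range" for s a b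
    using \<Theta> that has_vector_derivative_within_subset by blast
  have I3: "{t-\<eta>..t+\<eta>} \<subseteq> J_range" "{0..t-\<eta>} \<subseteq> J_range - {t}" "{t+\<eta>..2*pi} \<subseteq> J_range - {t}"
    using \<eta> \<open>\<eta> > 0\<close> t by auto
  let ?F = "\<lambda>a b \<delta>. integral {a..b} (\<lambda>s. jump_kernel t \<delta> s * \<Theta>' s)"
  have far1: "(?F 0 (t-\<eta>) \<longlongrightarrow> 0) (at_right 0)"
    by (rule jump_kernel_far_tendsto[OF t _ I3(2) sub]) (use \<eta> I3 t \<open>\<eta> > 0\<close> in auto)
  have far2: "(?F (t+\<eta>) (2*pi) \<longlongrightarrow> 0) (at_right 0)"
    by (rule jump_kernel_far_tendsto[OF t _ I3(3) sub]) (use \<eta> I3 t \<open>\<eta> > 0\<close> in auto)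
  have poi: "((\<lambda>\<delta>. g * (2 * \<i> * of_real (2 * arctan (\<eta> / \<delta>)))) \<longlongrightarrow> g * (2 * \<i> * of_real pi)) (at_right 0)"
    by (intro tendsto_mult tendsto_const tendsto_of_real poisson_limit \<open>\<eta> > 0\<close>)
  have "((\<lambda>\<delta>. g * (2 * \<i> * of_real (2 * arctan (\<eta> / \<delta>))) + ?F 0 (t-\<eta>) \<delta> + ?F (t+\<eta>) (2*pi) \<delta>)
     \<longlongrightarrow> g * (2 * \<i> * of_real pi) + 0 + 0) (at_right 0)"
    by (intro tendsto_add far1 far2 poi)
  then have lim: "\<forall>\<^sub>F \<delta> in at_right 0. dist (g * (2 * \<i> * of_real (2 * arctan (\<eta> / \<delta>))) + ?F 0 (t-\<eta>) \<delta> + ?F (t+\<eta>) (2*pi) \<delta>)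
     (2 * pi * \<i> * g) < e / 2"
    using \<open>e > 0\<close> by (intro tendstoD) (simp_all add: mult_ac)
  have small: "\<forall>\<^sub>F \<delta> in at_right 0. 0 < \<delta> \<and> \<delta> \<le> \<eta>"
    using \<open>\<eta> > 0\<close> by (intro eventually_at_rightI[of 0 \<eta>]) auto
  have int: "\<forall>\<^sub>F \<delta> in at_right 0. (\<lambda>s. jump_kernel t \<delta> s * \<Theta>' s) integrable_on J_range"
    by (rule eventually_mono[OF jump_kernel_integral[where t = t, OF \<Theta>]]) (auto intro: has_integral_integrable)
  show "\<forall>\<^sub>F \<delta> in at_right 0. dist (?F 0 (2*pi) \<delta>) (2 * pi * \<i> * \<Theta>' t) < e"
    using lim small int
  proof eventually_elim
    case (elim \<delta>)
    note int = elim(3)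
    have "?F 0 (t-\<eta>) \<delta> + ?F (t-\<eta>) (2*pi) \<delta> = ?F 0 (2*pi) \<delta>"
      by (intro Henstock_Kurzweil_Integration.integral_combine int) (use \<eta> \<open>\<eta> > 0\<close> t in auto)
    moreover have "?F (t-\<eta>) (t+\<eta>) \<delta> + ?F (t+\<eta>) (2*pi) \<delta> = ?F (t-\<eta>) (2*pi) \<delta>"
      by (intro Henstock_Kurzweil_Integration.integral_combine integrable_subinterval_real[OF int]) (use \<eta> \<open>\<eta> > 0\<close> t in auto)
    moreover have "norm (?F (t-\<eta>) (t+\<eta>) \<delta> - g * (2 * \<i> * of_real (2 * arctan (\<eta> / \<delta>)))) \<le> C * \<epsilon>"
      unfolding C_def
      by (rule jump_kernel_near[OF t \<open>\<epsilon> > 0\<close> M(1) \<open>\<eta> > 0\<close> M\<eta> M(2,3) near sub R])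
        (use elim I3 in auto)
    moreover have "C * \<epsilon> = e / 2" using \<open>C > 0\<close> by (simp add: \<epsilon>_def)
    ultimately have split: "?F 0 (2*pi) \<delta> = ?F 0 (t-\<eta>) \<delta> + ?F (t-\<eta>) (t+\<eta>) \<delta> + ?F (t+\<eta>) (2*pi) \<delta>"
      and near: "norm (?F (t-\<eta>) (t+\<eta>) \<delta> - g * (2 * \<i> * of_real (2 * arctan (\<eta> / \<delta>)))) \<le> e / 2"
      by (simp_all add: algebra_simps)
    have "?F 0 (2*pi) \<delta> - 2 * pi * \<i> * g = (?F (t-\<eta>) (t+\<eta>) \<delta> - g * (2 * \<i> * of_real (2 * arctan (\<eta> / \<delta>)))) +
      (g * (2 * \<i> * of_real (2 * arctan (\<eta> / \<delta>))) + ?F 0 (t-\<eta>) \<delta> + ?F (t+\<eta>) (2*pi) \<delta> - 2 * pi * \<i> * g)"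
      unfolding split by simp
    also have "norm \<dots> < e / 2 + e / 2"
      using near elim(1) by (intro norm_triangle_lt add_le_less_mono) (auto simp: dist_norm)
    finally show ?case by (simp add: dist_norm g_def)
  qed
qed

text \<open>With the real number \<open>u = s - t\<close> (modulo the period) in place of
  \<open>zeta t s\<close> the sum is real, so the imaginary part only sees the error. Each fraction
  changes by at most \<open>2 * M\<close>, since the quadratic error is compared with a denominator
  of size \<open>(u\<^sup>2 + \<delta>\<^sup>2) / 2\<close>. Away from the diagonal
  \<open>\<delta> < c / 2\<close> bounds each fraction by \<open>2 / c\<close>.\<close>

lemma symmetric_kernel_bounded:
  obtains B c where "c > 0"
    "\<And>t s \<delta>. 0 \<le> \<delta> \<Longrightarrow> \<delta> < c \<Longrightarrow> zeta t s \<noteq> 0 \<Longrightarrow>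
      \<bar>Im (1 / (zeta t s - \<i> * of_real \<delta>) + 1 / (zeta t s + \<i> * of_real \<delta>))\<bar> \<le> B"
proof -
  obtain M c where M: "M \<ge> 1" "c > 0"
    "\<And>t s. norm (zeta t s - of_real (s - t)) \<le> M * (s - t)\<^sup>2"
    "\<And>t s. \<bar>s - t\<bar> \<le> 1 / (4 * M) \<Longrightarrow> norm (zeta t s - of_real (s - t)) \<le> \<bar>s - t\<bar> / 4"
    "\<And>t s. norm (zeta t s) < c \<Longrightarrow> \<exists>n::int. \<bar>s - t - 2 * pi * of_int n\<bar> \<le> 1 / (4 * M)"
    using zeta_normal_form by metis
  have "\<bar>Im (1 / (zeta t s - \<i> * of_real \<delta>) + 1 / (zeta t s + \<i> * of_real \<delta>))\<bar> \<le> 4 / c + 4 * M"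
    if \<delta>: "0 \<le> \<delta>" "\<delta> < c / 2" and nz: "zeta t s \<noteq> 0" for t s \<delta>
  proof (cases "norm (zeta t s) < c")
    case False
    have bd: "norm (1 / (zeta t s + \<i> * of_real d)) \<le> 2 / c" if "\<bar>d\<bar> = \<delta>" for d
    proof -
      have "norm (zeta t s) - norm (\<i> * of_real d) \<le> norm (zeta t s + \<i> * of_real d)"
        by (rule norm_diff_ineq)
      then have "c / 2 \<le> norm (zeta t s + \<i> * of_real d)" using False \<delta> that by (simp add: norm_mult)
      then have "1 / norm (zeta t s + \<i> * of_real d) \<le> 1 / (c / 2)"
        using M(2) by (intro divide_left_mono mult_pos_pos) auto
      then show ?thesis by (simp add: norm_divide)
    qed
    have "\<bar>Im (1 / (zeta t s - \<i> * of_real \<delta>) + 1 / (zeta t s + \<i> * of_real \<delta>))\<bar> \<le>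
      norm (1 / (zeta t s - \<i> * of_real \<delta>) + 1 / (zeta t s + \<i> * of_real \<delta>))" by (rule abs_Im_le_cmod)
    also have "\<dots> \<le> 2 / c + 2 / c"
      using bd[of \<delta>] bd[of "-\<delta>"] \<delta> by (intro norm_triangle_mono) auto
    also have "\<dots> \<le> 4 / c + 4 * M" using M(1) by simp
    finally show ?thesis .
  next
    case True
    then obtain n :: int where n: "\<bar>s - t - 2 * pi * of_int n\<bar> \<le> 1 / (4 * M)" using M(5) by metis
    define s' where "s' = s - 2 * pi * of_int n"
    define u where "u = s' - t"
    have zz: "zeta t s = zeta t s'" using zeta_periodic(1)[of t s' n] by (simp add: s'_def)
    have zu: "norm (zeta t s - of_real u) \<le> \<bar>u\<bar> / 4" "norm (zeta t s - of_real u) \<le> M * u\<^sup>2"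
      using n M(3)[of t s'] M(4)[of s' t] unfolding zz u_def by (simp_all add: s'_def algebra_simps)
    have "u \<noteq> 0" using zu(1) nz by auto
    have bd: "norm (1 / (zeta t s + \<i> * of_real d) - 1 / (of_real u + \<i> * of_real d)) \<le> 2 * M" for d
    proof -
      define r where "r = sqrt (u\<^sup>2 + d\<^sup>2)"
      have r: "r > 0" "u\<^sup>2 \<le> r\<^sup>2" using \<open>u \<noteq> 0\<close> by (auto simp: r_def add_pos_nonneg)
      have 1: "r / 2 \<le> norm (zeta t s + \<i> * of_real d)"
        unfolding r_def by (rule norm_perturbed_real_plus_imaginary(1)[OF zu(1)])
      have 2: "norm (of_real u + \<i> * of_real d) = r" by (simp add: cmod_def r_def)
      have "1 / (zeta t s + \<i> * of_real d) - 1 / (of_real u + \<i> * of_real d) =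
        (of_real u - zeta t s) / ((zeta t s + \<i> * of_real d) * (of_real u + \<i> * of_real d))"
        by (subst diff_frac_eq) (use 1 2 r in auto)
      then have "norm (1 / (zeta t s + \<i> * of_real d) - 1 / (of_real u + \<i> * of_real d)) =
        norm (zeta t s - of_real u) / (norm (zeta t s + \<i> * of_real d) * r)"
        by (simp only: norm_divide norm_mult 2 norm_minus_commute)
      also have "\<dots> \<le> (M * r\<^sup>2) / (r / 2 * r)"
      proof (intro frac_le mult_right_mono 1)
        have "M * u\<^sup>2 \<le> M * r\<^sup>2" using r(2) M(1) by (intro mult_left_mono) auto
        then show "norm (zeta t s - of_real u) \<le> M * r\<^sup>2" using zu(2) by linarith
      qed (use r M(1) in auto)
      also have "\<dots> = 2 * M" using r by (simp add: power2_eq_square)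
      finally show ?thesis .
    qed
    have real: "1 / (of_real u - \<i> * of_real \<delta>) + 1 / (of_real u + \<i> * of_real \<delta>) = complex_of_real (2 * u / (u\<^sup>2 + \<delta>\<^sup>2))"
    proof -
      have "of_real u - \<i> * of_real \<delta> \<noteq> 0" "of_real u + \<i> * of_real \<delta> \<noteq> 0"
        using \<open>u \<noteq> 0\<close> by (auto simp: complex_eq_iff)
      then have "1 / (of_real u - \<i> * of_real \<delta>) + 1 / (of_real u + \<i> * of_real \<delta>) =
        (2 * of_real u) / ((of_real u - \<i> * of_real \<delta>) * (of_real u + \<i> * of_real \<delta>))"
        by (simp add: add_frac_eq)
      also have "(of_real u - \<i> * of_real \<delta>) * (of_real u + \<i> * of_real \<delta>) = complex_of_real (u\<^sup>2 + \<delta>\<^sup>2)"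
        by (simp add: algebra_simps power2_eq_square)
      finally show ?thesis by simp
    qed
    have "Im (1 / (zeta t s - \<i> * of_real \<delta>) + 1 / (zeta t s + \<i> * of_real \<delta>)) =
      Im ((1 / (zeta t s - \<i> * of_real \<delta>) - 1 / (of_real u - \<i> * of_real \<delta>)) +
          (1 / (zeta t s + \<i> * of_real \<delta>) - 1 / (of_real u + \<i> * of_real \<delta>)))"
      using arg_cong[OF real, of Im] by simp
    also have "\<bar>\<dots>\<bar> \<le> norm ((1 / (zeta t s - \<i> * of_real \<delta>) - 1 / (of_real u - \<i> * of_real \<delta>)) +
          (1 / (zeta t s + \<i> * of_real \<delta>) - 1 / (of_real u + \<i> * of_real \<delta>)))" by (rule abs_Im_le_cmod)
    also have "\<dots> \<le> 2 * M + 2 * M" using bd[of \<delta>] bd[of "-\<delta>"] by (intro norm_triangle_mono) auto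
    also have "\<dots> \<le> 4 / c + 4 * M" using M(2) by simp
    finally show ?thesis .
  qed
  with M(2) show ?thesis by (intro that[of "c / 2"]) auto
qed

text \<open>With \<open>\<Theta> = p\<close> the Cauchy integrals are winding numbers. They are
  constant on each of the two strips along the curve, since these are connected, so it suffices to
  evaluate the jump at one interior parameter, here \<open>pi\<close>.\<close>

lemma winding_jump:
  obtains c where "c > 0"
    "\<And>t \<delta>. 0 < \<delta> \<Longrightarrow> \<delta> < c \<Longrightarrow> p t + \<i> * of_real \<delta> * p' t \<notin> curve p \<and> p t - \<i> * of_real \<delta> * p' t \<notin> curve p \<and>
      winding_number (unit_path p) (p t + \<i> * of_real \<delta> * p' t) - winding_number (unit_path p) (p t - \<i> * of_real \<delta> * p' t) = 1"
proof -
  obtain c where c: "c > 0"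
    "\<And>t \<delta>. 0 < \<delta> \<Longrightarrow> \<delta> < c \<Longrightarrow> p t + \<i> * of_real \<delta> * p' t \<notin> curve p"
    "\<And>t \<delta>. 0 < \<delta> \<Longrightarrow> \<delta> < c \<Longrightarrow> p t - \<i> * of_real \<delta> * p' t \<notin> curve p"
    using displaced_nonzero by metis
  let ?W = "winding_number (unit_path p)"
  define A where "A = (UNIV :: real set) \<times> {0<..<c}"
  have path: "path (unit_path p)" by (rule valid_path_imp_path[OF valid_path_p])
  have "connected A" unfolding A_def by (intro connected_Times) auto
  have "connected ((\<lambda>x. p (fst x) + \<i> * of_real (snd x) * p' (fst x)) ` A)"
    by (intro connected_continuous_image \<open>connected A\<close> continuous_intros)
  moreover have "(\<lambda>x. p (fst x) + \<i> * of_real (snd x) * p' (fst x)) ` A \<inter> path_image (unit_path p) = {}"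
    using c(2) unfolding A_def curve_eq_path_image[symmetric] by auto
  ultimately have "?W constant_on ((\<lambda>x. p (fst x) + \<i> * of_real (snd x) * p' (fst x)) ` A)"
    by (rule winding_number_constant[OF path loop_p])
  then obtain k1 where k1: "\<And>t \<delta>. 0 < \<delta> \<Longrightarrow> \<delta> < c \<Longrightarrow> ?W (p t + \<i> * of_real \<delta> * p' t) = k1"
    unfolding constant_on_def A_def by fastforce
  have "connected ((\<lambda>x. p (fst x) - \<i> * of_real (snd x) * p' (fst x)) ` A)"
    by (intro connected_continuous_image \<open>connected A\<close> continuous_intros)
  moreover have "(\<lambda>x. p (fst x) - \<i> * of_real (snd x) * p' (fst x)) ` A \<inter> path_image (unit_path p) = {}"
    using c(3) unfolding A_def curve_eq_path_image[symmetric] by auto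
  ultimately have "?W constant_on ((\<lambda>x. p (fst x) - \<i> * of_real (snd x) * p' (fst x)) ` A)"
    by (rule winding_number_constant[OF path loop_p])
  then obtain k2 where k2: "\<And>t \<delta>. 0 < \<delta> \<Longrightarrow> \<delta> < c \<Longrightarrow> ?W (p t - \<i> * of_real \<delta> * p' t) = k2"
    unfolding constant_on_def A_def by fastforce
  have small: "\<forall>\<^sub>F \<delta> in at_right 0. 0 < \<delta> \<and> \<delta> < c"
    using c(1) by (intro eventually_at_rightI[of 0 c]) auto
  have "\<forall>\<^sub>F \<delta> in at_right 0. integral J_range (\<lambda>s. jump_kernel pi \<delta> s * p' s) = p' pi * (2 * pi * \<i> * (k1 - k2))"
    using small jump_kernel_integral[where \<Theta> = p and \<Theta>' = p' and t = pi, OF has_deriv]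
  proof eventually_elim
    case (elim \<delta>)
    have "integral J_range (\<lambda>s. p' s / (p s - (p pi + \<i> * of_real \<delta> * p' pi))) = 2 * pi * \<i> * k1"
      "integral J_range (\<lambda>s. p' s / (p s - (p pi - \<i> * of_real \<delta> * p' pi))) = 2 * pi * \<i> * k2"
      using integral_unique[OF winding_eq_integral[OF c(2)[of \<delta> pi]]]
        integral_unique[OF winding_eq_integral[OF c(3)[of \<delta> pi]]] k1[of \<delta> pi] k2[of \<delta> pi] elim(1)
      by auto
    then show ?case by (simp only: integral_unique[OF elim(2)]) (simp add: algebra_simps)
  qed
  moreover have "((\<lambda>\<delta>. integral J_range (\<lambda>s. jump_kernel pi \<delta> s * p' s)) \<longlongrightarrow> 2 * pi * \<i> * p' pi) (at_right 0)"
    by (rule jump[OF _ _ has_deriv]) auto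
  ultimately have "((\<lambda>\<delta>. p' pi * (2 * pi * \<i> * (k1 - k2))) \<longlongrightarrow> 2 * pi * \<i> * p' pi) (at_right (0::real))"
    by (rule Lim_transform_eventually[rotated])
  then have "p' pi * (2 * pi * \<i> * (k1 - k2)) = 2 * pi * \<i> * p' pi"
    using tendsto_unique[OF trivial_limit_at_right_real] tendsto_const by blast
  then have "(2 * pi * \<i> * p' pi) * (k1 - k2) = (2 * pi * \<i> * p' pi) * 1" by (simp add: mult_ac)
  then have "k1 - k2 = 1" by (subst (asm) mult_left_cancel) simp_all
  then show ?thesis using that[OF c(1)] c k1 k2 by simp
qed

text \<open>Off the curve the winding number is 1 inside and 0 outside, so a difference of 1 can be
  placed in one way only.\<close>

lemma sides_counterclockwise:
  assumes "counterclockwise p"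
  obtains c where "c > 0"
    "\<And>t \<delta>. 0 < \<delta> \<Longrightarrow> \<delta> < c \<Longrightarrow>
      p t + \<i> * of_real \<delta> * p' t \<in> inside (curve p) \<and> p t - \<i> * of_real \<delta> * p' t \<in> outside (curve p)"
proof -
  have W: "w \<in> inside (curve p) \<and> winding_number (unit_path p) w = 1 \<or>
      w \<in> outside (curve p) \<and> winding_number (unit_path p) w = 0" if "w \<notin> curve p" for w
    using assms winding_outside jordan_sides(9) that unfolding counterclockwise_def by blast
  obtain c where c: "c > 0"
    "\<And>t \<delta>. 0 < \<delta> \<Longrightarrow> \<delta> < c \<Longrightarrow> p t + \<i> * of_real \<delta> * p' t \<notin> curve p \<and> p t - \<i> * of_real \<delta> * p' t \<notin> curve p \<and>
      winding_number (unit_path p) (p t + \<i> * of_real \<delta> * p' t) - winding_number (unit_path p) (p t - \<i> * of_real \<delta> * p' t) = 1"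
    using winding_jump by metis
  show ?thesis
  proof (rule that[OF c(1)])
    fix t \<delta> :: real assume "0 < \<delta>" "\<delta> < c"
    from c(2)[OF this, of t] W[of "p t + \<i> * of_real \<delta> * p' t"] W[of "p t - \<i> * of_real \<delta> * p' t"]
    show "p t + \<i> * of_real \<delta> * p' t \<in> inside (curve p) \<and> p t - \<i> * of_real \<delta> * p' t \<in> outside (curve p)"
      by auto
  qed
qed

lemma sides_clockwise:
  assumes "clockwise p"
  obtains c where "c > 0"
    "\<And>t \<delta>. 0 < \<delta> \<Longrightarrow> \<delta> < c \<Longrightarrow>
      p t + \<i> * of_real \<delta> * p' t \<in> outside (curve p) \<and> p t - \<i> * of_real \<delta> * p' t \<in> inside (curve p)"
proof -
  have W: "w \<in> inside (curve p) \<and> winding_number (unit_path p) w = - 1 \<or>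
      w \<in> outside (curve p) \<and> winding_number (unit_path p) w = 0" if "w \<notin> curve p" for w
    using assms winding_outside jordan_sides(9) that unfolding clockwise_def by blast
  obtain c where c: "c > 0"
    "\<And>t \<delta>. 0 < \<delta> \<Longrightarrow> \<delta> < c \<Longrightarrow> p t + \<i> * of_real \<delta> * p' t \<notin> curve p \<and> p t - \<i> * of_real \<delta> * p' t \<notin> curve p \<and>
      winding_number (unit_path p) (p t + \<i> * of_real \<delta> * p' t) - winding_number (unit_path p) (p t - \<i> * of_real \<delta> * p' t) = 1"
    using winding_jump by metis
  show ?thesis
  proof (rule that[OF c(1)])
    fix t \<delta> :: real assume "0 < \<delta>" "\<delta> < c"
    from c(2)[OF this, of t] W[of "p t + \<i> * of_real \<delta> * p' t"] W[of "p t - \<i> * of_real \<delta> * p' t"]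
    show "p t + \<i> * of_real \<delta> * p' t \<in> outside (curve p) \<and> p t - \<i> * of_real \<delta> * p' t \<in> inside (curve p)"
      by auto
  qed
qed

end

subsection \<open>Geometry of the doubly connected region\<close>

text \<open>An arc \<open>L\<close> in the region connects the loops; run through in both directions
  it contributes nothing to integrals or winding numbers, and the homological Cauchy theorem for one
  closed path applies.\<close>

lemma Cauchy_theorem_two_loops:
  assumes S: "open S" "connected S" and g: "g holomorphic_on S"
    and v: "valid_path \<gamma>0" "valid_path \<gamma>1"
    and loop: "pathfinish \<gamma>0 = pathstart \<gamma>0" "pathfinish \<gamma>1 = pathstart \<gamma>1"
    and im: "path_image \<gamma>0 \<subseteq> S" "path_image \<gamma>1 \<subseteq> S"
    and wind: "\<And>w. w \<notin> S \<Longrightarrow> winding_number \<gamma>0 w + winding_number \<gamma>1 w = 0"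
  shows "contour_integral \<gamma>0 g + contour_integral \<gamma>1 g = 0"
proof -
  have "pathstart \<gamma>0 \<in> S" "pathstart \<gamma>1 \<in> S" using im pathstart_in_path_image by blast+
  then obtain L where L: "polynomial_function L" "path_image L \<subseteq> S" "pathstart L = pathstart \<gamma>0" "pathfinish L = pathstart \<gamma>1"
    using connected_open_polynomial_connected[OF S] by metis
  have vL: "valid_path L" using L(1) by (rule valid_path_polynomial_function)
  define G where "G = \<gamma>0 +++ (L +++ (\<gamma>1 +++ reversepath L))"
  have vG: "valid_path G" unfolding G_def using v vL L loop by (intro valid_path_join) auto
  have imG: "path_image G \<subseteq> S"
    unfolding G_def using im L loop by (auto simp: path_image_join)
  note paths = valid_path_imp_path[OF v(1)] valid_path_imp_path[OF v(2)] valid_path_imp_path[OF vL]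
  have "winding_number G w = 0" if "w \<notin> S" for w
  proof -
    have w: "w \<notin> path_image \<gamma>0" "w \<notin> path_image \<gamma>1" "w \<notin> path_image L" using that im L by auto
    have "winding_number G w = winding_number \<gamma>0 w + (winding_number L w + (winding_number \<gamma>1 w - winding_number L w))"
      unfolding G_def using paths w L loop
      by (simp add: winding_number_join winding_number_reversepath path_image_join)
    then show ?thesis using wind[OF that] by simp
  qed
  then have "(g has_contour_integral 0) G"
    by (intro Cauchy_theorem_global[OF S(1) g vG _ imG]) (auto simp: G_def L)
  then have "contour_integral G g = 0" by (rule contour_integral_unique)
  moreover have ci: "g contour_integrable_on \<gamma>0" "g contour_integrable_on \<gamma>1" "g contour_integrable_on L"
    using contour_integrable_holomorphic_simple[OF g S(1)] v vL im L by auto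
  have "contour_integral G g = contour_integral \<gamma>0 g + (contour_integral L g + (contour_integral \<gamma>1 g - contour_integral L g))"
    unfolding G_def using ci v vL L loop
    by (simp add: contour_integral_join contour_integral_reversepath contour_integrable_join contour_integrable_reversepath)
  ultimately show ?thesis by simp
qed

text \<open>The difference quotient of \<open>g\<close> at \<open>w\<close> is holomorphic in all of
  \<open>S\<close> and integrates to 0; what remains is \<open>g w\<close> times the winding
  numbers.\<close>

lemma Cauchy_integral_formula_two_loops:
  assumes S: "open S" "connected S" and g: "g holomorphic_on S"
    and v: "valid_path \<gamma>0" "valid_path \<gamma>1"
    and loop: "pathfinish \<gamma>0 = pathstart \<gamma>0" "pathfinish \<gamma>1 = pathstart \<gamma>1"
    and im: "path_image \<gamma>0 \<subseteq> S - {w}" "path_image \<gamma>1 \<subseteq> S - {w}"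
    and wind: "\<And>w. w \<notin> S \<Longrightarrow> winding_number \<gamma>0 w + winding_number \<gamma>1 w = 0"
    and w: "w \<in> S"
  shows "contour_integral \<gamma>0 (\<lambda>v. g v / (v - w)) + contour_integral \<gamma>1 (\<lambda>v. g v / (v - w)) =
    2 * pi * \<i> * (winding_number \<gamma>0 w + winding_number \<gamma>1 w) * g w"
proof -
  define h where "h = (\<lambda>v. if v = w then deriv g w else (g v - g w) / (v - w))"
  have h: "h holomorphic_on S" unfolding h_def by (rule pole_lemma_open[OF g S(1)])
  have "contour_integral \<gamma>0 h + contour_integral \<gamma>1 h = 0"
    by (rule Cauchy_theorem_two_loops[OF S h v loop _ _ wind]) (use im in auto)
  moreover have "contour_integral \<gamma> (\<lambda>v. g v / (v - w)) = contour_integral \<gamma> h + 2 * pi * \<i> * winding_number \<gamma> w * g w"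
    if "valid_path \<gamma>" "path_image \<gamma> \<subseteq> S - {w}" for \<gamma>
  proof -
    have "h contour_integrable_on \<gamma>"
      using contour_integrable_holomorphic_simple[OF h S(1)] that by auto
    moreover have "((\<lambda>v. 1 / (v - w)) has_contour_integral 2 * pi * \<i> * winding_number \<gamma> w) \<gamma>"
      using has_contour_integral_winding_number[OF that(1), of w] that by auto
    ultimately have "((\<lambda>v. h v + g w * (1 / (v - w))) has_contour_integral
      contour_integral \<gamma> h + g w * (2 * pi * \<i> * winding_number \<gamma> w)) \<gamma>"
      by (intro has_contour_integral_add has_contour_integral_lmul has_contour_integral_integral)
    then have "((\<lambda>v. g v / (v - w)) has_contour_integral
      contour_integral \<gamma> h + g w * (2 * pi * \<i> * winding_number \<gamma> w)) \<gamma>"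
      by (rule has_contour_integral_eq) (use that in \<open>auto simp: h_def diff_divide_distrib\<close>)
    then show ?thesis by (simp add: contour_integral_unique mult_ac)
  qed
  ultimately show ?thesis using v im by (simp add: algebra_simps)
qed

locale doubly_connected =
  fixes \<Omega> :: "complex set" and z :: "nat \<Rightarrow> real \<Rightarrow> complex"
  assumes region: "doubly_connected_region \<Omega> z"
begin

lemma open_\<Omega>: "open \<Omega>" and connected_\<Omega>: "connected \<Omega>" and bounded_\<Omega>: "bounded \<Omega>"
  and param0: "regular_jordan_param (z 0)" and param1: "regular_jordan_param (z 1)"
  and frontier_\<Omega>: "frontier \<Omega> = curve (z 0) \<union> curve (z 1)"
  and curves_disjoint: "curve (z 0) \<inter> curve (z 1) = {}"
  and curve1_inside: "curve (z 1) \<subseteq> inside (curve (z 0))"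
  and ccw: "counterclockwise (z 0)" and cw: "clockwise (z 1)"
  using region unfolding doubly_connected_region_def by blast+

sublocale z0: jordan_param "z 0" by unfold_locales (rule param0)
sublocale z1: jordan_param "z 1" by unfold_locales (rule param1)

lemma jordan_param: "j \<in> {0, 1} \<Longrightarrow> jordan_param (z j)"
  using z0.jordan_param_axioms z1.jordan_param_axioms by auto

text \<open>The closed exterior of the outer curve is connected and misses the inner curve, so it
  lies on one side of it. Being unbounded, it lies outside.\<close>

lemma closure_outside0: "outside (curve (z 0)) \<union> curve (z 0) \<subseteq> outside (curve (z 1))"
proof -
  have cl: "closure (outside (curve (z 0))) = outside (curve (z 0)) \<union> curve (z 0)"
    using closure_Un_frontier z0.jordan_sides(11) by blast
  let ?C = "outside (curve (z 0)) \<union> curve (z 0)"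
  have con: "connected ?C" using connected_imp_connected_closure[OF z0.jordan_sides(6)] unfolding cl .
  have "?C \<inter> curve (z 1) = {}" using curve1_inside z0.jordan_sides(8) curves_disjoint by blast
  then have sub: "?C \<subseteq> inside (curve (z 1)) \<union> outside (curve (z 1))" using z1.jordan_sides(9) by blast
  have "\<not> ?C \<subseteq> inside (curve (z 1))"
  proof
    assume "?C \<subseteq> inside (curve (z 1))"
    then have "bounded (outside (curve (z 0)))" using z1.jordan_sides(7) by (meson bounded_subset le_supE)
    then show False using unbounded_outside z0.compact_curve compact_imp_bounded by blast
  qed
  then show ?thesis
    using connectedD[OF con z1.jordan_sides(2) z1.jordan_sides(5)] z1.jordan_sides(8) sub by blast
qed

lemma closure_inside1: "inside (curve (z 1)) \<union> curve (z 1) \<subseteq> inside (curve (z 0))"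
  using closure_outside0 z0.jordan_sides(9) z1.jordan_sides(9) z1.jordan_sides(8) curve1_inside by blast

lemma \<Omega>_disjoint: "\<Omega> \<inter> (curve (z 0) \<union> curve (z 1)) = {}"
  using frontier_\<Omega> open_\<Omega> frontier_disjoint_eq by blast

lemma closure_\<Omega>: "closure \<Omega> = \<Omega> \<union> curve (z 0) \<union> curve (z 1)"
  using closure_Un_frontier[of \<Omega>] frontier_\<Omega> by blast

text \<open>Connectedness puts \<Omega> on one side of each curve. On the wrong side of one curve
  its closure would miss the other curve, which belongs to its frontier.\<close>

lemma \<Omega>_subset: "\<Omega> \<subseteq> inside (curve (z 0)) \<inter> outside (curve (z 1))"
proof -
  have ne: "curve (z 0) \<noteq> {}" "curve (z 1) \<noteq> {}" using z0.in_curve z1.in_curve by blast+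
  then have "\<Omega> \<noteq> {}" using frontier_\<Omega> by auto
  have "\<Omega> \<subseteq> inside (curve (z 0)) \<union> outside (curve (z 0))" using \<Omega>_disjoint z0.jordan_sides(9) by blast
  moreover have "\<not> \<Omega> \<subseteq> outside (curve (z 0))"
  proof
    assume "\<Omega> \<subseteq> outside (curve (z 0))"
    then have "closure \<Omega> \<subseteq> closure (outside (curve (z 0)))" by (rule closure_mono)
    also have "\<dots> = outside (curve (z 0)) \<union> curve (z 0)" using closure_Un_frontier z0.jordan_sides(11) by blast
    finally have "curve (z 1) \<subseteq> outside (curve (z 0)) \<union> curve (z 0)" using closure_\<Omega> by blast
    then show False using ne(2) curves_disjoint curve1_inside z0.jordan_sides(8) by blast
  qed
  ultimately have in0: "\<Omega> \<subseteq> inside (curve (z 0))"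
    using connectedD[OF connected_\<Omega> z0.jordan_sides(2) z0.jordan_sides(5)] z0.jordan_sides(8) by blast
  have "\<Omega> \<subseteq> inside (curve (z 1)) \<union> outside (curve (z 1))" using \<Omega>_disjoint z1.jordan_sides(9) by blast
  moreover have "\<not> \<Omega> \<subseteq> inside (curve (z 1))"
  proof
    assume "\<Omega> \<subseteq> inside (curve (z 1))"
    then have "closure \<Omega> \<subseteq> closure (inside (curve (z 1)))" by (rule closure_mono)
    also have "\<dots> = inside (curve (z 1)) \<union> curve (z 1)" using closure_Un_frontier z1.jordan_sides(10) by blast
    finally have "curve (z 0) \<subseteq> inside (curve (z 1)) \<union> curve (z 1)" using closure_\<Omega> by blast
    then show False using ne(1) closure_inside1 z0.jordan_sides(9) by blast
  qed
  ultimately have "\<Omega> \<subseteq> outside (curve (z 1))"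
    using connectedD[OF connected_\<Omega> z1.jordan_sides(2) z1.jordan_sides(5)] z1.jordan_sides(8) by blast
  with in0 show ?thesis by blast
qed

text \<open>By Janiszewski's theorem two points separated by neither curve are not separated by
  their union, the empty intersection being connected. A connected set that joins a point of
  \<Omega> to another point without meeting the frontier stays in \<Omega>.\<close>

lemma \<Omega>_eq: "\<Omega> = inside (curve (z 0)) \<inter> outside (curve (z 1))"
proof (rule antisym[OF \<Omega>_subset])
  define A where "A = inside (curve (z 0)) \<inter> outside (curve (z 1))"
  have cc: "connected_component (- (curve (z 0) \<union> curve (z 1))) a b" if "a \<in> A" "b \<in> A" for a b
  proof (rule Janiszewski)
    show "compact (curve (z 0))" "closed (curve (z 1))"
      using z0.compact_curve z1.compact_curve compact_imp_closed by auto
    show "connected (curve (z 0) \<inter> curve (z 1))" using curves_disjoint by simp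
    show "connected_component (- curve (z 0)) a b"
      using that z0.jordan_sides(3,9) unfolding A_def connected_component_def by blast
    show "connected_component (- curve (z 1)) a b"
      using that z1.jordan_sides(6,9) unfolding A_def connected_component_def by blast
  qed
  have "\<Omega> \<noteq> {}" using frontier_\<Omega> z0.in_curve by auto
  then obtain a where a: "a \<in> \<Omega>" by blast
  then have "a \<in> A" using \<Omega>_subset A_def by blast
  show "inside (curve (z 0)) \<inter> outside (curve (z 1)) \<subseteq> \<Omega>"
  proof
    fix b assume "b \<in> inside (curve (z 0)) \<inter> outside (curve (z 1))"
    then have "b \<in> A" unfolding A_def .
    obtain T where T: "connected T" "T \<subseteq> - (curve (z 0) \<union> curve (z 1))" "a \<in> T" "b \<in> T"
      using cc[OF \<open>a \<in> A\<close> \<open>b \<in> A\<close>] unfolding connected_component_def by blast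
    have "T \<inter> frontier \<Omega> = {}" using T(2) frontier_\<Omega> by blast
    then have "T \<subseteq> \<Omega>" using connected_Int_frontier[OF T(1), of \<Omega>] T(3) a by blast
    then show "b \<in> \<Omega>" using T(4) by blast
  qed
qed

text \<open>Multiplying the tangent by \<open>\<i>\<close> turns it to the left, where \<Omega> lies
  for both orientations; thus one formula displaces both curves into \<Omega>.\<close>

definition inner :: "nat \<Rightarrow> real \<Rightarrow> real \<Rightarrow> complex" where
  "inner j \<delta> t = z j t + \<i> * of_real \<delta> * vderiv (z j) t"

definition outer :: "nat \<Rightarrow> real \<Rightarrow> real \<Rightarrow> complex" where
  "outer j \<delta> t = z j t - \<i> * of_real \<delta> * vderiv (z j) t"

lemma vderiv_bounded:
  obtains B where "B > 0" "\<And>j t. j \<in> {0, 1} \<Longrightarrow> norm (vderiv (z j) t) \<le> B"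
proof -
  obtain B0 where B0: "B0 > 0" "\<And>t. norm (vderiv (z 0) t) \<le> B0"
    using z0.periodic_bounded[OF z0.periodic1 z0.cont1] by metis
  obtain B1 where B1: "B1 > 0" "\<And>t. norm (vderiv (z 1) t) \<le> B1"
    using z1.periodic_bounded[OF z1.periodic1 z1.cont1] by metis
  show ?thesis
    by (rule that[of "max B0 B1"]) (use B0 B1 in \<open>auto simp: le_max_iff_disj\<close>)
qed

text \<open>Orientation decides on which side of its own curve a displaced point lies. With respect
  to the other curve, each curve has a neighbourhood of radius \<open>r0\<close> or
  \<open>r1\<close> on the right side, and a displacement moves a point by at most
  \<open>\<delta> * B\<close>.\<close>

lemma inner_outer:
  obtains c where "c > 0"
    "\<And>j t \<delta>. j \<in> {0, 1} \<Longrightarrow> 0 < \<delta> \<Longrightarrow> \<delta> < c \<Longrightarrow> inner j \<delta> t \<in> \<Omega>"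
    "\<And>j t \<delta>. j \<in> {0, 1} \<Longrightarrow> 0 < \<delta> \<Longrightarrow> \<delta> < c \<Longrightarrow> outer j \<delta> t \<notin> closure \<Omega>"
proof -
  obtain c0 where c0: "c0 > 0" "\<And>t \<delta>. 0 < \<delta> \<Longrightarrow> \<delta> < c0 \<Longrightarrow>
      inner 0 \<delta> t \<in> inside (curve (z 0)) \<and> outer 0 \<delta> t \<in> outside (curve (z 0))"
    using z0.sides_counterclockwise[OF ccw] unfolding inner_def outer_def by metis
  obtain c1 where c1: "c1 > 0" "\<And>t \<delta>. 0 < \<delta> \<Longrightarrow> \<delta> < c1 \<Longrightarrow>
      inner 1 \<delta> t \<in> outside (curve (z 1)) \<and> outer 1 \<delta> t \<in> inside (curve (z 1))"
    using z1.sides_clockwise[OF cw] unfolding inner_def outer_def by metis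
  obtain B where B: "B > 0" "\<And>j t. j \<in> {0, 1} \<Longrightarrow> norm (vderiv (z j) t) \<le> B" by (rule vderiv_bounded) blast
  have "curve (z 0) \<subseteq> outside (curve (z 1))" using closure_outside0 by blast
  then obtain r0 where r0: "r0 > 0" "(\<Union>x\<in>curve (z 0). ball x r0) \<subseteq> outside (curve (z 1))"
    using compact_subset_open_imp_ball_epsilon_subset[OF z0.compact_curve z1.jordan_sides(5)] by metis
  obtain r1 where r1: "r1 > 0" "(\<Union>x\<in>curve (z 1). ball x r1) \<subseteq> inside (curve (z 0))"
    using compact_subset_open_imp_ball_epsilon_subset[OF z1.compact_curve z0.jordan_sides(2) curve1_inside] by metis
  define c where "c = Min {c0, c1, r0 / B, r1 / B}"
  have "c > 0" using c0 c1 r0 r1 B by (simp add: c_def)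
  have c: "c \<le> c0" "c \<le> c1" "c \<le> r0 / B" "c \<le> r1 / B" unfolding c_def by (rule Min.coboundedI; simp)+
  have dist: "dist (z j t) (inner j \<delta> t) < r" if "j \<in> {0, 1}" "0 < \<delta>" "\<delta> < c" "c \<le> r / B" for j t \<delta> r
  proof -
    have "dist (z j t) (inner j \<delta> t) = \<delta> * norm (vderiv (z j) t)"
      using that by (simp add: dist_norm inner_def norm_mult)
    also have "\<dots> \<le> \<delta> * B" using B that by (intro mult_left_mono) auto
    also have "\<dots> < c * B" using that B by (intro mult_strict_right_mono) auto
    also have "\<dots> \<le> r" using that B by (simp add: field_simps)
    finally show ?thesis .
  qed
  have "inner j \<delta> t \<in> \<Omega>" if "j \<in> {0, 1}" "0 < \<delta>" "\<delta> < c" for j t \<delta>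
  proof (cases "j = 0")
    case True
    have "inner 0 \<delta> t \<in> inside (curve (z 0))" using c0 that c by auto
    moreover have "inner 0 \<delta> t \<in> outside (curve (z 1))"
      using r0 dist[of 0 \<delta> r0 t] that c z0.in_curve[of t] by fastforce
    ultimately show ?thesis using \<Omega>_eq True by simp
  next
    case False
    then have "j = 1" using that by simp
    have "inner 1 \<delta> t \<in> outside (curve (z 1))" using c1 that c by auto
    moreover have "inner 1 \<delta> t \<in> inside (curve (z 0))"
      using r1 dist[of 1 \<delta> r1 t] that c z1.in_curve[of t] by fastforce
    ultimately show ?thesis using \<Omega>_eq \<open>j = 1\<close> by simp
  qed
  moreover have "outer j \<delta> t \<notin> closure \<Omega>" if "j \<in> {0, 1}" "0 < \<delta>" "\<delta> < c" for j t \<delta>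
  proof (cases "j = 0")
    case True
    have "outer 0 \<delta> t \<in> outside (curve (z 0))" using c0 that c by auto
    then show ?thesis using True closure_\<Omega> \<Omega>_eq z0.jordan_sides(8,9) curve1_inside by blast
  next
    case False
    then have "j = 1" using that by simp
    have "outer 1 \<delta> t \<in> inside (curve (z 1))" using c1 that c by auto
    then show ?thesis using \<open>j = 1\<close> closure_\<Omega> \<Omega>_eq z1.jordan_sides(8,9) closure_outside0 by blast
  qed
  ultimately show ?thesis using that[OF \<open>c > 0\<close>] by blast
qed

lemma inner_has_deriv:
  assumes "j \<in> {0, 1}"
  shows "(inner j \<delta> has_vector_derivative vderiv (z j) t + \<i> * of_real \<delta> * vderiv (vderiv (z j)) t) (at t within S)"
proof -
  interpret jordan_param "z j" using assms by (rule jordan_param)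
  show ?thesis unfolding inner_def[abs_def]
    by (intro has_vector_derivative_add has_vector_derivative_mult_right has_deriv has_deriv2)
qed

lemma cont_z [continuous_intros]:
  assumes "j \<in> {0, 1}" "continuous_on A g"
  shows "continuous_on A (\<lambda>x. z j (g x))" "continuous_on A (\<lambda>x. vderiv (z j) (g x))"
    "continuous_on A (\<lambda>x. vderiv (vderiv (z j)) (g x))"
proof -
  interpret jordan_param "z j" using assms(1) by (rule jordan_param)
  show "continuous_on A (\<lambda>x. z j (g x))" "continuous_on A (\<lambda>x. vderiv (z j) (g x))"
    "continuous_on A (\<lambda>x. vderiv (vderiv (z j)) (g x))"
    using assms(2) by (intro continuous_intros; simp)+
qed

lemma valid_path_inner:
  assumes "j \<in> {0, 1}"
  shows "valid_path (unit_path (inner j \<delta>))"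
  by (rule valid_path_unit_path[OF inner_has_deriv[OF assms]]) (intro continuous_intros assms)

lemma inner_periodic: "j \<in> {0, 1} \<Longrightarrow> inner j \<delta> (2 * pi) = inner j \<delta> 0"
  using jordan_param.periodic[OF jordan_param, of j 0] jordan_param.periodic1[OF jordan_param, of j 0]
  by (simp add: inner_def)

lemma inner_loop:
  assumes "j \<in> {0, 1}"
  shows "pathfinish (unit_path (inner j \<delta>)) = pathstart (unit_path (inner j \<delta>))"
  using inner_periodic[OF assms] by (simp add: pathfinish_def pathstart_def unit_path_def)

lemma inner_0: "inner j 0 = z j"
  by (simp add: inner_def fun_eq_iff)

text \<open>The linear homotopy between the two loops passes exactly through the intermediate
  parallel curves, which avoid \<open>w\<close>.\<close>

lemma winding_inner:
  assumes j: "j \<in> {0, 1}"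
    and w: "\<And>t \<delta>'. 0 \<le> \<delta>' \<Longrightarrow> \<delta>' \<le> \<delta> \<Longrightarrow> inner j \<delta>' t \<noteq> w"
    and "\<delta> > 0"
  shows "winding_number (unit_path (inner j \<delta>)) w = winding_number (unit_path (z j)) w"
proof (rule winding_number_loops_linear_eq)
  show "path (unit_path (z j))" "path (unit_path (inner j \<delta>))"
    using valid_path_inner[OF j] inner_0[of j] valid_path_imp_path by metis+
  show "pathfinish (unit_path (z j)) = pathstart (unit_path (z j))"
    "pathfinish (unit_path (inner j \<delta>)) = pathstart (unit_path (inner j \<delta>))"
    using inner_loop[OF j] inner_0[of j] by metis+
  fix t :: real
  show "w \<notin> closed_segment (unit_path (z j) t) (unit_path (inner j \<delta>) t)"
  proof
    assume "w \<in> closed_segment (unit_path (z j) t) (unit_path (inner j \<delta>) t)"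
    then obtain u where u: "0 \<le> u" "u \<le> 1" "w = (1 - u) *\<^sub>R unit_path (z j) t + u *\<^sub>R unit_path (inner j \<delta>) t"
      unfolding in_segment by blast
    then have "w = inner j (u * \<delta>) (2 * pi * t)"
      by (simp add: unit_path_def inner_def scaleR_conv_of_real algebra_simps)
    moreover have "u * \<delta> \<le> \<delta>" using u \<open>\<delta> > 0\<close> by (simp add: mult_left_le_one_le)
    moreover have "0 \<le> u * \<delta>" using u \<open>\<delta> > 0\<close> by simp
    ultimately show False using w[of "u * \<delta>" "2 * pi * t"] by blast
  qed
qed

lemma winding_sum_outside:
  assumes "w \<notin> closure \<Omega>"
  shows "winding_number (unit_path (z 0)) w + winding_number (unit_path (z 1)) w = 0"
proof -
  have w: "w \<notin> inside (curve (z 0)) \<inter> outside (curve (z 1))" "w \<notin> curve (z 0)" "w \<notin> curve (z 1)"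
    using assms closure_\<Omega> \<Omega>_eq by auto
  then consider "w \<in> outside (curve (z 0))" | "w \<in> inside (curve (z 1))"
    using z0.jordan_sides(9) z1.jordan_sides(9) by blast
  then show ?thesis
  proof cases
    case 1
    then show ?thesis using z0.winding_outside z1.winding_outside closure_outside0 by auto
  next
    case 2
    then show ?thesis using ccw cw closure_inside1 unfolding counterclockwise_def clockwise_def by auto
  qed
qed

lemma winding_sum_inside:
  assumes "w \<in> \<Omega>"
  shows "winding_number (unit_path (z 0)) w + winding_number (unit_path (z 1)) w = 1"
  using assms ccw z1.winding_outside \<Omega>_eq unfolding counterclockwise_def by auto

text \<open>Off the closure of \<Omega> the winding numbers are inherited from the boundary by
  homotopy. A point on the boundary lies on the starting curve of that homotopy, so it is first
  moved outwards along the normal, without meeting the inner curves.\<close>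

lemma inner_cycle:
  obtains c where "c > 0"
    "\<And>j t \<delta>. j \<in> {0, 1} \<Longrightarrow> 0 < \<delta> \<Longrightarrow> \<delta> < c \<Longrightarrow> inner j \<delta> t \<in> \<Omega>"
    "\<And>j t \<delta>. j \<in> {0, 1} \<Longrightarrow> 0 < \<delta> \<Longrightarrow> \<delta> < c \<Longrightarrow> outer j \<delta> t \<notin> closure \<Omega>"
    "\<And>\<delta> w. 0 < \<delta> \<Longrightarrow> \<delta> < c \<Longrightarrow> w \<notin> \<Omega> \<Longrightarrow>
      winding_number (unit_path (inner 0 \<delta>)) w + winding_number (unit_path (inner 1 \<delta>)) w = 0"
proof -
  obtain c where c: "c > 0"
    "\<And>j t \<delta>. j \<in> {0, 1} \<Longrightarrow> 0 < \<delta> \<Longrightarrow> \<delta> < c \<Longrightarrow> inner j \<delta> t \<in> \<Omega>"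
    "\<And>j t \<delta>. j \<in> {0, 1} \<Longrightarrow> 0 < \<delta> \<Longrightarrow> \<delta> < c \<Longrightarrow> outer j \<delta> t \<notin> closure \<Omega>"
    by (rule inner_outer) blast
  have zc: "z j t \<in> closure \<Omega>" if "j \<in> {0, 1}" for j t
    using that closure_\<Omega> z0.in_curve z1.in_curve by auto
  have off: "winding_number (unit_path (inner 0 \<delta>)) w + winding_number (unit_path (inner 1 \<delta>)) w = 0"
    if \<delta>: "0 < \<delta>" "\<delta> < c" and w: "w \<notin> closure \<Omega>" for \<delta> w
  proof -
    have "inner j \<delta>' t \<noteq> w" if "j \<in> {0, 1}" "0 \<le> \<delta>'" "\<delta>' \<le> \<delta>" for j t \<delta>'
    proof (cases "\<delta>' = 0")
      case True then show ?thesis using zc[of j t] w that(1) inner_0[of j] by auto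
    next
      case False then show ?thesis using c(2)[of j \<delta>' t] that \<delta> w closure_subset by force
    qed
    then show ?thesis using winding_inner[of 0 \<delta> w] winding_inner[of 1 \<delta> w] \<delta>(1) winding_sum_outside[OF w] by simp
  qed
  have "winding_number (unit_path (inner 0 \<delta>)) w + winding_number (unit_path (inner 1 \<delta>)) w = 0"
    if \<delta>: "0 < \<delta>" "\<delta> < c" and w: "w \<notin> \<Omega>" for \<delta> w
  proof (cases "w \<in> closure \<Omega>")
    case False
    then show ?thesis using off \<delta> by blast
  next
    case True
    then obtain k t where k: "k \<in> {0, 1}" "w = z k t"
      using w closure_\<Omega> z0.curve_eq_range z1.curve_eq_range by auto
    \<comment> \<open>The outer normal segment at \<open>w\<close>, including \<open>w\<close>
      itself. It avoids \<Omega>, hence the inner curves, so their winding numbers are constant on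
      it.\<close>
    define T where "T = (\<lambda>\<delta>'. outer k \<delta>' t) ` {0..<c}"
    have "connected T" unfolding T_def outer_def
      by (intro connected_continuous_image continuous_intros) auto
    have T: "T \<inter> \<Omega> = {}"
    proof -
      have "outer k \<delta>' t \<notin> \<Omega>" if "0 \<le> \<delta>'" "\<delta>' < c" for \<delta>'
      proof (cases "\<delta>' = 0")
        case True then show ?thesis using w k by (simp add: outer_def)
      next
        case False then show ?thesis using c(3)[of k \<delta>' t] that k closure_subset by force
      qed
      then show ?thesis unfolding T_def by auto
    qed
    have wT: "w \<in> T" unfolding T_def using k c(1) by (auto simp: outer_def intro!: image_eqI[of _ _ 0])
    have oT: "outer k (c / 2) t \<in> T" unfolding T_def using c(1) by auto
    have "winding_number (unit_path (inner j \<delta>)) w = winding_number (unit_path (inner j \<delta>)) (outer k (c / 2) t)"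
      if j: "j \<in> {0, 1}" for j
    proof -
      have "path_image (unit_path (inner j \<delta>)) \<subseteq> \<Omega>"
        unfolding path_image_unit_path using c(2)[OF j \<delta>] by blast
      then have "winding_number (unit_path (inner j \<delta>)) constant_on T"
        using T by (intro winding_number_constant valid_path_imp_path valid_path_inner inner_loop j \<open>connected T\<close>) blast
      then show ?thesis using wT oT unfolding constant_on_def by metis
    qed
    then show ?thesis using off[OF \<delta> c(3)[OF k(1), of "c / 2" t]] c(1) by simp
  qed
  with that c show ?thesis by blast
qed

text \<open>How small \<delta> must be depends on \<open>w\<close>: boundary points have distance at
  least \<open>r\<close> from \<open>w\<close>, and a displacement below \<open>r\<close> cannot
  bring them there.\<close>

lemma winding_inner_inside:
  assumes "w \<in> \<Omega>"
  shows "\<forall>\<^sub>F \<delta> in at_right 0.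
    w \<notin> path_image (unit_path (inner 0 \<delta>)) \<and> w \<notin> path_image (unit_path (inner 1 \<delta>)) \<and>
    winding_number (unit_path (inner 0 \<delta>)) w + winding_number (unit_path (inner 1 \<delta>)) w = 1"
proof -
  obtain B where B: "B > 0" "\<And>j t. j \<in> {0, 1} \<Longrightarrow> norm (vderiv (z j) t) \<le> B" by (rule vderiv_bounded) blast
  obtain r where r: "r > 0" "ball w r \<subseteq> \<Omega>" using open_\<Omega> assms openE by blast
  have ne: "inner j \<delta> t \<noteq> w" if j: "j \<in> {0, 1}" and \<delta>: "0 \<le> \<delta>" "\<delta> < r / B" for j t \<delta>
  proof
    assume eq: "inner j \<delta> t = w"
    have "z j t \<notin> \<Omega>" using \<Omega>_disjoint z0.in_curve z1.in_curve j by auto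
    then have "\<not> dist w (z j t) < r" using r(2) by auto
    moreover have "dist w (z j t) = \<delta> * norm (vderiv (z j) t)"
      unfolding eq[symmetric] using \<delta> by (simp add: dist_norm inner_def norm_mult)
    moreover have "\<delta> * norm (vderiv (z j) t) \<le> \<delta> * B" using B j \<delta> by (intro mult_left_mono) auto
    moreover have "\<delta> * B < r" using \<delta> B by (simp add: field_simps)
    ultimately show False by linarith
  qed
  show ?thesis
  proof (rule eventually_at_rightI[of 0 "r / B"])
    fix \<delta> assume "\<delta> \<in> {0<..<r / B}"
    then have \<delta>: "0 < \<delta>" "\<delta> < r / B" by auto
    have "winding_number (unit_path (inner j \<delta>)) w = winding_number (unit_path (z j)) w" if "j \<in> {0, 1}" for j
      by (rule winding_inner[OF that _ \<delta>(1)]) (use ne[OF that] \<delta> in auto)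
    moreover have "w \<notin> path_image (unit_path (inner j \<delta>))" if "j \<in> {0, 1}" for j
      unfolding path_image_unit_path using ne[OF that, of \<delta>] \<delta> by (metis imageE less_imp_le)
    ultimately show "w \<notin> path_image (unit_path (inner 0 \<delta>)) \<and> w \<notin> path_image (unit_path (inner 1 \<delta>)) \<and>
      winding_number (unit_path (inner 0 \<delta>)) w + winding_number (unit_path (inner 1 \<delta>)) w = 1"
      using winding_sum_inside[OF assms] by simp
  qed (use r B in auto)
qed

end

subsection \<open>The boundary argument principle\<close>

text \<open>Off \<open>a\<close> the cofactor \<open>k\<close> coincides with
  \<open>zor_poly f a\<close>; both are continuous at \<open>a\<close>, and the latter does not
  vanish there.\<close>

lemma zorder_factor_nonzero:
  assumes S: "open S" "connected S" and f: "f holomorphic_on S" and a: "a \<in> S" and nz: "\<exists>w\<in>S. f w \<noteq> 0"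
    and k: "continuous_on S k" "\<And>w. w \<in> S \<Longrightarrow> f w = (w - a) ^ n * k w" and zo: "zorder f a = int n"
  shows "k a \<noteq> 0"
proof -
  obtain r where r: "r > 0" "cball a r \<subseteq> S" "zor_poly f a holomorphic_on cball a r"
    "\<And>w. w \<in> cball a r \<Longrightarrow> f w = zor_poly f a w * (w - a) ^ n \<and> zor_poly f a w \<noteq> 0"
    using zorder_exist_zero[OF f S a nz] zo by auto
  have "(k \<longlongrightarrow> k a) (at a)"
    using continuous_on_interior[OF k(1), of a] a S(1) by (simp add: interior_open isCont_def)
  moreover have "((zor_poly f a) \<longlongrightarrow> zor_poly f a a) (at a)"
    using continuous_on_interior[OF holomorphic_on_imp_continuous_on[OF r(3)], of a] r(1)
    by (simp add: isCont_def)
  moreover have "\<forall>\<^sub>F w in at a. zor_poly f a w = k w"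
  proof -
    have "zor_poly f a w = k w" if "w \<in> ball a r" "w \<noteq> a" for w
    proof -
      have "w \<in> cball a r" using that(1) by auto
      then have "zor_poly f a w * (w - a) ^ n = k w * (w - a) ^ n"
        using r(2,4) k(2)[of w] by (metis mult.commute subsetD)
      then show ?thesis using that(2) by simp
    qed
    moreover have "\<forall>\<^sub>F w in at a. w \<in> ball a r \<and> w \<noteq> a"
      using r(1) by (auto simp: eventually_at dist_commute intro!: exI[of _ r])
    ultimately show ?thesis by (auto elim: eventually_mono)
  qed
  ultimately have "k a = zor_poly f a a"
    using Lim_transform_eventually tendsto_unique trivial_limit_at by metis
  then show ?thesis using r by simp
qed

text \<open>The zeros are divided out one after the other as difference quotients, which treats
  \<open>a = b\<close> as well. That the cofactor has no zero at \<open>a\<close> or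
  \<open>b\<close> is what the multiplicities say, by \<open>zorder_factor_nonzero\<close>.\<close>

lemma zeros_factorization:
  assumes S: "open S" "connected S" and f: "f holomorphic_on S" and nz: "\<exists>w\<in>S. f w \<noteq> 0"
    and zeros: "zeros_with_multiplicity f S {#a, b#}"
  obtains h where "h holomorphic_on S" "\<And>w. w \<in> S \<Longrightarrow> h w \<noteq> 0"
    "\<And>w. w \<in> S \<Longrightarrow> f w = (w - a) * (w - b) * h w"
proof -
  have ab: "{w \<in> S. f w = 0} = {a, b}" and zo: "\<And>w. w \<in> S \<Longrightarrow> zorder f w = int (count {#a, b#} w)"
    using zeros unfolding zeros_with_multiplicity_def by auto
  then have abS: "a \<in> S" "b \<in> S" and f0: "f a = 0" "f b = 0" by auto
  define g where "g = (\<lambda>w. if w = a then deriv f a else (f w - f a) / (w - a))"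
  have g: "g holomorphic_on S" unfolding g_def by (rule pole_lemma_open[OF f S(1)])
  have fg: "f w = (w - a) * g w" for w using f0 by (simp add: g_def)
  have gb: "g b = 0"
  proof (cases "a = b")
    case False
    then show ?thesis using fg[of b] f0 by simp
  next
    case True
    \<comment> \<open>Here \<open>g b\<close> is the derivative of \<open>f\<close> at the double
      zero; if it were nonzero, the order would be 1 and not 2.\<close>
    show ?thesis
    proof (rule ccontr)
      assume "g b \<noteq> 0"
      then have "zorder f b = 1"
        by (intro zorder_eqI[OF S(1) abS(2) g]) (use fg True in auto)
      then show False using zo[OF abS(2)] True by simp
    qed
  qed
  define h where "h = (\<lambda>w. if w = b then deriv g b else (g w - g b) / (w - b))"
  have h: "h holomorphic_on S" unfolding h_def by (rule pole_lemma_open[OF g S(1)])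
  have "g w = (w - b) * h w" for w using gb by (simp add: h_def)
  then have fh: "f w = (w - a) * (w - b) * h w" for w using fg[of w] by simp
  have hc: "continuous_on S h" by (rule holomorphic_on_imp_continuous_on[OF h])
  have "h w \<noteq> 0" if w: "w \<in> S" for w
  proof (cases "w \<in> {a, b}")
    case False
    then have "f w \<noteq> 0" using ab w by blast
    then show ?thesis using fh[of w] by auto
  next
    case True
    show ?thesis
    proof (cases "a = b")
      case True
      then have "w = a" using \<open>w \<in> {a, b}\<close> by simp
      show ?thesis unfolding \<open>w = a\<close>
      proof (rule zorder_factor_nonzero[OF S f abS(1) nz hc])
        show "f w = (w - a) ^ 2 * h w" for w using fh[of w] True by (simp add: power2_eq_square)
        show "zorder f a = int 2" using zo[OF abS(1)] True by simp
      qed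
    next
      case False
      have "(a - b) * h a \<noteq> 0"
      proof (rule zorder_factor_nonzero[OF S f abS(1) nz])
        show "continuous_on S (\<lambda>w. (w - b) * h w)" by (intro continuous_intros hc)
        show "f w = (w - a) ^ 1 * ((w - b) * h w)" for w using fh[of w] by simp
        show "zorder f a = int 1" using zo[OF abS(1)] False by simp
      qed
      moreover have "(b - a) * h b \<noteq> 0"
      proof (rule zorder_factor_nonzero[OF S f abS(2) nz])
        show "continuous_on S (\<lambda>w. (w - a) * h w)" by (intro continuous_intros hc)
        show "f w = (w - b) ^ 1 * ((w - a) * h w)" for w using fh[of w] by simp
        show "zorder f b = int 1" using zo[OF abS(2)] False by simp
      qed
      ultimately show ?thesis using \<open>w \<in> {a, b}\<close> by auto
    qed
  qed
  then show ?thesis using that h fh by blast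
qed

text \<open>Inner in the sense of function theory: modulus below 1 in the region and equal to 1 on
  the boundary, the latter through \<open>boundary_correspondence\<close>.\<close>

locale inner_function = doubly_connected +
  fixes f :: "complex \<Rightarrow> complex" and \<theta> :: "nat \<Rightarrow> real \<Rightarrow> real" and a0 a1 :: complex
  assumes holo: "f holomorphic_on \<Omega>"
    and cont_f: "continuous_on (closure \<Omega>) f"
    and f_less_1: "\<And>w. w \<in> \<Omega> \<Longrightarrow> norm (f w) < 1"
    and nonzero: "\<exists>w\<in>\<Omega>. f w \<noteq> 0"
    and zeros: "zeros_with_multiplicity f \<Omega> {#a0, a1#}"
    and boundary: "boundary_correspondence f z \<theta>"
begin

abbreviation "\<theta>' \<equiv> deriv_J \<theta>"

lemma zeros_in_\<Omega>: "a0 \<in> \<Omega>" "a1 \<in> \<Omega>" "f a0 = 0" "f a1 = 0"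
  using zeros unfolding zeros_with_multiplicity_def by auto

lemma \<theta>_has_deriv:
  assumes "j \<in> {0, 1}" "s \<in> J_range"
  shows "(\<theta> j has_vector_derivative \<theta>' j s) (at s within J_range)"
  using boundary assms unfolding boundary_correspondence_def deriv_J_def differentiable_on_def
  by (metis vector_derivative_works)

lemma \<theta>_has_deriv_complex:
  assumes "j \<in> {0, 1}" "s \<in> J_range"
  shows "((\<lambda>s. complex_of_real (\<theta> j s)) has_vector_derivative complex_of_real (\<theta>' j s)) (at s within J_range)"
  using has_vector_derivative_of_real \<theta>_has_deriv[OF assms]
  unfolding has_real_derivative_iff_has_vector_derivative by blast

lemma f_boundary: "j \<in> {0, 1} \<Longrightarrow> t \<in> J_range \<Longrightarrow> f (z j t) = exp (\<i> * of_real (\<theta> j t))"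
  using boundary unfolding boundary_correspondence_def by blast

lemma cont_\<theta>: "j \<in> {0, 1} \<Longrightarrow> continuous_on J_range (\<theta> j)"
  using \<theta>_has_deriv by (meson continuous_on_eq_continuous_within has_vector_derivative_continuous)

text \<open>Near the boundary \<open>f\<close> has the logarithm \<open>\<i> \<theta> + Ln (f \<cdot> exp (- \<i> \<theta>))\<close>, and integration by parts
  moves the derivative of the logarithm to \<open>q\<close>, so only uniform convergence is needed in the limit.\<close>

lemma inner_integral_tendsto:
  assumes j: "j \<in> {0, 1}" and U: "open U" "curve (z 0) \<union> curve (z 1) \<subseteq> U" and q: "q holomorphic_on U"
  shows "((\<lambda>\<delta>. contour_integral (unit_path (inner j \<delta>)) (\<lambda>v. q v * (deriv f v / f v))) \<longlongrightarrow>
           integral J_range (\<lambda>s. q (z j s) * (\<i> * of_real (\<theta>' j s)))) (at_right 0)"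
proof -
  obtain c where c: "c > 0"
    "\<And>j t \<delta>. j \<in> {0, 1} \<Longrightarrow> 0 < \<delta> \<Longrightarrow> \<delta> < c \<Longrightarrow> inner j \<delta> t \<in> \<Omega>"
    by (rule inner_outer) blast
  obtain B where B: "B > 0" "\<And>j t. j \<in> {0, 1} \<Longrightarrow> norm (vderiv (z j) t) \<le> B" by (rule vderiv_bounded) blast
  have "compact (curve (z 0) \<union> curve (z 1))" using z0.compact_curve z1.compact_curve by (rule compact_Un)
  then obtain r where r: "r > 0" "(\<Union>x\<in>curve (z 0) \<union> curve (z 1). ball x r) \<subseteq> U"
    using compact_subset_open_imp_ball_epsilon_subset[OF _ U] by metis
  have in_cl: "inner j \<delta> t \<in> closure \<Omega>" if "0 \<le> \<delta>" "\<delta> < c" for \<delta> t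
  proof (cases "\<delta> = 0")
    case True
    then show ?thesis using j z0.in_curve[of t] z1.in_curve[of t] closure_\<Omega> inner_0[of j] by auto
  next
    case False
    then show ?thesis using c(2)[OF j, of \<delta> t] that closure_subset by force
  qed
  define F where "F = (\<lambda>\<delta> s. f (inner j \<delta> s) * exp (- \<i> * of_real (\<theta> j s)))"
  have cont_inner: "continuous_on A (\<lambda>x. inner j (fst x) (snd x))" for A
    unfolding inner_def by (intro continuous_intros j)
  have cont_\<theta>2: "continuous_on (A \<times> J_range) (\<lambda>x. \<theta> j (snd x))" for A :: "real set"
    by (rule continuous_on_compose2[OF cont_\<theta>[OF j] continuous_on_snd]) (auto intro: continuous_intros)
  have cF: "continuous_on ({0..c/2} \<times> J_range) (\<lambda>x. F (fst x) (snd x))"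
    unfolding F_def
    by (intro continuous_intros continuous_on_compose2[OF cont_f] cont_inner cont_\<theta>2) (use in_cl c(1) in auto)
  have F0: "F 0 s = 1" if "s \<in> J_range" for s
    using f_boundary[OF j that] by (simp add: F_def inner_0 exp_minus)
  have "uniformly_continuous_on ({0..c/2} \<times> J_range) (\<lambda>x. F (fst x) (snd x))"
    by (intro compact_uniformly_continuous cF compact_Times) auto
  \<comment> \<open>On the boundary \<open>F\<close> is 1. The disc of radius 1 about 1 lies in the
    right half-plane, where the principal logarithm is holomorphic.\<close>
  then obtain e where e: "e > 0" "\<And>x y. x \<in> {0..c/2} \<times> J_range \<Longrightarrow> y \<in> {0..c/2} \<times> J_range \<Longrightarrow> dist y x < e \<Longrightarrow>
     dist (F (fst y) (snd y)) (F (fst x) (snd x)) < 1"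
    unfolding uniformly_continuous_on_def by (metis zero_less_one)
  define d where "d = Min {c / 2, e / 2, r / (2 * B)}"
  have "d > 0" using c e r B by (simp add: d_def)
  have d: "d \<le> c / 2" "d \<le> e / 2" "d \<le> r / (2 * B)" unfolding d_def by (rule Min.coboundedI; simp)+
  have F1: "dist (F \<delta> s) 1 < 1" if "\<delta> \<in> {0..d}" "s \<in> J_range" for \<delta> s
  proof -
    have "dist (\<delta>, s) (0, s) < e" using that d e(1) by (simp add: dist_Pair_Pair)
    then show ?thesis using e(2)[of "(0, s)" "(\<delta>, s)"] that d F0[OF that(2)] by auto
  qed
  have Fpos: "Re (F \<delta> s) > 0" if "\<delta> \<in> {0..d}" "s \<in> J_range" for \<delta> s
    using F1[OF that] abs_Re_le_cmod[of "F \<delta> s - 1"] by (simp add: dist_norm)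
  have Fnn: "F \<delta> s \<notin> \<real>\<^sub>\<le>\<^sub>0" if "\<delta> \<in> {0..d}" "s \<in> J_range" for \<delta> s
    using Fpos[OF that] complex_nonpos_Reals_iff by auto
  have f_nz: "f (inner j \<delta> s) \<noteq> 0" if "\<delta> \<in> {0..d}" "s \<in> J_range" for \<delta> s
    using Fpos[OF that] by (auto simp: F_def)
  have in_U: "inner j \<delta> s \<in> U" if "\<delta> \<in> {0..d}" for \<delta> s
  proof -
    have "dist (z j s) (inner j \<delta> s) = \<delta> * norm (vderiv (z j) s)"
      using that by (simp add: dist_norm inner_def norm_mult)
    also have "\<dots> \<le> d * B" using B(2)[OF j] that \<open>d > 0\<close> by (intro mult_mono) auto
    also have "\<dots> \<le> r / 2" using d(3) B(1) by (simp add: field_simps)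
    finally have "inner j \<delta> s \<in> ball (z j s) r" using r(1) by simp
    moreover have "z j s \<in> curve (z 0) \<union> curve (z 1)" using j z0.in_curve z1.in_curve by auto
    ultimately show ?thesis using r(2) by blast
  qed
  have in_\<Omega>: "inner j \<delta> s \<in> \<Omega>" if "\<delta> \<in> {0<..d}" for \<delta> s
    using c(2)[OF j, of \<delta> s] that d c(1) by auto
  define \<Phi> where "\<Phi> = (\<lambda>\<delta> s. \<i> * of_real (\<theta> j s) + Ln (F \<delta> s))"
  have cont_\<Phi>: "continuous_on ({0..d} \<times> J_range) (\<lambda>x. \<Phi> (fst x) (snd x))"
    unfolding \<Phi>_def
    by (intro continuous_intros cont_\<theta>2 continuous_on_subset[OF cF]) (use Fnn d in auto)
  define G' where "G' = (\<lambda>\<delta> s. vderiv (z j) s + \<i> * of_real \<delta> * vderiv (vderiv (z j)) s)"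
  define K' where "K' = (\<lambda>\<delta> s. deriv q (inner j \<delta> s) * G' \<delta> s)"
  have cont_K': "continuous_on ({0..d} \<times> J_range) (\<lambda>x. K' (fst x) (snd x))"
    unfolding K'_def G'_def
    by (intro continuous_intros j cont_inner
          continuous_on_compose2[OF holomorphic_on_imp_continuous_on[OF holomorphic_deriv[OF q U(1)]]])
       (use in_U in auto)
  have cont_q: "continuous_on ({0..d} \<times> J_range) (\<lambda>x. q (inner j (fst x) (snd x)))"
    by (intro cont_inner continuous_on_compose2[OF holomorphic_on_imp_continuous_on[OF q]]) (use in_U in auto)
  have K_deriv: "((\<lambda>s. q (inner j \<delta> s)) has_vector_derivative K' \<delta> s) (at s within J_range)"
    if "\<delta> \<in> {0..d}" for \<delta> s
  proof -
    have "(q has_field_derivative deriv q (inner j \<delta> s)) (at (inner j \<delta> s) within inner j \<delta> ` J_range)"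
      using holomorphic_derivI[OF q U(1) in_U[OF that]] by (rule has_field_derivative_at_within)
    from field_vector_diff_chain_within[OF inner_has_deriv[OF j] this] show ?thesis
      by (simp add: o_def K'_def G'_def mult.commute)
  qed
  \<comment> \<open>The form after integration by parts, free of \<open>\<theta>'\<close>. It is
    continuous down to \<open>\<delta> = 0\<close> and equals the contour integral for positive
    \<delta> and the boundary integral for \<open>\<delta> = 0\<close>.\<close>
  define E where "E = (\<lambda>\<delta>. q (inner j \<delta> (2 * pi)) * \<Phi> \<delta> (2 * pi) - q (inner j \<delta> 0) * \<Phi> \<delta> 0 -
    integral J_range (\<lambda>s. K' \<delta> s * \<Phi> \<delta> s))"
  have sec: "continuous_on {0..d} (\<lambda>\<delta>. g \<delta> s)" if "continuous_on ({0..d} \<times> J_range) (\<lambda>x. g (fst x) (snd x))" "s \<in> J_range"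
    for g :: "real \<Rightarrow> real \<Rightarrow> complex" and s
    using continuous_on_compose2[OF that(1), of "{0..d}" "\<lambda>\<delta>. (\<delta>, s)"] that(2)
      continuous_on_Pair[OF continuous_on_id continuous_on_const, of "{0..d}" s] by (simp add: image_subset_iff)
  have sec2: "continuous_on J_range (g \<delta>)" if "continuous_on ({0..d} \<times> J_range) (\<lambda>x. g (fst x) (snd x))" "\<delta> \<in> {0..d}"
    for g :: "real \<Rightarrow> real \<Rightarrow> complex" and \<delta>
    using continuous_on_compose2[OF that(1), of J_range "\<lambda>s. (\<delta>, s)"] that(2)
      continuous_on_Pair[OF continuous_on_const continuous_on_id, of J_range \<delta>] by (simp add: image_subset_iff)
  have "continuous_on {0..d} (\<lambda>\<delta>. integral (cbox 0 (2*pi)) (\<lambda>s. K' \<delta> s * \<Phi> \<delta> s))"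
    by (rule integral_continuous_on_param)
      (use continuous_on_mult[OF cont_K' cont_\<Phi>] in \<open>simp add: split_beta\<close>)
  then have "continuous_on {0..d} E"
    unfolding E_def
    by (intro continuous_intros sec[OF cont_\<Phi>] sec[OF cont_q]) auto
  then have "(E \<longlongrightarrow> E 0) (at 0 within {0..d})" using \<open>d > 0\<close> by (simp add: continuous_on)
  then have lim: "(E \<longlongrightarrow> E 0) (at_right 0)" using \<open>d > 0\<close> by (simp add: at_within_Icc_at_right)
  have "\<Phi> 0 s = \<i> * of_real (\<theta> j s)" if "s \<in> J_range" for s using F0[OF that] by (simp add: \<Phi>_def)
  then have "(\<Phi> 0 has_vector_derivative \<i> * of_real (\<theta>' j s)) (at s within J_range)" if "s \<in> J_range" for s
    using has_vector_derivative_transform[OF that _ has_vector_derivative_mult_right[OF \<theta>_has_deriv_complex[OF j that], of \<i>]]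
    by simp
  then have I0: "((\<lambda>s. q (inner j 0 s) * (\<i> * of_real (\<theta>' j s))) has_integral E 0) J_range"
    unfolding E_def
    by (intro has_integral_by_parts_vector K_deriv sec2[OF cont_K']) (use \<open>d > 0\<close> in auto)
  have I: "contour_integral (unit_path (inner j \<delta>)) (\<lambda>v. q v * (deriv f v / f v)) = E \<delta>" if \<delta>: "\<delta> \<in> {0<..d}" for \<delta>
  proof -
    have \<delta>': "\<delta> \<in> {0..d}" using \<delta> by auto
    \<comment> \<open>The two occurrences of \<open>\<theta>'\<close> in the derivative cancel, and
      the logarithmic derivative of \<open>f\<close> along the parallel curve is left.\<close>
    have "(\<Phi> \<delta> has_vector_derivative deriv f (inner j \<delta> s) / f (inner j \<delta> s) * G' \<delta> s) (at s within J_range)" if s: "s \<in> J_range" for s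
    proof -
      have "(f has_field_derivative deriv f (inner j \<delta> s)) (at (inner j \<delta> s) within inner j \<delta> ` J_range)"
        using holomorphic_derivI[OF holo open_\<Omega> in_\<Omega>[OF \<delta>]] by (rule has_field_derivative_at_within)
      from field_vector_diff_chain_within[OF inner_has_deriv[OF j] this]
      have 1: "((\<lambda>s. f (inner j \<delta> s)) has_vector_derivative G' \<delta> s * deriv f (inner j \<delta> s)) (at s within J_range)"
        by (simp add: o_def G'_def)
      have 2: "((\<lambda>s. - \<i> * of_real (\<theta> j s)) has_vector_derivative - \<i> * of_real (\<theta>' j s)) (at s within J_range)"
        by (rule has_vector_derivative_mult_right[OF \<theta>_has_deriv_complex[OF j s]])
      have 3: "((\<lambda>s. exp (- \<i> * of_real (\<theta> j s))) has_vector_derivative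
          (- \<i> * of_real (\<theta>' j s)) * exp (- \<i> * of_real (\<theta> j s))) (at s within J_range)"
        using field_vector_diff_chain_within[OF 2 DERIV_exp[THEN has_field_derivative_at_within]] by (simp add: o_def)
      have 4: "(F \<delta> has_vector_derivative f (inner j \<delta> s) * ((- \<i> * of_real (\<theta>' j s)) * exp (- \<i> * of_real (\<theta> j s))) +
          (G' \<delta> s * deriv f (inner j \<delta> s)) * exp (- \<i> * of_real (\<theta> j s))) (at s within J_range)"
        unfolding F_def by (rule has_vector_derivative_mult[OF 1 3])
      have "(Ln has_field_derivative inverse (F \<delta> s)) (at (F \<delta> s) within F \<delta> ` J_range)"
        by (rule has_field_derivative_at_within[OF has_field_derivative_Ln[OF Fnn[OF \<delta>' s]]])
      from has_vector_derivative_add[OF has_vector_derivative_mult_right[OF \<theta>_has_deriv_complex[OF j s], of \<i>]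
          field_vector_diff_chain_within[OF 4 this]]
      have "(\<Phi> \<delta> has_vector_derivative \<i> * of_real (\<theta>' j s) +
        (f (inner j \<delta> s) * ((- \<i> * of_real (\<theta>' j s)) * exp (- \<i> * of_real (\<theta> j s))) +
          (G' \<delta> s * deriv f (inner j \<delta> s)) * exp (- \<i> * of_real (\<theta> j s))) * inverse (F \<delta> s)) (at s within J_range)"
        by (simp add: o_def \<Phi>_def)
      moreover have "\<i> * of_real (\<theta>' j s) +
        (f (inner j \<delta> s) * ((- \<i> * of_real (\<theta>' j s)) * exp (- \<i> * of_real (\<theta> j s))) +
          (G' \<delta> s * deriv f (inner j \<delta> s)) * exp (- \<i> * of_real (\<theta> j s))) * inverse (F \<delta> s) =
          deriv f (inner j \<delta> s) / f (inner j \<delta> s) * G' \<delta> s"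
        using f_nz[OF \<delta>' s] by (simp add: F_def field_simps)
      ultimately show ?thesis by simp
    qed
    then have "((\<lambda>s. q (inner j \<delta> s) * (deriv f (inner j \<delta> s) / f (inner j \<delta> s) * G' \<delta> s)) has_integral E \<delta>) J_range"
      unfolding E_def
      by (intro has_integral_by_parts_vector K_deriv sec2[OF cont_K']) (use \<delta>' in auto)
    then have "((\<lambda>v. q v * (deriv f v / f v)) has_contour_integral E \<delta>) (unit_path (inner j \<delta>))"
      unfolding has_contour_integral_unit_path[OF inner_has_deriv[OF j]] by (simp add: G'_def mult.assoc)
    then show ?thesis by (rule contour_integral_unique)
  qed
  have "\<forall>\<^sub>F \<delta> in at_right 0. E \<delta> = contour_integral (unit_path (inner j \<delta>)) (\<lambda>v. q v * (deriv f v / f v))"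
    using I \<open>d > 0\<close> by (intro eventually_at_rightI[of 0 d]) auto
  then have "((\<lambda>\<delta>. contour_integral (unit_path (inner j \<delta>)) (\<lambda>v. q v * (deriv f v / f v))) \<longlongrightarrow> E 0) (at_right 0)"
    by (rule Lim_transform_eventually[OF lim])
  then show "((\<lambda>\<delta>. contour_integral (unit_path (inner j \<delta>)) (\<lambda>v. q v * (deriv f v / f v))) \<longlongrightarrow>
           integral J_range (\<lambda>s. q (z j s) * (\<i> * of_real (\<theta>' j s)))) (at_right 0)"
    using integral_unique[OF I0] by (simp add: inner_0)
qed

end

section \<open>Holomorphy of Cauchy integrals off the curve\<close>

lemma divide_diff_swap: "x / (a - b) = - (x / (b - a :: complex))"
  by (metis minus_diff_eq minus_divide_right)

context jordan_param
begin

text \<open>Differentiation under the integral sign is legitimate once integration by parts has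
  replaced \<open>\<Theta>'\<close> by the continuous \<open>\<Theta>\<close>. It is carried out on
  discs, because the Leibniz rule is applied on convex sets.\<close>

lemma cauchy_integral_holomorphic:
  assumes \<Theta>: "\<And>s. s \<in> J_range \<Longrightarrow> (\<Theta> has_vector_derivative \<Theta>' s) (at s within J_range)"
  shows "(\<lambda>w. integral J_range (\<lambda>s. \<Theta>' s / (p s - w))) holomorphic_on - curve p"
proof -
  have c\<Theta>: "continuous_on J_range \<Theta>"
    using \<Theta> by (meson continuous_on_eq_continuous_within has_vector_derivative_continuous)
  have op: "open (- curve p)" using compact_imp_closed[OF compact_curve] by (simp add: open_Compl)
  have "(\<lambda>w. integral J_range (\<lambda>s. p' s / (p s - w)\<^sup>2 * \<Theta> s)) holomorphic_on U"
    if U: "U \<subseteq> - curve p" "convex U" for U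
  proof -
    have nz: "p s - w \<noteq> 0" if "w \<in> U" for s w using in_curve[of s] U that by auto
    have "(\<lambda>w. integral (cbox 0 (2*pi)) (\<lambda>s. p' s / (p s - w)\<^sup>2 * \<Theta> s)) holomorphic_on U"
    proof (rule leibniz_rule_holomorphic)
      fix w s assume w: "w \<in> U"
      show "((\<lambda>w. p' s / (p s - w)\<^sup>2 * \<Theta> s) has_field_derivative 2 * p' s * \<Theta> s / (p s - w) ^ 3) (at w within U)"
      proof -
        have "((\<lambda>w. p' s / (p s - w)\<^sup>2 * \<Theta> s) has_field_derivative
            2 * p' s * \<Theta> s * (p s - w) / ((p s - w)\<^sup>2)\<^sup>2) (at w within U)"
          using nz[OF w, of s] by (auto intro!: derivative_eq_intros simp: power2_eq_square mult_ac)
            (simp only: minus_divide_left mult_minus_right[symmetric] minus_diff_eq)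
        moreover have "A * x / (x\<^sup>2)\<^sup>2 = A / x ^ 3" if "x \<noteq> 0" for A x :: complex
          using that by (simp add: eval_nat_numeral)
        ultimately show ?thesis using nz[OF w, of s] by metis
      qed
    next
      fix w assume w: "w \<in> U"
      have "continuous_on J_range (\<lambda>s. p' s / (p s - w)\<^sup>2 * \<Theta> s)"
        using nz[OF w] c\<Theta> by (intro continuous_intros) auto
      then show "(\<lambda>s. p' s / (p s - w)\<^sup>2 * \<Theta> s) integrable_on cbox 0 (2*pi)"
        by (simp add: integrable_continuous_real)
    next
      have "continuous_on (U \<times> J_range) (\<lambda>x. 2 * p' (snd x) * \<Theta> (snd x) / (p (snd x) - fst x) ^ 3)"
        using nz by (intro continuous_intros continuous_on_compose2[OF c\<Theta> continuous_on_snd]) auto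
      then show "continuous_on (U \<times> cbox 0 (2*pi)) (\<lambda>(w, s). 2 * p' s * \<Theta> s / (p s - w) ^ 3)"
        by (simp add: split_beta)
    qed (rule U)
    then show ?thesis by simp
  qed
  note loc = this
  have "(\<lambda>w. integral J_range (\<lambda>s. p' s / (p s - w)\<^sup>2 * \<Theta> s)) holomorphic_on - curve p"
    unfolding holomorphic_on_def
  proof
    fix w assume "w \<in> - curve p"
    then obtain r where r: "r > 0" "ball w r \<subseteq> - curve p" using op openE by blast
    then show "(\<lambda>w. integral J_range (\<lambda>s. p' s / (p s - w)\<^sup>2 * \<Theta> s)) field_differentiable at w within - curve p"
      using holomorphic_on_imp_differentiable_at[OF loc[OF r(2) convex_ball], of w]
      by (auto intro: field_differentiable_at_within)
  qed
  moreover have "(\<lambda>w. (\<Theta> (2 * pi) - \<Theta> 0) / (p 0 - w)) holomorphic_on - curve p"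
    using in_curve[of 0] by (intro holomorphic_intros) auto
  ultimately have "(\<lambda>w. (\<Theta> (2 * pi) - \<Theta> 0) / (p 0 - w) + integral J_range (\<lambda>s. p' s / (p s - w)\<^sup>2 * \<Theta> s)) holomorphic_on - curve p"
    by (intro holomorphic_on_add)
  then show ?thesis
    by (rule holomorphic_transform) (use integral_unique[OF cauchy_by_parts[OF _ \<Theta>]] in auto)
qed

end

section \<open>Residues on the pair of inner parallel curves\<close>

context inner_function
begin

lemma log_deriv_split:
  obtains R where "R holomorphic_on \<Omega>"
    "\<And>v. v \<in> \<Omega> - {a0, a1} \<Longrightarrow> deriv f v / f v = R v + 1 / (v - a0) + 1 / (v - a1)"
proof -
  obtain h where h: "h holomorphic_on \<Omega>" "\<And>w. w \<in> \<Omega> \<Longrightarrow> h w \<noteq> 0"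
    "\<And>w. w \<in> \<Omega> \<Longrightarrow> f w = (w - a0) * (w - a1) * h w"
    using zeros_factorization[OF open_\<Omega> connected_\<Omega> holo nonzero zeros] by metis
  have "deriv f v / f v = deriv h v / h v + 1 / (v - a0) + 1 / (v - a1)" if v: "v \<in> \<Omega> - {a0, a1}" for v
  proof -
    have "((\<lambda>w. (w - a0) * (w - a1) * h w) has_field_derivative
        ((v - a1) + (v - a0)) * h v + (v - a0) * (v - a1) * deriv h v) (at v)"
      using v by (auto intro!: derivative_eq_intros holomorphic_derivI[OF h(1) open_\<Omega>] simp: algebra_simps)
    then have "(f has_field_derivative ((v - a1) + (v - a0)) * h v + (v - a0) * (v - a1) * deriv h v) (at v)"
      by (rule has_field_derivative_transform_within_open[OF _ open_\<Omega>]) (use v h in auto)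
    then have d: "deriv f v = ((v - a1) + (v - a0)) * h v + (v - a0) * (v - a1) * deriv h v" by (rule DERIV_imp_deriv)
    have "((y + x) * A + x * y * B) / (x * y * A) = B / A + 1 / x + 1 / y"
      if "x \<noteq> 0" "y \<noteq> 0" "A \<noteq> 0" for x y A B :: complex
      using that by (simp add: field_simps)
    from this[of "v - a0" "v - a1" "h v" "deriv h v"] show ?thesis
      using v h(2)[of v] unfolding d h(3)[OF DiffD1[OF v]] by simp
  qed
  moreover have "(\<lambda>v. deriv h v / h v) holomorphic_on \<Omega>"
    using h by (intro holomorphic_intros holomorphic_deriv open_\<Omega>) auto
  ultimately show ?thesis using that by blast
qed

definition cycle :: "real \<Rightarrow> (complex \<Rightarrow> complex) \<Rightarrow> complex" where
  "cycle \<delta> g = contour_integral (unit_path (inner 0 \<delta>)) g + contour_integral (unit_path (inner 1 \<delta>)) g"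

text \<open>The inner curves form a cycle that is null-homologous in \<Omega> and runs once around
  each point of \<open>W\<close>, the prospective poles.\<close>

definition good :: "complex set \<Rightarrow> real \<Rightarrow> bool" where
  "good W \<delta> \<longleftrightarrow> (\<forall>j\<in>{0, 1}. path_image (unit_path (inner j \<delta>)) \<subseteq> \<Omega> - W) \<and>
    (\<forall>w. w \<notin> \<Omega> \<longrightarrow> winding_number (unit_path (inner 0 \<delta>)) w + winding_number (unit_path (inner 1 \<delta>)) w = 0) \<and>
    (\<forall>w\<in>W. winding_number (unit_path (inner 0 \<delta>)) w + winding_number (unit_path (inner 1 \<delta>)) w = 1)"

lemma eventually_good:
  assumes "finite W" "W \<subseteq> \<Omega>"
  shows "\<forall>\<^sub>F \<delta> in at_right 0. good W \<delta>"
proof -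
  obtain c where c: "c > 0"
    "\<And>j t \<delta>. j \<in> {0, 1} \<Longrightarrow> 0 < \<delta> \<Longrightarrow> \<delta> < c \<Longrightarrow> inner j \<delta> t \<in> \<Omega>"
    "\<And>\<delta> w. 0 < \<delta> \<Longrightarrow> \<delta> < c \<Longrightarrow> w \<notin> \<Omega> \<Longrightarrow>
      winding_number (unit_path (inner 0 \<delta>)) w + winding_number (unit_path (inner 1 \<delta>)) w = 0"
    by (rule inner_cycle) blast
  have "\<forall>\<^sub>F \<delta> in at_right 0. 0 < \<delta> \<and> \<delta> < c"
    using c(1) by (intro eventually_at_rightI[of 0 c]) auto
  moreover have "\<forall>\<^sub>F \<delta> in at_right 0. \<forall>w\<in>W. w \<notin> path_image (unit_path (inner 0 \<delta>)) \<and> w \<notin> path_image (unit_path (inner 1 \<delta>)) \<and>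
    winding_number (unit_path (inner 0 \<delta>)) w + winding_number (unit_path (inner 1 \<delta>)) w = 1"
    using assms winding_inner_inside by (subst eventually_ball_finite_distrib) auto
  ultimately show ?thesis
  proof eventually_elim
    case (elim \<delta>)
    have "path_image (unit_path (inner j \<delta>)) \<subseteq> \<Omega>" if "j \<in> {0, 1}" for j
      unfolding path_image_unit_path using c(2)[OF that] elim(1) by blast
    then show ?case unfolding good_def using elim c(3) by blast
  qed
qed

lemma cycle_cong:
  assumes "good W \<delta>" "\<And>v. v \<in> \<Omega> - W \<Longrightarrow> g v = g' v"
  shows "cycle \<delta> g = cycle \<delta> g'"
proof -
  have "contour_integral (unit_path (inner j \<delta>)) g = contour_integral (unit_path (inner j \<delta>)) g'" if "j \<in> {0, 1}" for j
    by (rule contour_integral_cong) (use assms that in \<open>auto simp: good_def\<close>)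
  then show ?thesis by (simp add: cycle_def)
qed

lemma good_integrable:
  assumes "good W \<delta>" "finite W" "g holomorphic_on \<Omega> - W" "j \<in> {0, 1}"
  shows "g contour_integrable_on unit_path (inner j \<delta>)"
proof -
  have "open (\<Omega> - W)" using open_\<Omega> assms(2) by (simp add: finite_imp_closed open_Diff)
  then show ?thesis
    using contour_integrable_holomorphic_simple[OF assms(3) _ valid_path_inner[OF assms(4)]] assms(1,4)
    by (auto simp: good_def)
qed

lemma cycle_add:
  assumes "good W \<delta>" "finite W" "g holomorphic_on \<Omega> - W" "h holomorphic_on \<Omega> - W"
  shows "cycle \<delta> (\<lambda>v. g v + h v) = cycle \<delta> g + cycle \<delta> h"
  unfolding cycle_def using good_integrable[OF assms(1,2)] assms(3,4)
  by (simp add: contour_integral_add)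

lemma cycle_holomorphic:
  assumes "good W \<delta>" "g holomorphic_on \<Omega>"
  shows "cycle \<delta> g = 0"
  unfolding cycle_def
  by (rule Cauchy_theorem_two_loops[OF open_\<Omega> connected_\<Omega> assms(2)])
    (use assms(1) valid_path_inner inner_loop in \<open>auto simp: good_def\<close>)

lemma cycle_Cauchy:
  assumes "good W \<delta>" "g holomorphic_on \<Omega>" "w \<in> W" "W \<subseteq> \<Omega>"
  shows "cycle \<delta> (\<lambda>v. g v / (v - w)) = 2 * pi * \<i> * g w"
proof -
  have "cycle \<delta> (\<lambda>v. g v / (v - w)) =
      2 * pi * \<i> * (winding_number (unit_path (inner 0 \<delta>)) w + winding_number (unit_path (inner 1 \<delta>)) w) * g w"
    unfolding cycle_def
    by (rule Cauchy_integral_formula_two_loops[OF open_\<Omega> connected_\<Omega> assms(2)])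
      (use assms valid_path_inner inner_loop in \<open>auto simp: good_def\<close>)
  then show ?thesis using assms by (simp add: good_def)
qed

lemma cycle_log_deriv:
  assumes W: "good W \<delta>" "finite W" "W \<subseteq> \<Omega>" "a0 \<in> W" "a1 \<in> W" and q: "q holomorphic_on \<Omega> - W"
    and R: "R holomorphic_on \<Omega>"
    "\<And>v. v \<in> \<Omega> - {a0, a1} \<Longrightarrow> deriv f v / f v = R v + 1 / (v - a0) + 1 / (v - a1)"
  shows "cycle \<delta> (\<lambda>v. q v * (deriv f v / f v)) =
    cycle \<delta> (\<lambda>v. q v * R v) + cycle \<delta> (\<lambda>v. q v / (v - a0)) + cycle \<delta> (\<lambda>v. q v / (v - a1))"
proof -
  have h: "(\<lambda>v. q v * R v) holomorphic_on \<Omega> - W" "(\<lambda>v. q v / (v - a0)) holomorphic_on \<Omega> - W"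
    "(\<lambda>v. q v / (v - a1)) holomorphic_on \<Omega> - W"
    using W by (intro holomorphic_intros q holomorphic_on_subset[OF R(1)]; auto)+
  have "cycle \<delta> (\<lambda>v. q v * (deriv f v / f v)) = cycle \<delta> (\<lambda>v. (q v * R v + q v / (v - a0)) + q v / (v - a1))"
  proof (rule cycle_cong[OF W(1)])
    fix v assume "v \<in> \<Omega> - W"
    then have "v \<in> \<Omega> - {a0, a1}" using W by auto
    then show "q v * (deriv f v / f v) = (q v * R v + q v / (v - a0)) + q v / (v - a1)"
      by (simp only: R(2)) (simp add: algebra_simps)
  qed
  also have "\<dots> = cycle \<delta> (\<lambda>v. q v * R v) + cycle \<delta> (\<lambda>v. q v / (v - a0)) + cycle \<delta> (\<lambda>v. q v / (v - a1))"
    using h by (simp add: cycle_add[OF W(1,2)] holomorphic_on_add)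
  finally show ?thesis .
qed

text \<open>The cycle integral does not change for small \<delta>, so its limit, the boundary
  integral, equals that constant. Since \<open>q\<close> lives on a neighbourhood of the curves
  only, it may have poles in \<Omega>, as in \<open>cauchy_inside\<close>.\<close>

lemma boundary_integral_eq_cycle:
  fixes q :: "complex \<Rightarrow> complex" and A :: complex
  assumes U: "open U" "curve (z 0) \<union> curve (z 1) \<subseteq> U" "q holomorphic_on U"
    and ev: "\<forall>\<^sub>F \<delta> in at_right 0. cycle \<delta> (\<lambda>v. q v * (deriv f v / f v)) = 2 * pi * \<i> * A"
  shows "integral J_range (\<lambda>s. q (z 0 s) * of_real (\<theta>' 0 s)) + integral J_range (\<lambda>s. q (z 1 s) * of_real (\<theta>' 1 s)) = 2 * pi * A"
proof -
  let ?I = "\<lambda>j. integral J_range (\<lambda>s. q (z j s) * (\<i> * of_real (\<theta>' j s)))"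
  have "((\<lambda>\<delta>. cycle \<delta> (\<lambda>v. q v * (deriv f v / f v))) \<longlongrightarrow> ?I 0 + ?I 1) (at_right 0)"
    unfolding cycle_def by (intro tendsto_add inner_integral_tendsto[OF _ U]) auto
  then have "((\<lambda>\<delta>::real. 2 * pi * \<i> * A) \<longlongrightarrow> ?I 0 + ?I 1) (at_right 0)"
    using ev by (rule Lim_transform_eventually)
  then have "2 * pi * \<i> * A = ?I 0 + ?I 1"
    using tendsto_unique[OF trivial_limit_at_right_real tendsto_const] by blast
  moreover have "?I j = \<i> * integral J_range (\<lambda>s. q (z j s) * of_real (\<theta>' j s))" for j
  proof -
    have "(\<lambda>s. q (z j s) * (\<i> * of_real (\<theta>' j s))) = (\<lambda>s. \<i> * (q (z j s) * of_real (\<theta>' j s)))" by (simp add: mult_ac)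
    then show ?thesis by (simp only: integral_mult_right)
  qed
  ultimately have "\<i> * (integral J_range (\<lambda>s. q (z 0 s) * of_real (\<theta>' 0 s)) + integral J_range (\<lambda>s. q (z 1 s) * of_real (\<theta>' 1 s)))
    = \<i> * (2 * pi * A)"
    by (simp add: algebra_simps)
  then show ?thesis by (subst (asm) mult_left_cancel) simp_all
qed

lemma boundary_argument_principle:
  fixes q :: "complex \<Rightarrow> complex"
  assumes U: "open U" "closure \<Omega> \<subseteq> U" "q holomorphic_on U"
  shows "integral J_range (\<lambda>s. q (z 0 s) * of_real (\<theta>' 0 s)) + integral J_range (\<lambda>s. q (z 1 s) * of_real (\<theta>' 1 s)) =
    2 * pi * (q a0 + q a1)"
proof (rule boundary_integral_eq_cycle[OF U(1) _ U(3)])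
  show "curve (z 0) \<union> curve (z 1) \<subseteq> U" using U(2) closure_\<Omega> by blast
  obtain R where R: "R holomorphic_on \<Omega>"
    "\<And>v. v \<in> \<Omega> - {a0, a1} \<Longrightarrow> deriv f v / f v = R v + 1 / (v - a0) + 1 / (v - a1)"
    by (rule log_deriv_split) blast
  have W: "finite {a0, a1}" "{a0, a1} \<subseteq> \<Omega>" using zeros_in_\<Omega> by auto
  have q: "q holomorphic_on \<Omega>" using holomorphic_on_subset[OF U(3)] U(2) closure_subset by blast
  show "\<forall>\<^sub>F \<delta> in at_right 0. cycle \<delta> (\<lambda>v. q v * (deriv f v / f v)) = 2 * pi * \<i> * (q a0 + q a1)"
    using eventually_good[OF W]
  proof eventually_elim
    case (elim \<delta>)
    have "cycle \<delta> (\<lambda>v. q v * R v) = 0" by (intro cycle_holomorphic[OF elim] holomorphic_intros q R)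
    moreover have "cycle \<delta> (\<lambda>v. q v / (v - a)) = 2 * pi * \<i> * q a" if "a \<in> {a0, a1}" for a
      by (rule cycle_Cauchy[OF elim q that W(2)])
    ultimately show ?case
      using cycle_log_deriv[OF elim W _ _ holomorphic_on_subset[OF q] R] by (simp add: algebra_simps)
  qed
qed

section \<open>The Cauchy integral on both sides of the boundary and the sign of the density\<close>

definition curve_cauchy :: "nat \<Rightarrow> complex \<Rightarrow> complex" where
  "curve_cauchy k w = integral J_range (\<lambda>s. complex_of_real (\<theta>' k s) / (z k s - w))"

definition cauchy :: "complex \<Rightarrow> complex" where
  "cauchy w = curve_cauchy 0 w + curve_cauchy 1 w"

lemma cauchy_eq_other: "j \<in> {0, 1} \<Longrightarrow> cauchy w = curve_cauchy j w + curve_cauchy (1 - j) w"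
  by (auto simp: cauchy_def)

lemma curve_cauchy_holomorphic:
  assumes "k \<in> {0, 1}"
  shows "curve_cauchy k holomorphic_on - curve (z k)"
  unfolding curve_cauchy_def[abs_def]
  by (rule jordan_param.cauchy_integral_holomorphic[OF jordan_param[OF assms] \<theta>_has_deriv_complex[OF assms]])

lemma curve_cauchy_has_integral:
  assumes "k \<in> {0, 1}" "w \<notin> curve (z k)"
  shows "((\<lambda>s. complex_of_real (\<theta>' k s) / (z k s - w)) has_integral curve_cauchy k w) J_range"
  unfolding curve_cauchy_def
  by (rule integrable_integral[OF has_integral_integrable[OF
        jordan_param.cauchy_by_parts[OF jordan_param[OF assms(1)] assms(2) \<theta>_has_deriv_complex[OF assms(1)]]]])

lemma notin_other_curve:
  assumes "j \<in> {0, 1}"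
  shows "z j t \<notin> curve (z (1 - j))"
  using curves_disjoint z0.in_curve[of t] z1.in_curve[of t] assms by auto

lemma other_curve_isCont:
  assumes j: "j \<in> {0, 1}"
  shows "isCont (curve_cauchy (1 - j)) (z j t)"
proof -
  have k: "1 - j \<in> {0, 1}" using j by auto
  have "open (- curve (z (1 - j)))"
    using compact_imp_closed[OF jordan_param.compact_curve[OF jordan_param[OF k]]] by (simp add: open_Compl)
  then show ?thesis
    using holomorphic_on_imp_continuous_on[OF curve_cauchy_holomorphic[OF k]] notin_other_curve[OF j]
    by (simp add: continuous_on_eq_continuous_at)
qed

lemma curve_cauchy_jump:
  assumes j: "j \<in> {0, 1}" and t: "0 < t" "t < 2 * pi"
  shows "((\<lambda>\<delta>. vderiv (z j) t * (curve_cauchy j (inner j \<delta> t) - curve_cauchy j (outer j \<delta> t))) \<longlongrightarrow>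
    2 * pi * \<i> * of_real (\<theta>' j t)) (at_right 0)"
proof -
  interpret p: jordan_param "z j" using j by (rule jordan_param)
  have "((\<lambda>\<delta>. integral J_range (\<lambda>s. p.jump_kernel t \<delta> s * of_real (\<theta>' j s))) \<longlongrightarrow> 2 * pi * \<i> * of_real (\<theta>' j t)) (at_right 0)"
    by (rule p.jump[OF t \<theta>_has_deriv_complex[OF j]])
  moreover have "\<forall>\<^sub>F \<delta> in at_right 0. integral J_range (\<lambda>s. p.jump_kernel t \<delta> s * of_real (\<theta>' j s)) =
     vderiv (z j) t * (curve_cauchy j (inner j \<delta> t) - curve_cauchy j (outer j \<delta> t))"
    by (rule eventually_mono[OF p.jump_kernel_integral[where t = t, OF \<theta>_has_deriv_complex[OF j]]])
      (auto simp: curve_cauchy_def inner_def outer_def integral_unique)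
  ultimately show ?thesis by (rule Lim_transform_eventually)
qed

lemma inner_outer_tendsto:
  "((\<lambda>\<delta>. inner j \<delta> t) \<longlongrightarrow> z j t) (at_right 0)" "((\<lambda>\<delta>. outer j \<delta> t) \<longlongrightarrow> z j t) (at_right 0)"
  unfolding inner_def outer_def by (auto intro!: tendsto_eq_intros)

lemma cauchy_outside:
  assumes "w \<notin> closure \<Omega>"
  shows "cauchy w = 2 * pi * (1 / (a0 - w) + 1 / (a1 - w))"
proof -
  have "(\<lambda>v. 1 / (v - w)) holomorphic_on - {w}" by (intro holomorphic_intros) auto
  moreover have "open (- {w})" "closure \<Omega> \<subseteq> - {w}" using assms by auto
  ultimately show ?thesis
    using boundary_argument_principle[of "- {w}" "\<lambda>v. 1 / (v - w)"] by (simp add: cauchy_def curve_cauchy_def)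
qed

text \<open>The weight now has a pole at \<open>w\<close>, whose residue is added to those at the
  zeros. Only the regular part \<open>R\<close> of the logarithmic derivative survives.\<close>

lemma cauchy_inside:
  assumes w: "w \<in> \<Omega>" "w \<noteq> a0" "w \<noteq> a1"
  shows "cauchy w = 2 * pi * (deriv f w / f w - 1 / (w - a0) - 1 / (w - a1))"
proof -
  obtain R where R: "R holomorphic_on \<Omega>"
    "\<And>v. v \<in> \<Omega> - {a0, a1} \<Longrightarrow> deriv f v / f v = R v + 1 / (v - a0) + 1 / (v - a1)"
    by (rule log_deriv_split) blast
  define W where "W = {a0, a1, w}"
  have W: "finite W" "W \<subseteq> \<Omega>" "a0 \<in> W" "a1 \<in> W" "w \<in> W" using zeros_in_\<Omega> w by (auto simp: W_def)
  have q: "(\<lambda>v. 1 / (v - w)) holomorphic_on A" if "w \<notin> A" for A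
    using that by (intro holomorphic_intros) auto
  have "integral J_range (\<lambda>s. 1 / (z 0 s - w) * of_real (\<theta>' 0 s)) + integral J_range (\<lambda>s. 1 / (z 1 s - w) * of_real (\<theta>' 1 s)) =
    2 * pi * R w"
  proof (rule boundary_integral_eq_cycle)
    show "open (- {w})" by auto
    show "curve (z 0) \<union> curve (z 1) \<subseteq> - {w}" using \<Omega>_disjoint w by auto
    show "(\<lambda>v. 1 / (v - w)) holomorphic_on - {w}" by (rule q) simp
    show "\<forall>\<^sub>F \<delta> in at_right 0. cycle \<delta> (\<lambda>v. 1 / (v - w) * (deriv f v / f v)) = 2 * pi * \<i> * R w"
      using eventually_good[OF W(1,2)]
    proof eventually_elim
      case (elim \<delta>)
      have "cycle \<delta> (\<lambda>v. 1 / (v - w) * R v) = 2 * pi * \<i> * R w"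
        using cycle_Cauchy[OF elim R(1) W(5,2)] by simp
      \<comment> \<open>The residues at \<open>a\<close> and at \<open>w\<close> are opposite to
        each other, as partial fractions show.\<close>
      moreover have "cycle \<delta> (\<lambda>v. 1 / (v - w) / (v - a)) = 0" if a: "a \<in> {a0, a1}" for a
      proof -
        have aW: "a \<in> W" using a W by auto
        have "a \<noteq> w" using a w by auto
        have "cycle \<delta> (\<lambda>v. 1 / (v - w) / (v - a)) = cycle \<delta> (\<lambda>v. (1 / (a - w)) / (v - a) + (- 1 / (a - w)) / (v - w))"
        proof (rule cycle_cong[OF elim])
          fix v assume "v \<in> \<Omega> - W"
          then have "v \<noteq> a" "v \<noteq> w" using aW W(5) by auto
          then show "1 / (v - w) / (v - a) = (1 / (a - w)) / (v - a) + (- 1 / (a - w)) / (v - w)"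
            using \<open>a \<noteq> w\<close> by (simp add: divide_simps)
        qed
        also have "\<dots> = cycle \<delta> (\<lambda>v. (1 / (a - w)) / (v - a)) + cycle \<delta> (\<lambda>v. (- 1 / (a - w)) / (v - w))"
          by (rule cycle_add[OF elim W(1)]; intro holomorphic_intros) (use aW W(5) in auto)
        also have "cycle \<delta> (\<lambda>v. (1 / (a - w)) / (v - a)) = 2 * pi * \<i> * (1 / (a - w))"
          by (rule cycle_Cauchy[OF elim _ aW W(2)]) (intro holomorphic_intros)
        also have "cycle \<delta> (\<lambda>v. (- 1 / (a - w)) / (v - w)) = 2 * pi * \<i> * (- 1 / (a - w))"
          by (rule cycle_Cauchy[OF elim _ W(5,2)]) (intro holomorphic_intros)
        finally show ?thesis by simp
      qed
      ultimately show ?case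
        using cycle_log_deriv[OF elim W(1-4) q R] W(5) by simp
    qed
  qed
  moreover have "R w = deriv f w / f w - 1 / (w - a0) - 1 / (w - a1)" using R(2)[of w] w by simp
  ultimately show ?thesis by (simp add: cauchy_def curve_cauchy_def)
qed

lemma \<theta>'_integral: "j \<in> {0, 1} \<Longrightarrow> (\<theta>' j has_integral \<theta> j (2 * pi) - \<theta> j 0) J_range"
  by (intro fundamental_theorem_of_calculus \<theta>_has_deriv) auto

text \<open>The argument principle with weight 1 counts the two zeros.\<close>

lemma total_increment: "(\<theta> 0 (2 * pi) - \<theta> 0 0) + (\<theta> 1 (2 * pi) - \<theta> 1 0) = 4 * pi"
proof -
  have c: "integral J_range (\<lambda>s. complex_of_real (\<theta>' j s)) = of_real (\<theta> j (2 * pi) - \<theta> j 0)" if "j \<in> {0, 1}" for j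
    by (rule integral_unique[OF has_integral_of_real[OF \<theta>'_integral[OF that]]])
  have c01: "integral J_range (\<lambda>s. complex_of_real (\<theta>' 0 s)) = of_real (\<theta> 0 (2 * pi) - \<theta> 0 0)"
    "integral J_range (\<lambda>s. complex_of_real (\<theta>' 1 s)) = of_real (\<theta> 1 (2 * pi) - \<theta> 1 0)"
    by (rule c; simp)+
  have "integral J_range (\<lambda>s. 1 * complex_of_real (\<theta>' 0 s)) + integral J_range (\<lambda>s. 1 * complex_of_real (\<theta>' 1 s)) =
      complex_of_real (2 * pi) * (1 + 1)"
    by (rule boundary_argument_principle[of UNIV "\<lambda>_. 1"]) auto
  then have "complex_of_real ((\<theta> 0 (2 * pi) - \<theta> 0 0) + (\<theta> 1 (2 * pi) - \<theta> 1 0)) = of_real (4 * pi)"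
    unfolding mult_1 c01 by simp
  then show ?thesis by (simp only: of_real_eq_iff)
qed

lemma cauchy_jump:
  assumes j: "j \<in> {0, 1}" and t: "0 < t" "t < 2 * pi"
  shows "((\<lambda>\<delta>. vderiv (z j) t * (cauchy (inner j \<delta> t) - cauchy (outer j \<delta> t))) \<longlongrightarrow> 2 * pi * \<i> * of_real (\<theta>' j t)) (at_right 0)"
proof -
  have "((\<lambda>\<delta>. vderiv (z j) t * (curve_cauchy (1 - j) (inner j \<delta> t) - curve_cauchy (1 - j) (outer j \<delta> t))) \<longlongrightarrow>
      vderiv (z j) t * (curve_cauchy (1 - j) (z j t) - curve_cauchy (1 - j) (z j t))) (at_right 0)"
    by (intro tendsto_intros isCont_tendsto_compose[OF other_curve_isCont[OF j]] inner_outer_tendsto)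
  from tendsto_add[OF curve_cauchy_jump[OF j t] this] show ?thesis
    by (simp add: cauchy_eq_other[OF j] algebra_simps)
qed

text \<open>The formulas for \<open>cauchy\<close> inside and outside differ by the logarithmic
  derivative and by rational terms \<open>S\<close> that are continuous across the boundary. So the
  jump relation is a statement about the boundary limit of the logarithmic derivative along the
  normal.\<close>

lemma log_deriv_tendsto:
  assumes j: "j \<in> {0, 1}" and t: "0 < t" "t < 2 * pi"
  shows "((\<lambda>\<delta>. vderiv (z j) t * (deriv f (inner j \<delta> t) / f (inner j \<delta> t))) \<longlongrightarrow> \<i> * of_real (\<theta>' j t)) (at_right 0)"
proof -
  obtain c where c: "c > 0"
    "\<And>j t \<delta>. j \<in> {0, 1} \<Longrightarrow> 0 < \<delta> \<Longrightarrow> \<delta> < c \<Longrightarrow> outer j \<delta> t \<notin> closure \<Omega>"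
    by (rule inner_cycle) blast
  have zt: "z j t \<notin> \<Omega>" using \<Omega>_disjoint z0.in_curve z1.in_curve j by auto
  have ne: "z j t \<noteq> a0" "z j t \<noteq> a1" using zt zeros_in_\<Omega> by auto
  define S where "S = (\<lambda>w. 1 / (w - a0) + 1 / (w - a1))"
  have lim: "((\<lambda>\<delta>. (vderiv (z j) t * (cauchy (inner j \<delta> t) - cauchy (outer j \<delta> t))) / (2 * pi) +
      vderiv (z j) t * (S (inner j \<delta> t) - S (outer j \<delta> t))) \<longlongrightarrow>
      (2 * pi * \<i> * of_real (\<theta>' j t)) / (2 * pi) + vderiv (z j) t * (S (z j t) - S (z j t))) (at_right 0)"
    unfolding S_def using ne by (intro tendsto_intros cauchy_jump[OF j t] inner_outer_tendsto) auto
  have ev: "\<forall>\<^sub>F \<delta> in at_right 0. (vderiv (z j) t * (cauchy (inner j \<delta> t) - cauchy (outer j \<delta> t))) / (2 * pi) +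
      vderiv (z j) t * (S (inner j \<delta> t) - S (outer j \<delta> t)) = vderiv (z j) t * (deriv f (inner j \<delta> t) / f (inner j \<delta> t))"
  proof -
    have "\<forall>\<^sub>F \<delta> in at_right 0. 0 < \<delta> \<and> \<delta> < c" using c(1) by (intro eventually_at_rightI[of 0 c]) auto
    moreover have "\<forall>\<^sub>F \<delta> in at_right 0. good {a0, a1} \<delta>"
      by (rule eventually_good) (use zeros_in_\<Omega> in auto)
    ultimately show ?thesis
    proof eventually_elim
      case (elim \<delta>)
      have "inner j \<delta> t \<in> path_image (unit_path (inner j \<delta>))"
        unfolding path_image_unit_path using t by auto
      then have "inner j \<delta> t \<in> \<Omega> - {a0, a1}" using elim j by (auto simp: good_def)
      then have 1: "cauchy (inner j \<delta> t) = 2 * pi * (deriv f (inner j \<delta> t) / f (inner j \<delta> t) - S (inner j \<delta> t))"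
        using cauchy_inside[of "inner j \<delta> t"] by (simp add: S_def)
      have out: "outer j \<delta> t \<notin> closure \<Omega>" using c(2)[OF j] elim by blast
      have 2: "cauchy (outer j \<delta> t) = 2 * pi * (- S (outer j \<delta> t))"
        unfolding cauchy_outside[OF out] divide_diff_swap[of 1 a0] divide_diff_swap[of 1 a1] S_def by simp
      have "u * (2 * of_real pi * (X - a) - 2 * of_real pi * (- b)) / (2 * of_real pi) + u * (a - b) = u * X"
        for u X a b :: complex
        by (simp add: field_simps)
      then show ?case unfolding 1 2 by simp
    qed
  qed
  from Lim_transform_eventually[OF lim ev] show ?thesis by simp
qed

text \<open>Along the inner normal at \<open>z j t\<close> the derivative of \<open>\<bar>f\<bar>\<^sup>2\<close> tends to \<open>- 2 \<theta>' j t\<close>, while \<open>\<bar>f\<bar>\<close> drops below its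
  boundary value \<open>1\<close>.\<close>

lemma \<theta>'_nonneg:
  assumes j: "j \<in> {0, 1}" and t: "0 < t" "t < 2 * pi"
  shows "0 \<le> \<theta>' j t"
proof (rule ccontr)
  assume "\<not> 0 \<le> \<theta>' j t"
  then have neg: "\<theta>' j t < 0" by simp
  have tJ: "t \<in> J_range" using t by auto
  obtain c where c: "c > 0"
    "\<And>j t \<delta>. j \<in> {0, 1} \<Longrightarrow> 0 < \<delta> \<Longrightarrow> \<delta> < c \<Longrightarrow> inner j \<delta> t \<in> \<Omega>"
    by (rule inner_outer) blast
  define g where "g = (\<lambda>\<delta>. vderiv (z j) t * (deriv f (inner j \<delta> t) / f (inner j \<delta> t)))"
  define N where "N = (\<lambda>\<delta>. (Re (f (inner j \<delta> t)))\<^sup>2 + (Im (f (inner j \<delta> t)))\<^sup>2)"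
  have "((\<lambda>\<delta>. Im (g \<delta>)) \<longlongrightarrow> Im (\<i> * of_real (\<theta>' j t))) (at_right 0)"
    unfolding g_def by (rule tendsto_Im[OF log_deriv_tendsto[OF j t]])
  then have "\<forall>\<^sub>F \<delta> in at_right 0. Im (g \<delta>) < 0" using neg order_tendstoD(2) by fastforce
  then obtain d where d: "d > 0" "\<And>\<delta>. 0 < \<delta> \<Longrightarrow> \<delta> < d \<Longrightarrow> Im (g \<delta>) < 0"
    unfolding eventually_at_right_field by auto
  define e where "e = min (c / 2) (d / 2)"
  have e: "e > 0" "e < c" "e < d" using c d by (auto simp: e_def)
  have incl: "inner j \<delta> t \<in> closure \<Omega>" if "\<delta> \<in> {0..e}" for \<delta>
  proof (cases "\<delta> = 0")
    case True
    then show ?thesis using j z0.in_curve[of t] z1.in_curve[of t] closure_\<Omega> inner_0[of j] by auto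
  next
    case False
    then show ?thesis using c(2)[OF j, of \<delta> t] that e closure_subset by force
  qed
  have contf: "continuous_on {0..e} (\<lambda>\<delta>. f (inner j \<delta> t))"
    by (rule continuous_on_compose2[OF cont_f]) (use incl in \<open>auto simp: inner_def intro!: continuous_intros\<close>)
  have contN: "continuous_on {0..e} N" unfolding N_def by (intro continuous_intros contf)
  \<comment> \<open>Along the normal \<open>f\<close> has the derivative
    \<open>\<i> * g \<delta> * f\<close>, so the logarithmic derivative of \<open>N\<close> is twice
    the real part of \<open>\<i> * g \<delta>\<close>.\<close>
  have deriv_N: "(N has_real_derivative - 2 * N \<delta> * Im (g \<delta>)) (at \<delta>)" if "0 < \<delta>" "\<delta> < e" for \<delta>
  proof -
    have in\<Omega>: "inner j \<delta> t \<in> \<Omega>" using c(2)[OF j, of \<delta> t] that e by auto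
    \<comment> \<open>At a zero of \<open>f\<close> the quotient in \<open>g\<close> would be 0 by
      division by zero, contrary to \<open>Im (g \<delta>) < 0\<close>.\<close>
    have nz: "f (inner j \<delta> t) \<noteq> 0"
      using d(2)[of \<delta>] that e by (auto simp: g_def)
    have "((\<lambda>\<delta>. inner j \<delta> t) has_vector_derivative \<i> * vderiv (z j) t) (at \<delta>)"
      unfolding inner_def by (auto intro!: derivative_eq_intros)
    from field_vector_diff_chain_at[OF this holomorphic_derivI[OF holo open_\<Omega> in\<Omega>]]
    have D: "((\<lambda>\<delta>. f (inner j \<delta> t)) has_vector_derivative \<i> * vderiv (z j) t * deriv f (inner j \<delta> t)) (at \<delta>)"
      by (simp add: o_def)
    have eq: "\<i> * vderiv (z j) t * deriv f (inner j \<delta> t) = \<i> * g \<delta> * f (inner j \<delta> t)"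
      using nz by (simp add: g_def)
    note D = D[unfolded eq]
    have r: "((\<lambda>\<delta>. Re (f (inner j \<delta> t))) has_real_derivative Re (\<i> * g \<delta> * f (inner j \<delta> t))) (at \<delta>)"
      and i: "((\<lambda>\<delta>. Im (f (inner j \<delta> t))) has_real_derivative Im (\<i> * g \<delta> * f (inner j \<delta> t))) (at \<delta>)"
      using bounded_linear.has_vector_derivative[OF bounded_linear_Re D]
        bounded_linear.has_vector_derivative[OF bounded_linear_Im D]
      by (simp_all add: has_real_derivative_iff_has_vector_derivative)
    show ?thesis unfolding N_def
      by (rule DERIV_cong[OF DERIV_add[OF DERIV_power[OF r, of 2] DERIV_power[OF i, of 2]]])
        (simp add: power2_eq_square algebra_simps)
  qed
  obtain l \<xi> where \<xi>: "0 < \<xi>" "\<xi> < e" "DERIV N \<xi> :> l" "N e - N 0 = e * l"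
    using MVT[OF e(1) contN] deriv_N real_differentiable_def by (metis diff_zero)
  then have l: "l = - 2 * N \<xi> * Im (g \<xi>)" using DERIV_unique deriv_N by blast
  have "N \<xi> \<ge> 0" by (simp add: N_def)
  then have "N e - N 0 \<ge> 0" unfolding \<xi>(4) l using d(2)[of \<xi>] \<xi> e by (simp add: mult_nonneg_nonpos)
  moreover have "N \<delta> = (norm (f (inner j \<delta> t)))\<^sup>2" for \<delta> by (simp add: N_def cmod_power2)
  moreover have "norm (f (inner j 0 t)) = 1" using f_boundary[OF j tJ] by (simp add: inner_0)
  moreover have "norm (f (inner j e t)) < 1" using c(2)[OF j, of e t] e f_less_1 by auto
  moreover from this have "(norm (f (inner j e t)))\<^sup>2 < 1" by (simp add: power_less_one_iff)
  ultimately show False by simp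
qed

end

subsection \<open>The integral equation\<close>

lemma has_integral_remove_finite:
  fixes g :: "real \<Rightarrow> 'a::banach"
  assumes "finite F"
  shows "(g has_integral I) (A - F) \<longleftrightarrow> (g has_integral I) A"
  by (rule has_integral_spike_set_eq) (use assms in \<open>auto intro: negligible_subset[OF negligible_finite[OF assms]]\<close>)

lemma integral_remove_finite:
  fixes g :: "real \<Rightarrow> 'a::banach"
  assumes "finite F"
  shows "integral (A - F) g = integral A g" "g integrable_on (A - F) \<longleftrightarrow> g integrable_on A"
  unfolding integral_def integrable_on_def has_integral_remove_finite[OF assms] by simp_all

lemma Im_of_real_mult: "Im (of_real r * w) = r * Im w"
  by simp

context inner_function
begin

section \<open>Increments of the boundary correspondence over the two curves\<close>

lemma increment_integer:
  assumes j: "j \<in> {0, 1}"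
  obtains n :: int where "\<theta> j (2 * pi) - \<theta> j 0 = 2 * pi * of_int n"
proof -
  have "z j (2 * pi) = z j 0" using jordan_param.periodic[OF jordan_param[OF j], of 0] by simp
  then have "exp (\<i> * of_real (\<theta> j (2 * pi))) = exp (\<i> * of_real (\<theta> j 0))"
    using f_boundary[OF j, of 0] f_boundary[OF j, of "2 * pi"] by simp
  then obtain n :: int where "\<i> * of_real (\<theta> j (2 * pi)) = \<i> * of_real (\<theta> j 0) + (of_int (2 * n) * pi) * \<i>"
    unfolding exp_eq by blast
  then have "\<theta> j (2 * pi) = \<theta> j 0 + 2 * pi * of_int n" by (auto simp: complex_eq_iff)
  then show ?thesis using that[of n] by simp
qed

lemma \<theta>_has_real_derivative:
  assumes j: "j \<in> {0, 1}" and x: "0 < x" "x < 2 * pi"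
  shows "(\<theta> j has_real_derivative \<theta>' j x) (at x)"
proof -
  have "(\<theta> j has_vector_derivative \<theta>' j x) (at x within {0<..<2 * pi})"
    by (rule has_vector_derivative_within_subset[OF \<theta>_has_deriv[OF j]]) (use x in auto)
  moreover have "at x within {0<..<2 * pi} = at x" by (rule at_within_open) (use x in auto)
  ultimately show ?thesis by (simp only: has_real_derivative_iff_has_vector_derivative)
qed

lemma \<theta>_mono:
  assumes j: "j \<in> {0, 1}" and ab: "0 \<le> a" "a \<le> b" "b \<le> 2 * pi"
  shows "\<theta> j a \<le> \<theta> j b"
proof (rule DERIV_nonneg_imp_increasing_open[OF ab(2)])
  fix x assume x: "a < x" "x < b"
  have "(\<theta> j has_real_derivative \<theta>' j x) (at x)"
    by (rule \<theta>_has_real_derivative[OF j]) (use x ab in auto)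
  moreover have "\<theta>' j x \<ge> 0" using \<theta>'_nonneg[OF j, of x] x ab by auto
  ultimately show "\<exists>y. (\<theta> j has_real_derivative y) (at x) \<and> 0 \<le> y" by blast
qed (use continuous_on_subset[OF cont_\<theta>[OF j]] ab in auto)

text \<open>If \<open>\<theta> j\<close> were constant, the Cauchy integral would continue analytically across the \<open>j\<close>-th curve from the
  exterior, where it has poles at the zeros of \<open>f\<close>, to a neighbourhood of these zeros.\<close>

lemma increment_nonzero:
  assumes j: "j \<in> {0, 1}"
  shows "\<theta> j (2 * pi) - \<theta> j 0 \<noteq> 0"
proof
  assume eq: "\<theta> j (2 * pi) - \<theta> j 0 = 0"
  have const: "\<theta> j s = \<theta> j 0" if "s \<in> J_range" for s
    using \<theta>_mono[OF j, of 0 s] \<theta>_mono[OF j, of s "2 * pi"] that eq by auto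
  have zero: "\<theta>' j s = 0" if s: "s \<in> J_range" for s
  proof -
    have "(\<theta> j has_vector_derivative 0) (at s within cbox 0 (2 * pi))"
      using has_vector_derivative_transform[OF s const has_vector_derivative_const[of "\<theta> j 0"]] by simp
    then show ?thesis using vector_derivative_within_cbox[of 0 "2 * pi" s "\<theta> j" 0] s by (simp add: deriv_J_def)
  qed
  define k where "k = 1 - j"
  have k: "k \<in> {0, 1}" using j by (auto simp: k_def)
  define C where "C = curve_cauchy k"
  have "curve_cauchy j w = 0" for w
    unfolding curve_cauchy_def by (rule integral_unique[OF has_integral_is_0]) (use zero in auto)
  then have cauchy_C: "cauchy w = C w" for w by (simp add: cauchy_eq_other[OF j] C_def k_def)
  have Ch: "C holomorphic_on - curve (z k)"
    unfolding C_def by (rule curve_cauchy_holomorphic[OF k])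
  \<comment> \<open>\<open>D\<close> is the side of the remaining curve that contains \<Omega>;
    \<open>N\<close> is the piece beyond the \<open>j\<close>-th curve, where
    \<open>cauchy_outside\<close> applies. Without the \<open>j\<close>-th density nothing separates
    \<open>N\<close> from \<Omega>.\<close>
  obtain D N where D: "open D" "connected D" "D \<subseteq> - curve (z k)" "\<Omega> \<subseteq> D"
    and N: "open N" "N \<noteq> {}" "N \<subseteq> D" "N \<inter> closure \<Omega> = {}"
  proof (cases "j = 0")
    case True
    then have "k = 1" by (simp add: k_def)
    show ?thesis
    proof (rule that)
      show "open (outside (curve (z 1)))" "connected (outside (curve (z 1)))"
        "open (outside (curve (z 0)))" "outside (curve (z 0)) \<noteq> {}" by (fact z0.jordan_sides z1.jordan_sides)+
      show "outside (curve (z 1)) \<subseteq> - curve (z k)" using \<open>k = 1\<close> z1.jordan_sides(9) by blast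
      show "\<Omega> \<subseteq> outside (curve (z 1))" using \<Omega>_eq by blast
      show "outside (curve (z 0)) \<subseteq> outside (curve (z 1))" using closure_outside0 by blast
      show "outside (curve (z 0)) \<inter> closure \<Omega> = {}"
        unfolding closure_\<Omega> using \<Omega>_subset z0.jordan_sides(8) outside_no_overlap[of "curve (z 0)"] curve1_inside by blast
    qed
  next
    case False
    then have "k = 0" using j by (simp add: k_def)
    show ?thesis
    proof (rule that)
      show "open (inside (curve (z 0)))" "connected (inside (curve (z 0)))"
        "open (inside (curve (z 1)))" "inside (curve (z 1)) \<noteq> {}" by (fact z0.jordan_sides z1.jordan_sides)+
      show "inside (curve (z 0)) \<subseteq> - curve (z k)" using \<open>k = 0\<close> z0.jordan_sides(9) by blast
      show "\<Omega> \<subseteq> inside (curve (z 0))" using \<Omega>_eq by blast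
      show "inside (curve (z 1)) \<subseteq> inside (curve (z 0))" using closure_inside1 by blast
      show "inside (curve (z 1)) \<inter> closure \<Omega> = {}"
        unfolding closure_\<Omega> using \<Omega>_subset z1.jordan_sides(8) inside_no_overlap[of "curve (z 0)"]
          inside_no_overlap[of "curve (z 1)"] closure_inside1 by blast
    qed
  qed
  have CD: "C holomorphic_on D" by (rule holomorphic_on_subset[OF Ch D(3)])
  \<comment> \<open>The identity of \<open>cauchy_outside\<close> with denominators cleared: it
    makes sense at the zeros of \<open>f\<close> too.\<close>
  define F where "F = (\<lambda>w. C w * ((w - a0) * (w - a1)) + 2 * of_real pi * ((w - a0) + (w - a1)))"
  have FD: "F holomorphic_on D" unfolding F_def by (intro holomorphic_intros CD)
  have FN: "F w = 0" if "w \<in> N" for w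
  proof -
    have w: "w \<notin> closure \<Omega>" using N that by blast
    then have "a0 - w \<noteq> 0" "a1 - w \<noteq> 0" using zeros_in_\<Omega> closure_subset by auto
    moreover have "C w = 2 * pi * (1 / (a0 - w) + 1 / (a1 - w))" using cauchy_outside[OF w] cauchy_C by simp
    moreover have "2 * of_real pi * (1 / x + 1 / y) * ((- x) * (- y)) + 2 * of_real pi * ((- x) + (- y)) = 0"
      if "x \<noteq> 0" "y \<noteq> 0" for x y :: complex
      using that by (simp add: field_simps)
    ultimately show ?thesis unfolding F_def by (metis minus_diff_eq of_real_mult of_real_numeral)
  qed
  obtain \<xi> where "\<xi> \<in> N" using N by blast
  then have "\<xi> islimpt N" using N(1) interior_limit_point interior_open by blast
  then have F0: "F w = 0" if "w \<in> D" for w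
    using analytic_continuation[OF FD D(1,2) N(3) _ _ FN that, of \<xi>] \<open>\<xi> \<in> N\<close> N(3) by blast
  have aD: "a0 \<in> D" "a1 \<in> D" using zeros_in_\<Omega> D(4) by auto
  \<comment> \<open>\<open>F a0 = 0\<close> reads \<open>2 * pi * (a0 - a1) = 0\<close>, so only a
    double zero is left. Then one factor cancels and \<open>C w * (w - a0)\<close> is the constant
    \<open>- 4 * pi\<close>, although it tends to 0 at \<open>a0\<close>.\<close>
  have "a0 = a1" using F0[OF aD(1)] by (simp add: F_def)
  have "C w * (w - a0) = - 4 * of_real pi" if "w \<in> D" "w \<noteq> a0" for w
  proof -
    have "(C w * (w - a0) + 4 * of_real pi) * (w - a0) = 0"
      using F0[OF that(1)] \<open>a0 = a1\<close> by (simp add: F_def algebra_simps)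
    then show ?thesis using that(2) by (simp add: add_eq_0_iff2)
  qed
  then have "\<forall>\<^sub>F w in at a0. C w * (w - a0) = - 4 * of_real pi"
    using eventually_at_in_open[OF D(1) aD(1)] by (auto elim: eventually_mono)
  moreover have "((\<lambda>w. C w * (w - a0)) \<longlongrightarrow> C a0 * (a0 - a0)) (at a0)"
    using holomorphic_on_imp_continuous_on[OF CD] D(1) aD(1)
    by (intro tendsto_intros) (simp add: continuous_on_eq_continuous_at isCont_def)
  ultimately have "((\<lambda>w. - 4 * of_real pi) \<longlongrightarrow> C a0 * (a0 - a0)) (at a0)"
    by (rule Lim_transform_eventually[rotated])
  then have "- 4 * complex_of_real pi = C a0 * (a0 - a0)"
    using tendsto_unique[OF trivial_limit_at tendsto_const] by blast
  then show False by simp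
qed

lemma increment1: "\<theta> 1 (2 * pi) - \<theta> 1 0 = 2 * pi"
proof -
  have "\<exists>n::int. n \<ge> 1 \<and> \<theta> j (2 * pi) - \<theta> j 0 = 2 * pi * of_int n" if j: "j \<in> {0, 1}" for j
  proof -
    obtain n :: int where n: "\<theta> j (2 * pi) - \<theta> j 0 = 2 * pi * of_int n" by (rule increment_integer[OF j])
    moreover have "\<theta> j (2 * pi) - \<theta> j 0 > 0"
      using \<theta>_mono[OF j, of 0 "2 * pi"] increment_nonzero[OF j] by auto
    ultimately have "n \<ge> 1" by (simp add: zero_less_mult_iff)
    with n show ?thesis by blast
  qed
  then obtain n m :: int where nm: "n \<ge> 1" "m \<ge> 1" "\<theta> 0 (2 * pi) - \<theta> 0 0 = 2 * pi * of_int n"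
    "\<theta> 1 (2 * pi) - \<theta> 1 0 = 2 * pi * of_int m" by blast
  then have "2 * pi * of_int n + 2 * pi * of_int m = 4 * pi" using total_increment by simp
  then have "(2 * pi) * (of_int n + of_int m) = (2 * pi) * 2" by (simp add: algebra_simps)
  then have "of_int n + of_int m = (2::real)" by (subst (asm) mult_left_cancel) auto
  then have "m = 1" using nm by linarith
  then show ?thesis using nm by simp
qed

lemma J_op_eq_psi: "J_op \<theta>' j t = psi j t"
  using integral_unique[OF \<theta>'_integral[of 1]] increment1 by (simp add: J_op_def psi_def)

text \<open>Off the diagonal this is \<open>- pi\<close> times the \<open>Nstar_kernel\<close> of a
  single curve, with the sign of the Cauchy kernel. On the diagonal it is 0 by division by zero,
  which the integral does not see.\<close>

definition kernel :: "nat \<Rightarrow> real \<Rightarrow> real \<Rightarrow> real" where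
  "kernel j t s = Im (vderiv (z j) t / (z j s - z j t))"

text \<open>For \<open>\<delta> = 0\<close> both fractions in
  \<open>symmetric_kernel_bounded\<close> coincide, so twice the kernel is bounded.\<close>

lemma kernel_bounded:
  assumes "j \<in> {0, 1}"
  obtains B where "B \<ge> 0" "\<And>t s. \<bar>kernel j t s\<bar> \<le> B"
proof -
  interpret p: jordan_param "z j" using assms by (rule jordan_param)
  obtain B c where B: "c > 0"
    "\<And>t s \<delta>. 0 \<le> \<delta> \<Longrightarrow> \<delta> < c \<Longrightarrow> p.zeta t s \<noteq> 0 \<Longrightarrow>
      \<bar>Im (1 / (p.zeta t s - \<i> * of_real \<delta>) + 1 / (p.zeta t s + \<i> * of_real \<delta>))\<bar> \<le> B"
    by (rule p.symmetric_kernel_bounded) (rule that)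
  have "\<bar>kernel j t s\<bar> \<le> max B 0" for t s
  proof (cases "p.zeta t s = 0")
    case True
    then have "z j s - z j t = 0" by (simp add: p.zeta_def)
    then show ?thesis by (simp add: kernel_def)
  next
    case False
    have "kernel j t s = Im (1 / p.zeta t s)" by (simp add: kernel_def p.zeta_def)
    moreover have "\<bar>Im (1 / p.zeta t s) + Im (1 / p.zeta t s)\<bar> \<le> B"
      using B(2)[OF order_refl B(1) False]
      by (simp only: of_real_0 mult_zero_right diff_0_right add_0_right plus_complex.simps)
    ultimately show ?thesis by linarith
  qed
  then show ?thesis using that[of "max B 0"] by simp
qed

text \<open>The outer value is half of the sum minus the difference of both displaced values. The
  difference is the jump. In the sum the imaginary part of the kernel is bounded, so nonnegativity
  makes \<open>B * \<theta>' j s\<close> an integrable majorant. Dominated convergence yields a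
  limit along sequences, hence the sequence \<open>d\<close>.\<close>

lemma own_curve_limit:
  assumes j: "j \<in> {0, 1}" and t: "0 < t" "t < 2 * pi"
  shows "(\<lambda>s. kernel j t s * \<theta>' j s) integrable_on J_range"
    and "\<exists>d. filterlim d (at_right 0) sequentially \<and>
      (\<lambda>n. Im (vderiv (z j) t * curve_cauchy j (outer j (d n) t))) \<longlonglongrightarrow>
      integral J_range (\<lambda>s. kernel j t s * \<theta>' j s) - pi * \<theta>' j t"
proof -
  interpret p: jordan_param "z j" using j by (rule jordan_param)
  obtain c1 where c1: "c1 > 0"
    "\<And>t s \<delta>. 0 < \<delta> \<Longrightarrow> \<delta> < c1 \<Longrightarrow> p.zeta t s + \<i> * of_real \<delta> \<noteq> 0"
    "\<And>t s \<delta>. 0 < \<delta> \<Longrightarrow> \<delta> < c1 \<Longrightarrow> p.zeta t s - \<i> * of_real \<delta> \<noteq> 0"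
    "\<And>t \<delta>. 0 < \<delta> \<Longrightarrow> \<delta> < c1 \<Longrightarrow> inner j \<delta> t \<notin> curve (z j)"
    "\<And>t \<delta>. 0 < \<delta> \<Longrightarrow> \<delta> < c1 \<Longrightarrow> outer j \<delta> t \<notin> curve (z j)"
    by (rule p.displaced_nonzero, fold inner_def outer_def) (rule that)
  obtain B c2 where c2: "c2 > 0"
    "\<And>t s \<delta>. 0 \<le> \<delta> \<Longrightarrow> \<delta> < c2 \<Longrightarrow> p.zeta t s \<noteq> 0 \<Longrightarrow>
      \<bar>Im (1 / (p.zeta t s - \<i> * of_real \<delta>) + 1 / (p.zeta t s + \<i> * of_real \<delta>))\<bar> \<le> B"
    by (rule p.symmetric_kernel_bounded) (rule that)
  \<comment> \<open>The summand 2 makes \<open>d n\<close> strictly smaller than both thresholds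
    already for \<open>n = 0\<close>.\<close>
  define d where "d = (\<lambda>n. min c1 c2 / (real n + 2))"
  have d: "0 < d n" "d n < c1" "d n < c2" for n
  proof -
    have pos: "min c1 c2 > 0" using c1(1) c2(1) by simp
    then have "min c1 c2 / (real n + 2) < min c1 c2 / 1" by (intro divide_strict_left_mono) auto
    then have "0 < d n" "d n < min c1 c2" using pos by (auto simp: d_def)
    then show "0 < d n" "d n < c1" "d n < c2" by auto
  qed
  have "d \<longlonglongrightarrow> 0" unfolding d_def by real_asymp
  then have lim_d: "filterlim d (at_right 0) sequentially"
    using d by (intro filterlim_at_withinI) auto
  \<comment> \<open>At \<open>t\<close> the kernel is singular, and at the two end points the sign
    of \<open>\<theta>'\<close> is not yet known; removing three points does not change the
    integrals.\<close>
  define S where "S = J_range - {0, t, 2 * pi}"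
  have fin: "finite {0, t, 2 * pi}" by simp
  note rem = integral_remove_finite[OF fin, where A = J_range, folded S_def]
  define C where "C = curve_cauchy j"
  have C: "((\<lambda>s. complex_of_real (\<theta>' j s) / (z j s - w)) has_integral C w) J_range" if "w \<notin> curve (z j)" for w
    unfolding C_def by (rule curve_cauchy_has_integral[OF j that])
  define sym where "sym = (\<lambda>n s. Im (1 / (p.zeta t s - \<i> * of_real (d n)) + 1 / (p.zeta t s + \<i> * of_real (d n))))"
  have sym_int: "((\<lambda>s. sym n s * \<theta>' j s) has_integral
      Im (vderiv (z j) t * (C (inner j (d n) t) + C (outer j (d n) t)))) J_range" for n
  proof -
    let ?G = "\<lambda>s. vderiv (z j) t * (complex_of_real (\<theta>' j s) / (z j s - inner j (d n) t) +
      complex_of_real (\<theta>' j s) / (z j s - outer j (d n) t))"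
    have "(?G has_integral vderiv (z j) t * (C (inner j (d n) t) + C (outer j (d n) t))) J_range"
      by (intro has_integral_mult_right has_integral_add C c1 d)
    from has_integral_linear[OF this bounded_linear_Im]
    have "((\<lambda>s. Im (?G s)) has_integral Im (vderiv (z j) t * (C (inner j (d n) t) + C (outer j (d n) t)))) J_range"
      by (simp add: o_def)
    moreover have "Im (?G s) = sym n s * \<theta>' j s" for s
    proof -
      have "?G s = (1 / (p.zeta t s - \<i> * of_real (d n)) + 1 / (p.zeta t s + \<i> * of_real (d n))) * of_real (\<theta>' j s)"
      proof -
        have "v * (T / (v * A) + T / (v * B)) = (1 / A + 1 / B) * T" if "v \<noteq> 0" for v T A B :: complex
          using that by (simp add: distrib_left distrib_right)
        from this[OF p.deriv_nz] show ?thesis unfolding inner_def outer_def p.diff_displaced .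
      qed
      then show ?thesis by (simp add: sym_def)
    qed
    ultimately show ?thesis by simp
  qed
  have nz: "p.zeta t s \<noteq> 0" if "s \<in> S" for s using p.zeta_nonzero[OF t, of s] that by (auto simp: S_def)
  have "(\<lambda>s. B * \<theta>' j s) integrable_on J_range"
    using has_integral_mult_right[OF \<theta>'_integral[OF j]] by blast
  then have dom: "(\<lambda>s. B * \<theta>' j s) integrable_on S" by (simp only: rem)
  have f: "(\<lambda>s. sym n s * \<theta>' j s) integrable_on S" for n
    unfolding rem by (rule has_integral_integrable[OF sym_int])
  have le: "norm (sym n s * \<theta>' j s) \<le> B * \<theta>' j s" if "s \<in> S" for n s
  proof -
    have "0 \<le> \<theta>' j s" using \<theta>'_nonneg[OF j, of s] that by (auto simp: S_def)
    moreover have "\<bar>sym n s\<bar> \<le> B" unfolding sym_def using c2(2)[of "d n" t s] d[of n] nz[OF that] by simp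
    ultimately show ?thesis by (simp add: abs_mult mult_right_mono)
  qed
  have lim: "(\<lambda>n. sym n s * \<theta>' j s) \<longlonglongrightarrow> 2 * (kernel j t s * \<theta>' j s)" if "s \<in> S" for s
  proof -
    have "(\<lambda>n. sym n s * \<theta>' j s) \<longlonglongrightarrow> Im (1 / (p.zeta t s - \<i> * of_real 0) + 1 / (p.zeta t s + \<i> * of_real 0)) * \<theta>' j s"
      unfolding sym_def by (intro tendsto_intros \<open>d \<longlonglongrightarrow> 0\<close>) (use nz[OF that] in auto)
    moreover have "Im (1 / (p.zeta t s - \<i> * of_real 0) + 1 / (p.zeta t s + \<i> * of_real 0)) = 2 * kernel j t s"
      by (simp only: kernel_def p.zeta_def of_real_0 mult_zero_right diff_0_right add_0_right
          plus_complex.simps divide_divide_eq_right mult_1_left mult_2)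
    ultimately show ?thesis by (simp add: mult.assoc)
  qed
  have dc: "(\<lambda>s. 2 * (kernel j t s * \<theta>' j s)) integrable_on S"
    "(\<lambda>n. integral S (\<lambda>s. sym n s * \<theta>' j s)) \<longlonglongrightarrow> integral S (\<lambda>s. 2 * (kernel j t s * \<theta>' j s))"
    using dominated_convergence[OF f dom le lim] by auto
  have "(\<lambda>s. (1 / 2) * (2 * (kernel j t s * \<theta>' j s))) integrable_on J_range"
    using dc(1) unfolding rem by (rule integrable_on_mult_right)
  then show "(\<lambda>s. kernel j t s * \<theta>' j s) integrable_on J_range" by simp
  have l1: "(\<lambda>n. Im (vderiv (z j) t * (C (inner j (d n) t) + C (outer j (d n) t)))) \<longlonglongrightarrow>
      2 * integral J_range (\<lambda>s. kernel j t s * \<theta>' j s)"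
    using dc(2) unfolding rem integral_unique[OF sym_int] by simp
  from tendsto_Im[OF filterlim_compose[OF curve_cauchy_jump[OF j t] lim_d]]
  have l2: "(\<lambda>n. Im (vderiv (z j) t * (C (inner j (d n) t) - C (outer j (d n) t)))) \<longlonglongrightarrow> 2 * pi * \<theta>' j t"
    by (simp add: C_def)
  have "(\<lambda>n. (Im (vderiv (z j) t * (C (inner j (d n) t) + C (outer j (d n) t))) -
      Im (vderiv (z j) t * (C (inner j (d n) t) - C (outer j (d n) t)))) / 2) \<longlonglongrightarrow>
      (2 * integral J_range (\<lambda>s. kernel j t s * \<theta>' j s) - 2 * pi * \<theta>' j t) / 2"
    by (intro tendsto_intros l1 l2) simp
  moreover have "(Im (v * (x + y)) - Im (v * (x - y))) / 2 = Im (v * y)" for v x y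
    by (simp add: algebra_simps)
  ultimately have "(\<lambda>n. Im (vderiv (z j) t * C (outer j (d n) t))) \<longlonglongrightarrow>
      integral J_range (\<lambda>s. kernel j t s * \<theta>' j s) - pi * \<theta>' j t"
    by (simp add: diff_divide_distrib)
  then show "\<exists>d. filterlim d (at_right 0) sequentially \<and>
      (\<lambda>n. Im (vderiv (z j) t * curve_cauchy j (outer j (d n) t))) \<longlonglongrightarrow>
      integral J_range (\<lambda>s. kernel j t s * \<theta>' j s) - pi * \<theta>' j t"
    using lim_d unfolding C_def by blast
qed

text \<open>The own curve contributes a bounded kernel whose diagonal value is irrelevant; the other
  curve contributes an ordinary Cauchy integral, taken at a point off that curve.\<close>

lemma Nstar_eq:
  assumes j: "j \<in> {0, 1}" and t: "t \<in> J_range"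
  shows "pi * Nstar_op z \<theta>' j t =
    - integral J_range (\<lambda>s. kernel j t s * \<theta>' j s) - Im (vderiv (z j) t * curve_cauchy (1 - j) (z j t))"
proof -
  define k where "k = 1 - j"
  have k: "k \<in> {0, 1}" "k \<noteq> j" using j by (auto simp: k_def)
  let ?I = "\<lambda>k. integral J_range (\<lambda>s. Nstar_kernel z j t k s * \<theta>' k s)"
  have "?I j = integral J_range (\<lambda>s. (- 1 / pi) * (kernel j t s * \<theta>' j s))"
  proof (rule integral_spike[of "{t}"])
    fix s assume "s \<in> J_range - {t}"
    then show "(- 1 / pi) * (kernel j t s * \<theta>' j s) = Nstar_kernel z j t j s * \<theta>' j s"
      by (simp add: Nstar_kernel_def kernel_def divide_diff_swap[of _ "z j t" "z j s"])
  qed simp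
  also have "\<dots> = (- 1 / pi) * integral J_range (\<lambda>s. kernel j t s * \<theta>' j s)" by (rule integral_mult_right)
  finally have Ij: "pi * ?I j = - integral J_range (\<lambda>s. kernel j t s * \<theta>' j s)" by simp
  have "((\<lambda>s. vderiv (z j) t * (complex_of_real (\<theta>' k s) / (z k s - z j t))) has_integral vderiv (z j) t * curve_cauchy k (z j t)) J_range"
    using notin_other_curve[OF j] unfolding k_def[symmetric]
    by (intro has_integral_mult_right curve_cauchy_has_integral k(1))
  from has_integral_linear[OF this bounded_linear_Im]
  have "((\<lambda>s. Im (vderiv (z j) t * (complex_of_real (\<theta>' k s) / (z k s - z j t)))) has_integral Im (vderiv (z j) t * curve_cauchy k (z j t))) J_range"
    by (simp add: o_def)
  from has_integral_mult_right[OF this, of "- 1 / pi"]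
  have "((\<lambda>s. (- 1 / pi) * Im (vderiv (z j) t * (complex_of_real (\<theta>' k s) / (z k s - z j t)))) has_integral
     (- 1 / pi) * Im (vderiv (z j) t * curve_cauchy k (z j t))) J_range" .
  moreover have "(- 1 / pi) * Im (vderiv (z j) t * (complex_of_real (\<theta>' k s) / (z k s - z j t))) =
      Nstar_kernel z j t k s * \<theta>' k s" for s
  proof -
    have "vderiv (z j) t * (complex_of_real (\<theta>' k s) / (z k s - z j t)) = of_real (\<theta>' k s) * - (vderiv (z j) t / (z j t - z k s))"
      unfolding divide_diff_swap[of "vderiv (z j) t" "z j t"] by simp
    then have "Im (vderiv (z j) t * (complex_of_real (\<theta>' k s) / (z k s - z j t))) = - (\<theta>' k s * Im (vderiv (z j) t / (z j t - z k s)))"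
      by (simp only: Im_of_real_mult uminus_complex.simps)
    then show ?thesis using k(2) by (simp add: Nstar_kernel_def)
  qed
  ultimately have "?I k = (- 1 / pi) * Im (vderiv (z j) t * curve_cauchy k (z j t))" by (simp add: integral_unique)
  then have Ik: "pi * ?I k = - Im (vderiv (z j) t * curve_cauchy k (z j t))" by simp
  have "Nstar_op z \<theta>' j t = ?I j + ?I k"
    using j by (auto simp: Nstar_op_def integral_J_def k_def)
  then show ?thesis using Ij Ik by (simp add: distrib_left k_def)
qed

definition target :: "nat \<Rightarrow> real \<Rightarrow> real" where
  "target j t = 2 * Im (vderiv (z j) t / (z j t - a0)) + 2 * Im (vderiv (z j) t / (z j t - a1))"

lemma boundary_ne_zeros: "j \<in> {0, 1} \<Longrightarrow> z j t \<noteq> a0" "j \<in> {0, 1} \<Longrightarrow> z j t \<noteq> a1"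
  using \<Omega>_disjoint z0.in_curve[of t] z1.in_curve[of t] zeros_in_\<Omega> by auto

text \<open>One and the same limit along the outer normal is computed from the jump relation and
  from the explicit formula outside.\<close>

lemma integral_equation_interior:
  assumes j: "j \<in> {0, 1}" and t: "0 < t" "t < 2 * pi"
  shows "\<theta>' j t + Nstar_op z \<theta>' j t = target j t"
proof -
  let ?v = "vderiv (z j) t"
  obtain d where d: "filterlim d (at_right 0) sequentially"
    "(\<lambda>n. Im (?v * curve_cauchy j (outer j (d n) t))) \<longlonglongrightarrow>
      integral J_range (\<lambda>s. kernel j t s * \<theta>' j s) - pi * \<theta>' j t"
    using own_curve_limit(2)[OF j t] by blast
  obtain c where c: "c > 0"
    "\<And>j t \<delta>. j \<in> {0, 1} \<Longrightarrow> 0 < \<delta> \<Longrightarrow> \<delta> < c \<Longrightarrow> outer j \<delta> t \<notin> closure \<Omega>"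
    by (rule inner_cycle) blast
  note out = inner_outer_tendsto(2)[of j t]
  have "((\<lambda>\<delta>. ?v * curve_cauchy (1 - j) (outer j \<delta> t)) \<longlongrightarrow> ?v * curve_cauchy (1 - j) (z j t)) (at_right 0)"
    by (intro tendsto_intros isCont_tendsto_compose[OF other_curve_isCont[OF j] out])
  from tendsto_add[OF d(2) tendsto_Im[OF filterlim_compose[OF this d(1)]]]
  have l1: "(\<lambda>n. Im (?v * cauchy (outer j (d n) t))) \<longlonglongrightarrow>
    integral J_range (\<lambda>s. kernel j t s * \<theta>' j s) - pi * \<theta>' j t + Im (?v * curve_cauchy (1 - j) (z j t))"
    using j by (auto simp: cauchy_def algebra_simps)
  have "((\<lambda>\<delta>. Im (?v * (2 * of_real pi * (1 / (a0 - outer j \<delta> t) + 1 / (a1 - outer j \<delta> t))))) \<longlongrightarrow>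
     Im (?v * (2 * of_real pi * (1 / (a0 - z j t) + 1 / (a1 - z j t))))) (at_right 0)"
    using boundary_ne_zeros[OF j, of t] by (intro tendsto_intros out) auto
  moreover have "\<forall>\<^sub>F \<delta> in at_right 0. Im (?v * (2 * of_real pi * (1 / (a0 - outer j \<delta> t) + 1 / (a1 - outer j \<delta> t)))) =
      Im (?v * cauchy (outer j \<delta> t))"
    by (rule eventually_at_rightI[OF _ c(1)]) (use cauchy_outside c(2)[OF j] in auto)
  ultimately have "((\<lambda>\<delta>. Im (?v * cauchy (outer j \<delta> t))) \<longlongrightarrow>
     Im (?v * (2 * of_real pi * (1 / (a0 - z j t) + 1 / (a1 - z j t))))) (at_right 0)"
    by (rule Lim_transform_eventually)
  from LIMSEQ_unique[OF l1 filterlim_compose[OF this d(1)]]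
  have "integral J_range (\<lambda>s. kernel j t s * \<theta>' j s) - pi * \<theta>' j t + Im (?v * curve_cauchy (1 - j) (z j t)) =
    Im (?v * (2 * of_real pi * (1 / (a0 - z j t) + 1 / (a1 - z j t))))" by simp
  also have "?v * (2 * of_real pi * (1 / (a0 - z j t) + 1 / (a1 - z j t))) =
    of_real (- 2 * pi) * (?v / (z j t - a0) + ?v / (z j t - a1))"
    unfolding divide_diff_swap[of 1 a0] divide_diff_swap[of 1 a1] by (simp add: algebra_simps)
  also have "Im \<dots> = - pi * target j t"
    unfolding Im_of_real_mult by (simp add: target_def algebra_simps)
  finally have "pi * (\<theta>' j t + Nstar_op z \<theta>' j t) = pi * target j t"
    using Nstar_eq[OF j, of t] t by (simp add: algebra_simps)
  then show ?thesis by simp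
qed

text \<open>The bound for \<open>kernel\<close> is uniform in both variables, so one majorant
  \<open>B * \<theta>' j s\<close> serves while the base point moves; continuity of
  \<open>\<theta>'\<close> does not enter.\<close>

lemma Nstar_tendsto_endpoint:
  assumes j: "j \<in> {0, 1}" and t: "t = 0 \<or> t = 2 * pi" and \<xi>: "\<And>n. 0 < \<xi> n" "\<And>n. \<xi> n < 2 * pi" "\<xi> \<longlonglongrightarrow> t"
  shows "(\<lambda>n. Nstar_op z \<theta>' j (\<xi> n)) \<longlonglongrightarrow> Nstar_op z \<theta>' j t"
proof -
  interpret p: jordan_param "z j" using j by (rule jordan_param)
  obtain B where B: "B \<ge> 0" "\<And>t s. \<bar>kernel j t s\<bar> \<le> B" by (rule kernel_bounded[OF j]) blast
  have zc: "(\<lambda>n. z j (\<xi> n)) \<longlonglongrightarrow> z j t" "(\<lambda>n. vderiv (z j) (\<xi> n)) \<longlonglongrightarrow> vderiv (z j) t"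
    using p.cont[of UNIV] p.cont1[of UNIV] \<xi>(3)
    by (auto simp: continuous_on_eq_continuous_at intro: isCont_tendsto_compose)
  define S where "S = J_range - {0, 2 * pi}"
  have fin: "finite {0, 2 * pi}" by simp
  note rem = integral_remove_finite[OF fin, where A = J_range, folded S_def]
  have "(\<lambda>s. B * \<theta>' j s) integrable_on J_range"
    using has_integral_mult_right[OF \<theta>'_integral[OF j]] by blast
  then have dom: "(\<lambda>s. B * \<theta>' j s) integrable_on S" by (simp only: rem)
  have f: "(\<lambda>s. kernel j (\<xi> n) s * \<theta>' j s) integrable_on S" for n
    unfolding rem by (rule own_curve_limit(1)[OF j \<xi>(1,2)])
  have le: "norm (kernel j (\<xi> n) s * \<theta>' j s) \<le> B * \<theta>' j s" if "s \<in> S" for n s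
  proof -
    have "0 \<le> \<theta>' j s" using \<theta>'_nonneg[OF j, of s] that by (auto simp: S_def)
    then show ?thesis using B(2)[of "\<xi> n" s] by (simp add: abs_mult mult_right_mono)
  qed
  have lim: "(\<lambda>n. kernel j (\<xi> n) s * \<theta>' j s) \<longlonglongrightarrow> kernel j t s * \<theta>' j s" if "s \<in> S" for s
  proof -
    have s: "0 < s" "s < 2 * pi" using that by (auto simp: S_def)
    \<comment> \<open>The arguments are exchanged because \<open>zeta_nonzero\<close> asks for an
      interior base point, which \<open>s\<close> is and \<open>t\<close> is not.\<close>
    have "p.zeta s t \<noteq> 0" by (rule p.zeta_nonzero[OF s]) (use t s in auto)
    then have "z j s - z j t \<noteq> 0" by (auto simp: p.zeta_def)
    then show ?thesis unfolding kernel_def by (intro tendsto_intros zc)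
  qed
  have "(\<lambda>n. integral S (\<lambda>s. kernel j (\<xi> n) s * \<theta>' j s)) \<longlonglongrightarrow> integral S (\<lambda>s. kernel j t s * \<theta>' j s)"
    by (rule dominated_convergence(2)[OF f dom le lim])
  then have "(\<lambda>n. (- integral J_range (\<lambda>s. kernel j (\<xi> n) s * \<theta>' j s) - Im (vderiv (z j) (\<xi> n) * curve_cauchy (1 - j) (z j (\<xi> n)))) / pi) \<longlonglongrightarrow>
     (- integral J_range (\<lambda>s. kernel j t s * \<theta>' j s) - Im (vderiv (z j) t * curve_cauchy (1 - j) (z j t))) / pi"
    unfolding rem by (intro tendsto_intros zc isCont_tendsto_compose[OF other_curve_isCont[OF j]]) auto
  moreover have "Nstar_op z \<theta>' j x = (- integral J_range (\<lambda>s. kernel j x s * \<theta>' j s) - Im (vderiv (z j) x * curve_cauchy (1 - j) (z j x))) / pi"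
    if "x \<in> J_range" for x using Nstar_eq[OF j that] by (simp add: field_simps)
  moreover have "\<xi> n \<in> J_range" for n using \<xi>(1,2)[of n] by auto
  moreover have "t \<in> J_range" using t by auto
  ultimately show ?thesis by simp
qed

text \<open>At the end points \<open>\<theta>' j t\<close> is only a one-sided derivative; difference quotients of \<open>\<theta> j\<close> are interior values of
  \<open>\<theta>' j\<close> by the mean value theorem, and these converge because \<open>\<^bold>N\<^sup>* \<theta>'\<close> is continuous at the end points.\<close>

lemma integral_equation:
  assumes j: "j \<in> {0, 1}" and t: "t \<in> J_range"
  shows "\<theta>' j t + Nstar_op z \<theta>' j t = target j t"
proof (cases "0 < t \<and> t < 2 * pi")
  case True
  then show ?thesis using integral_equation_interior[OF j] by blast
next
  case False
  then have t': "t = 0 \<or> t = 2 * pi" using t by auto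
  interpret p: jordan_param "z j" using j by (rule jordan_param)
  \<comment> \<open>The increments point into the interval: forwards at 0, backwards at
    \<open>2 * pi\<close>.\<close>
  define \<sigma> where "\<sigma> = (if t = 0 then 1 else - 1 :: real)"
  define h where "h = (\<lambda>n. \<sigma> / (real n + 1))"
  have h: "t + h n \<in> J_range" "h n \<noteq> 0" for n
  proof -
    have "1 / (real n + 1) \<le> 1" by simp
    also have "\<dots> \<le> 2 * pi" using pi_gt3 by simp
    finally show "t + h n \<in> J_range" "h n \<noteq> 0" using t' by (auto simp: h_def \<sigma>_def)
  qed
  have "h \<longlonglongrightarrow> 0" unfolding h_def by real_asymp
  have mvt: "\<exists>\<xi>. 0 < \<xi> \<and> \<xi> < 2 * pi \<and> \<bar>\<xi> - t\<bar> \<le> \<bar>h n\<bar> \<and> (\<theta> j (t + h n) - \<theta> j t) / h n = \<theta>' j \<xi>" for n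
  proof -
    define a b where "a = min t (t + h n)" and "b = max t (t + h n)"
    have ab: "a < b" "0 \<le> a" "b \<le> 2 * pi" using h[of n] t by (auto simp: a_def b_def)
    have D: "(\<theta> j has_real_derivative \<theta>' j x) (at x)" if "a < x" "x < b" for x
      by (rule \<theta>_has_real_derivative[OF j]) (use that ab in auto)
    have "continuous_on {a..b} (\<theta> j)" by (rule continuous_on_subset[OF cont_\<theta>[OF j]]) (use ab in auto)
    then obtain l \<xi> where l: "a < \<xi>" "\<xi> < b" "DERIV (\<theta> j) \<xi> :> l" "\<theta> j b - \<theta> j a = (b - a) * l"
      using MVT[OF ab(1), of "\<theta> j"] D real_differentiable_def by blast
    then have "l = \<theta>' j \<xi>" using DERIV_unique D by blast
    have "(\<theta> j (t + h n) - \<theta> j t) / h n = l"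
      using l(4) h(2)[of n] by (auto simp: a_def b_def min_def max_def field_simps split: if_splits)
    moreover have "\<bar>\<xi> - t\<bar> \<le> \<bar>h n\<bar>" using l(1,2) by (auto simp: a_def b_def)
    ultimately show ?thesis using l ab \<open>l = \<theta>' j \<xi>\<close> by (intro exI[of _ \<xi>]) auto
  qed
  then obtain \<xi> where \<xi>: "\<And>n. 0 < \<xi> n" "\<And>n. \<xi> n < 2 * pi" "\<And>n. \<bar>\<xi> n - t\<bar> \<le> \<bar>h n\<bar>"
    "\<And>n. (\<theta> j (t + h n) - \<theta> j t) / h n = \<theta>' j (\<xi> n)" by metis
  have "(\<lambda>n. \<bar>h n\<bar>) \<longlonglongrightarrow> 0" using tendsto_rabs[OF \<open>h \<longlonglongrightarrow> 0\<close>] by simp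
  then have "(\<lambda>n. \<xi> n - t) \<longlonglongrightarrow> 0" by (rule Lim_null_comparison[rotated]) (use \<xi>(3) in auto)
  then have "\<xi> \<longlonglongrightarrow> t" by (rule LIM_zero_cancel)
  have "(\<theta> j has_real_derivative \<theta>' j t) (at t within J_range)"
    using \<theta>_has_deriv[OF j t] by (simp add: has_real_derivative_iff_has_vector_derivative)
  then have "((\<lambda>y. (\<theta> j y - \<theta> j t) / (y - t)) \<longlongrightarrow> \<theta>' j t) (at t within J_range)"
    unfolding has_field_derivative_iff .
  moreover have "filterlim (\<lambda>n. t + h n) (at t within J_range) sequentially"
    using tendsto_add[OF tendsto_const[of t] \<open>h \<longlonglongrightarrow> 0\<close>] h
    by (intro filterlim_at_withinI) auto
  ultimately have "(\<lambda>n. (\<theta> j (t + h n) - \<theta> j t) / (t + h n - t)) \<longlonglongrightarrow> \<theta>' j t" by (rule filterlim_compose)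
  then have l1: "(\<lambda>n. \<theta>' j (\<xi> n)) \<longlonglongrightarrow> \<theta>' j t" by (simp add: \<xi>(4))
  have zc: "(\<lambda>n. z j (\<xi> n)) \<longlonglongrightarrow> z j t" "(\<lambda>n. vderiv (z j) (\<xi> n)) \<longlonglongrightarrow> vderiv (z j) t"
    using p.cont[of UNIV] p.cont1[of UNIV] \<open>\<xi> \<longlonglongrightarrow> t\<close>
    by (auto simp: continuous_on_eq_continuous_at intro: isCont_tendsto_compose)
  have l2: "(\<lambda>n. target j (\<xi> n)) \<longlonglongrightarrow> target j t"
    unfolding target_def using boundary_ne_zeros[OF j, of t] by (intro tendsto_intros zc) auto
  have "(\<lambda>n. \<theta>' j (\<xi> n) + Nstar_op z \<theta>' j (\<xi> n)) \<longlonglongrightarrow> \<theta>' j t + Nstar_op z \<theta>' j t"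
    by (intro tendsto_add l1 Nstar_tendsto_endpoint[OF j t' \<xi>(1,2) \<open>\<xi> \<longlonglongrightarrow> t\<close>])
  then show ?thesis
    using LIMSEQ_unique[OF l2] integral_equation_interior[OF j \<xi>(1,2)] by simp
qed

text \<open>In \<open>phi\<close> the term of \<open>J_op\<close> cancels \<open>psi\<close>, and
  \<open>k1\<close> subtracts exactly the \<open>a0\<close> part of \<open>target\<close>.\<close>

lemma k1_eq:
  assumes "j \<in> {0, 1}" "t \<in> J_range"
  shows "k1 z a0 \<theta> j t = Im (vderiv (z j) t / (z j t - a1))"
  using integral_equation[OF assms] J_op_eq_psi[of j t]
  by (simp add: k1_def phi_def target_def)

end

theorem mainTheorem4:
  fixes \<Omega> :: "complex set" and z :: "nat \<Rightarrow> real \<Rightarrow> complex"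
    and f :: "complex \<Rightarrow> complex" and \<theta> :: "nat \<Rightarrow> real \<Rightarrow> real"
    and a0 a1 :: complex and \<alpha> \<beta> :: real
  assumes "doubly_connected_region \<Omega> z"
    and "a0 \<in> \<Omega>"
    and "ahlfors_map \<Omega> a0 f"
    and "continuous_on (closure \<Omega>) f"
    and "zeros_with_multiplicity f \<Omega> {#a0, a1#}"
    and "a1 = complex_of_real \<alpha> + \<i> * complex_of_real \<beta>"
    and "boundary_correspondence f z \<theta>"
  shows "\<forall>j\<in>{0, 1}. \<forall>t\<in>{0..2 * pi}.
    (let x = (\<lambda>t. Re (z j t)); y = (\<lambda>t. Im (z j t));
         \<kappa>1 = k1 z a0 \<theta> j t;
         \<kappa>2 = deriv y t - 2 * \<kappa>1 * x t;
         \<kappa>3 = - 2 * \<kappa>1 * y t - deriv x t;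
         \<kappa>4 = \<kappa>1 * (x t)\<^sup>2 + \<kappa>1 * (y t)\<^sup>2 + deriv x t * y t - deriv y t * x t
     in Im (vderiv (z j) t / (z j t - a1)) = \<kappa>1 \<and>
        \<kappa>2 * \<alpha> + \<kappa>3 * \<beta> + \<kappa>1 * (\<alpha>\<^sup>2 + \<beta>\<^sup>2) = - \<kappa>4)"
proof -
  have comp: "ahlfors_competitor \<Omega> a0 f" using assms(3) unfolding ahlfors_map_def by blast
  have dc: "doubly_connected \<Omega> z" by unfold_locales (rule assms(1))
  \<comment> \<open>A competitor has a positive derivative at \<open>a0\<close> and cannot vanish
    identically.\<close>
  have "\<exists>w\<in>\<Omega>. f w \<noteq> 0"
  proof (rule ccontr)
    assume "\<not> (\<exists>w\<in>\<Omega>. f w \<noteq> 0)"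
    then have "(f has_field_derivative 0) (at a0)"
      using has_field_derivative_transform_within_open[OF DERIV_const[of 0] doubly_connected.open_\<Omega>[OF dc] assms(2), of f]
      by auto
    then have "deriv f a0 = 0" by (rule DERIV_imp_deriv)
    then show False using comp unfolding ahlfors_competitor_def by simp
  qed
  then interpret inner_function \<Omega> z f \<theta> a0 a1
    using assms comp by unfold_locales (auto simp: ahlfors_competitor_def)
  show ?thesis
  proof (intro ballI)
    fix j t assume j: "j \<in> {0, 1::nat}" and t: "t \<in> {0..2 * pi}"
    interpret p: jordan_param "z j" using j by (rule jordan_param)
    define \<kappa> where "\<kappa> = k1 z a0 \<theta> j t"
    define x y x' y' where xy: "x = Re (z j t)" "y = Im (z j t)" "x' = Re (vderiv (z j) t)" "y' = Im (vderiv (z j) t)"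
    have \<kappa>: "Im (vderiv (z j) t / (z j t - a1)) = \<kappa>" using k1_eq[OF j t] by (simp add: \<kappa>_def)
    have dx: "deriv (\<lambda>t. Re (z j t)) t = x'"
      using bounded_linear.has_vector_derivative[OF bounded_linear_Re p.has_deriv[of t UNIV]]
      by (intro DERIV_imp_deriv) (simp add: has_real_derivative_iff_has_vector_derivative xy)
    have dy: "deriv (\<lambda>t. Im (z j t)) t = y'"
      using bounded_linear.has_vector_derivative[OF bounded_linear_Im p.has_deriv[of t UNIV]]
      by (intro DERIV_imp_deriv) (simp add: has_real_derivative_iff_has_vector_derivative xy)
    \<comment> \<open>\<open>D\<close> is the squared distance of the boundary point from
      \<open>a1\<close>. Multiplying the first identity by it and sorting by \<alpha> and \<beta>
      gives the second.\<close>
    define D where "D = (x - \<alpha>)\<^sup>2 + (y - \<beta>)\<^sup>2"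
    have "D \<noteq> 0" using boundary_ne_zeros(2)[OF j, of t] assms(6)
      by (auto simp: D_def xy complex_eq_iff sum_power2_eq_zero_iff)
    moreover have "\<kappa> = (y' * (x - \<alpha>) - x' * (y - \<beta>)) / D"
      unfolding \<kappa>[symmetric] by (simp add: Im_divide assms(6) xy D_def)
    ultimately have "\<kappa> * D = y' * (x - \<alpha>) - x' * (y - \<beta>)" by simp
    then have "(y' - 2 * \<kappa> * x) * \<alpha> + (- 2 * \<kappa> * y - x') * \<beta> + \<kappa> * (\<alpha>\<^sup>2 + \<beta>\<^sup>2) =
        - (\<kappa> * x\<^sup>2 + \<kappa> * y\<^sup>2 + x' * y - y' * x)"
      unfolding D_def by (simp add: power2_eq_square algebra_simps)
    then show "(let x = (\<lambda>t. Re (z j t)); y = (\<lambda>t. Im (z j t));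
         \<kappa>1 = k1 z a0 \<theta> j t;
         \<kappa>2 = deriv y t - 2 * \<kappa>1 * x t;
         \<kappa>3 = - 2 * \<kappa>1 * y t - deriv x t;
         \<kappa>4 = \<kappa>1 * (x t)\<^sup>2 + \<kappa>1 * (y t)\<^sup>2 + deriv x t * y t - deriv y t * x t
     in Im (vderiv (z j) t / (z j t - a1)) = \<kappa>1 \<and>
        \<kappa>2 * \<alpha> + \<kappa>3 * \<beta> + \<kappa>1 * (\<alpha>\<^sup>2 + \<beta>\<^sup>2) = - \<kappa>4)"
      unfolding Let_def dx dy \<kappa>_def[symmetric] xy(1,2)[symmetric] using \<kappa> by blast
  qed
qed

end
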